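(* Let $N\ge2$ and consider the half-duplex relay fading channel with one source, $N-1$ relays and one destination described in the context. The diversity-multiplexing tradeoff achieved by the dynamic decode-and-forward (DDF) protocol with $N-1$ relays is $$d(r)=\begin{cases}N(1-r), & 0\le r\le \tfrac1N,\\[2pt] 1+\dfrac{(N-1)(1-2r)}{1-r}, & \tfrac1N\le r\le\tfrac12,\\[6pt] \dfrac{1-r}{r}, & \tfrac12\le r\le 1.\end{cases}$$
   Context: Channel. All channels (source-destination, source-relay, relay-relay, relay-destination) are flat, Rayleigh-fading and quasi-static: all channel gains are mutually independent zero-mean unit-variance circularly-symmetric complex Gaussian random variables, constant over a codeword of $l$ symbol-intervals (which spans a whole coherence interval). Noises are zero-mean, mutually independent, circularly-symmetric white complex Gaussian, of variance $\sigma_w^2$ at the relays and $\sigma_v^2$ at the destination, with $c=\sigma_v^2/\sigma_w^2$ a fixed constant. Each node has one antenna, operates synchronously, and may use average energy at most $E$ per transmitted symbol; $\rho=E/\sigma_v^2$ is the signal-to-noise ratio. Channel gains are known only at receiving nodes; there is no feedback to transmitters. Half-duplex: a node cannot transmit and receive at the same time. DDF protocol with $N-1$ relays. The source transmits at rate $R$ bits per channel use during all $l$ symbol-intervals, using a random Gaussian code-book. Each relay listens until the mutual information between its received signal and the signals transmitted by the source and by the other (already transmitting) relays exceeds $lR$; this mutual information accumulates $\log_2(1+c\rho\sum_i|h_i|^2)$ per symbol-interval, the sum being over the gains $h_i$ to that relay from all nodes (source and relays) transmitting in that interval. Once this happens, the relay decodes the message, re-encodes it with its own independent Gaussian code-book,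 and transmits for the rest of the codeword; a relay for which this does not happen before the end of the codeword never transmits. The word "exceeds" is understood strictly (if necessary with an additional margin of $o(l)$ symbols), so that the channel coding theorem applies: given the channel realization and correct decoding at the previously activated relays, the decoding error probability of a relay that starts transmitting can be made arbitrarily small by taking $l$ large. All relays and the destination know all code-books and the times at which each relay starts transmitting; the cost of conveying these times (beacons, quantization of starting times) is ignored. In a symbol-interval in which a set $S$ of nodes (containing the source) is transmitting symbols $x_i$, the destination receives $\sum_{i\in S}g_ix_i$ plus noise, $g_i$ being the gain from node $i$ to the destination. The destination knows the $g_i$ and uses maximum-likelihood (ML) decoding. Code-lengths are asymptotically large: $P_E(\rho)$ refers to the regime $l\to\infty$ at each $\rho$. Diversity and multiplexing. With rate $R(\rho)$ and ML error probability $P_E(\rho)$ at the destination (averaged over the fading and the code ensemble), the multiplexing gain is $r=\lim_{\rho\to\infty}R(\rho)/\log\rho$ and the diversity gain is $d=-\lim_{\rho\to\infty}\log P_E(\rho)/\log\rho$; $d(r)$ is the diversity gain achieved at multiplexing gain $r$.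
   Formalization: The rate R(ρ) is assumed to be eventually bounded away from 0; this is automatic for r > 0, and at r = 0 it excludes vanishing rates such as R = 0 or R = 1/ρ, for which d(0) = N fails. *)

theory Defs
  imports "HOL-Probability.Probability"
begin

text \<open>Variance of a complex random variable is the expected squared modulus, so a circularly-symmetric
  complex Gaussian of variance \<open>s\<close> has independent real and imaginary parts of variance \<open>s/2\<close>.\<close>

definition cgauss_density :: "real \<Rightarrow> complex \<Rightarrow> real" where
  "cgauss_density s z = exp (- (cmod z)\<^sup>2 / s) / (pi * s)"

definition cgauss :: "real \<Rightarrow> complex measure" where
  "cgauss s = density lborel (\<lambda>z. ennreal (cgauss_density s z))"

text \<open>Nodes are numbered \<open>0, \<dots>, nodes - 1\<close>; node \<open>0\<close> is the source, the others are the relays.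
  The symbol-intervals of a codeword are \<open>0, \<dots>, len - 1\<close>; \<open>rate\<close> is in bits per channel use.\<close>

record ddf =
  nodes :: nat
  relay_noise_var :: real
  dest_noise_var :: real
  snr :: real
  rate :: real
  len :: nat
  margin :: nat

definition symbol_energy :: "ddf \<Rightarrow> real" where
  "symbol_energy p = snr p * dest_noise_var p"

definition noise_ratio :: "ddf \<Rightarrow> real" where
  "noise_ratio p = dest_noise_var p / relay_noise_var p"

definition num_messages :: "ddf \<Rightarrow> nat" where
  "num_messages p = nat \<lfloor>2 powr (real (len p) * rate p)\<rfloor>"

text \<open>The elementary random variables. \<open>Relay_Gain i j\<close> is the gain from node \<open>i\<close> to relay \<open>j\<close>,
  \<open>Code_Symbol i m t\<close> is the symbol for interval \<open>t\<close> in node \<open>i\<close>'s codeword for message \<open>m\<close>.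
  They are realised as the coordinates of a product space, hence mutually independent.\<close>

datatype coord =
    Relay_Gain nat nat
  | Dest_Gain nat
  | Code_Symbol nat nat nat
  | Relay_Noise nat nat
  | Dest_Noise nat

fun coord_variance :: "ddf \<Rightarrow> coord \<Rightarrow> real" where
  "coord_variance p (Relay_Gain i j) = 1"
| "coord_variance p (Dest_Gain i) = 1"
| "coord_variance p (Code_Symbol i m t) = symbol_energy p"
| "coord_variance p (Relay_Noise j t) = relay_noise_var p"
| "coord_variance p (Dest_Noise t) = dest_noise_var p"

definition ddf_space :: "ddf \<Rightarrow> (coord \<Rightarrow> complex) measure" where
  "ddf_space p = PiM UNIV (\<lambda>k. cgauss (coord_variance p k))"

text \<open>Set of nodes transmitting in interval \<open>t\<close>. Since accumulated information is nondecreasing, relay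
  \<open>j\<close> transmits in interval \<open>t\<close> iff its information over the first \<open>t - margin\<close> intervals
  exceeds \<open>len * rate\<close>, i.e. it starts exactly \<open>margin\<close> intervals after that first happens. For
  \<open>t < margin\<close> the truncated subtraction gives an empty sum, which does not exceed a positive
  \<open>len * rate\<close>. Removing \<open>j\<close> from the index set of the inner sum only affects intervals in which
  \<open>j\<close> already transmits.\<close>

function transmitting :: "ddf \<Rightarrow> (coord \<Rightarrow> complex) \<Rightarrow> nat \<Rightarrow> nat set" where
  "transmitting p \<omega> t = insert 0 {j \<in> {1..<nodes p}.
     (\<Sum>\<tau><t - margin p. log 2 (1 + noise_ratio p * snr p *
        (\<Sum>i\<in>transmitting p \<omega> \<tau> - {j}. (cmod (\<omega> (Relay_Gain i j)))\<^sup>2)))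
     > real (len p) * rate p}"
  by pat_completeness auto
termination
  by (relation "Wellfounded.measure (\<lambda>(p, \<omega>, t). t)") auto

declare transmitting.simps [simp del]

text \<open>Maximum-likelihood decision among \<open>M\<close> messages from the observations \<open>y t\<close>, \<open>t \<in> T\<close>, in Gaussian
  noise of variance \<open>s\<close>, where message \<open>m\<close> would produce the noiseless signal \<open>x m t\<close>.
  Ties go to the smallest message.\<close>

definition ml_decode ::
    "real \<Rightarrow> nat \<Rightarrow> nat set \<Rightarrow> (nat \<Rightarrow> nat \<Rightarrow> complex) \<Rightarrow> (nat \<Rightarrow> complex) \<Rightarrow> nat" where
  "ml_decode s M T x y =
     (LEAST m. is_arg_max (\<lambda>m. \<Prod>t\<in>T. cgauss_density s (y t - x m t)) (\<lambda>m. m < M) m)"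

lemma ml_decode_cong [fundef_cong]:
  assumes "s = s'" "M = M'" "T = T'" "x = x'" "\<And>t. t \<in> T' \<Longrightarrow> y t = y' t"
  shows "ml_decode s M T x y = ml_decode s' M' T' x' y'"
proof -
  have "(\<lambda>m. \<Prod>t\<in>T'. cgauss_density s' (y t - x' m t))
      = (\<lambda>m. \<Prod>t\<in>T'. cgauss_density s' (y' t - x' m t))"
    using assms(5) by (intro ext prod.cong) auto
  then show ?thesis
    unfolding ml_decode_def assms(1-4) by simp
qed

text \<open>\<open>encoded p \<omega> w t j\<close> is the message whose codeword node \<open>j\<close> sends in interval \<open>t\<close> (meaningful
  for \<open>j \<in> transmitting p \<omega> t\<close>) when the source message is \<open>w\<close>. For a relay it is its decision based on
  all intervals in which it listened; its received signal contains what the active relays really send,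
  including their decoding errors, while its likelihoods suppose that those relays decoded correctly.\<close>

function encoded :: "ddf \<Rightarrow> (coord \<Rightarrow> complex) \<Rightarrow> nat \<Rightarrow> nat \<Rightarrow> nat \<Rightarrow> nat" where
  "encoded p \<omega> w t j = (if j = 0 then w else
     ml_decode (relay_noise_var p) (num_messages p) {\<tau>. \<tau> < t \<and> j \<notin> transmitting p \<omega> \<tau>}
       (\<lambda>m \<tau>. \<Sum>i\<in>transmitting p \<omega> \<tau>. \<omega> (Relay_Gain i j) * \<omega> (Code_Symbol i m \<tau>))
       (\<lambda>\<tau>. (\<Sum>i\<in>transmitting p \<omega> \<tau>. \<omega> (Relay_Gain i j) * \<omega> (Code_Symbol i (encoded p \<omega> w \<tau> i) \<tau>))
            + \<omega> (Relay_Noise j \<tau>)))"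
  by pat_completeness auto
termination
  by (relation "Wellfounded.measure (\<lambda>(p, \<omega>, w, t, j). t)") auto

declare encoded.simps [simp del]

definition dest_received :: "ddf \<Rightarrow> (coord \<Rightarrow> complex) \<Rightarrow> nat \<Rightarrow> nat \<Rightarrow> complex" where
  "dest_received p \<omega> w t =
     (\<Sum>i\<in>transmitting p \<omega> t. \<omega> (Dest_Gain i) * \<omega> (Code_Symbol i (encoded p \<omega> w t i) t))
     + \<omega> (Dest_Noise t)"

definition dest_decision :: "ddf \<Rightarrow> (coord \<Rightarrow> complex) \<Rightarrow> nat \<Rightarrow> nat" where
  "dest_decision p \<omega> w =
     ml_decode (dest_noise_var p) (num_messages p) {..<len p}
       (\<lambda>m t. \<Sum>i\<in>transmitting p \<omega> t. \<omega> (Dest_Gain i) * \<omega> (Code_Symbol i m t))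
       (dest_received p \<omega> w)"

text \<open>Average over equiprobable messages, the fading, the noise and the code ensemble.\<close>

definition error_prob :: "ddf \<Rightarrow> real" where
  "error_prob p = (\<Sum>w<num_messages p.
      measure (ddf_space p) {\<omega> \<in> space (ddf_space p). dest_decision p \<omega> w \<noteq> w})
    / real (num_messages p)"

definition has_multiplexing_gain :: "(real \<Rightarrow> real) \<Rightarrow> real \<Rightarrow> bool" where
  "has_multiplexing_gain R r \<longleftrightarrow> ((\<lambda>\<rho>. R \<rho> / log 2 \<rho>) \<longlongrightarrow> r) at_top"

text \<open>Positivity is required explicitly because \<open>log 2 0 = 0\<close> in HOL.\<close>

definition has_diversity_gain :: "(real \<Rightarrow> real) \<Rightarrow> real \<Rightarrow> bool" where
  "has_diversity_gain P d \<longleftrightarrow>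
     (\<forall>\<^sub>F \<rho> in at_top. P \<rho> > 0) \<and> ((\<lambda>\<rho>. - (log 2 (P \<rho>) / log 2 \<rho>)) \<longlongrightarrow> d) at_top"

text \<open>Upper and lower error probability in the regime of infinite code-length. Making a claim about both
  avoids presupposing that the error probability converges as the code-length grows.\<close>

definition long_code_error_sup :: "(nat \<Rightarrow> ddf) \<Rightarrow> real" where
  "long_code_error_sup p = real_of_ereal (limsup (\<lambda>l. ereal (error_prob (p l))))"

definition long_code_error_inf :: "(nat \<Rightarrow> ddf) \<Rightarrow> real" where
  "long_code_error_inf p = real_of_ereal (liminf (\<lambda>l. ereal (error_prob (p l))))"

text \<open>The additional listening time is \<open>o(l)\<close> symbols. It has to dominate the fluctuations of order
  \<open>sqrt l\<close> of the information density, otherwise the decoding error at a relay that stops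
  listening right at the threshold does not vanish.\<close>

definition admissible_margin :: "(nat \<Rightarrow> nat) \<Rightarrow> bool" where
  "admissible_margin \<mu> \<longleftrightarrow> (\<lambda>l. real (\<mu> l) / real l) \<longlonglongrightarrow> 0 \<and>
     filterlim (\<lambda>l. real (\<mu> l) / sqrt (real l)) at_top sequentially"

definition ddf_family ::
    "nat \<Rightarrow> real \<Rightarrow> real \<Rightarrow> (real \<Rightarrow> real) \<Rightarrow> (nat \<Rightarrow> nat) \<Rightarrow> real \<Rightarrow> nat \<Rightarrow> ddf" where
  "ddf_family N \<sigma>w2 \<sigma>v2 R \<mu> \<rho> l =
     \<lparr>nodes = N, relay_noise_var = \<sigma>w2, dest_noise_var = \<sigma>v2, snr = \<rho>, rate = R \<rho>,
      len = l, margin = \<mu> l\<rparr>"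

end

theory Submission
  imports Defs "HOL-Real_Asymp.Real_Asymp"
begin

text \<open>Fix the channel gains; then the times at which the relays start transmitting are fixed too. Suppose first
  that all active relays decode correctly. The received signal of every receiver is then that of a random
  Gaussian code over parallel Gaussian channels, and the \<open>s\<close>-th moments (\<open>-1 < s < 1\<close>) of the exponentiated
  information density are explicit Gaussian integrals. Markov's inequality with \<open>s\<close> of order \<open>1 / sqrt l\<close> shows that
  decoding succeeds when the information exceeds \<open>l * R\<close> by much more than \<open>sqrt l\<close>, and (after a change of
  measure to the output distribution) that it fails when the information is that much too small. The
  listening margin makes all relay errors negligible. By dominated convergence over the gains, the limiting error
  probability is squeezed between the probabilities of two outage events.

  For the upper bound, write the squared gains as \<open>\<rho> powr (- v\<^sub>i)\<close> (destination) and \<open>\<rho> powr (- u\<^sub>j)\<close> (source to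
  relay \<open>j\<close>), and let relays listen to the source only. With \<open>x = min v\<^sub>0 1\<close>, no outage occurs as soon as \<open>1 - v\<^sub>0 > r\<close> or
  \<open>u\<^sub>j + v\<^sub>j < 1 - r * x / (1 - r)\<close> for a single relay \<open>j\<close>. Hence \<open>v\<^sub>0 + (\<Sum>j. u\<^sub>j + v\<^sub>j) \<ge> d(r)\<close> in outage, and
  Markov's inequality for a negative fractional moment of the product of all gains bounds its probability.
  For the lower bound, one explicit box of gains suffices.\<close>

section \<open>Complex Gaussian integrals\<close>

text \<open>A relay hears the decisions of earlier relays, so conditioning on their correctness
  would destroy the independence of the code symbols. Instead, on the same sample point, every
  receiver is compared with a fictitious one to which all active relays send the right codeword. If
  the fictitious relays all decide correctly, induction on time shows that the real system agrees
  with the fictitious one, and a union bound over at most \<open>N\<close> relays suffices. The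
  transmitting sets depend on the gains only, so redrawing code-books and noises leaves them
  unchanged; this replaces conditioning by a product integral. A squared gain is exponentially
  distributed, so its exponent exceeds \<open>v\<close> with probability of order
  \<open>\<rho> powr (- v)\<close>, and a sum of independent exponents exceeds \<open>D\<close> with
  probability of order \<open>\<rho> powr (- D)\<close> up to logarithms. The moment of order
  \<open>-(1 - e)\<close> is finite for every small \<open>e > 0\<close>, so Markov's inequality
  loses only an arbitrarily small part of the exponent and no integral over the outage region is
  needed. Capping squared gains at 1 keeps the exponents nonnegative: a large gain must not
  compensate a small one.\<close>

lemma distr_Complex_lborel:
  "distr (lborel \<Otimes>\<^sub>M lborel) borel (\<lambda>(x, y). Complex x y) = (lborel :: complex measure)"
proof (rule lborel_eqI[symmetric])
  have [measurable]: "(\<lambda>(x, y). Complex x y) \<in> borel_measurable (lborel \<Otimes>\<^sub>M lborel)"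
    by (simp add: Complex_eq split_beta)
  fix l u :: complex
  assume le: "\<And>b. b \<in> Basis \<Longrightarrow> l \<bullet> b \<le> u \<bullet> b"
  have le': "Re l \<le> Re u" "Im l \<le> Im u"
    using le[of 1] le[of \<i>] by (auto simp: Basis_complex_def)
  have "(\<lambda>(x, y). Complex x y) -` box l u \<inter> space (lborel \<Otimes>\<^sub>M lborel)
      = {Re l<..<Re u} \<times> {Im l<..<Im u}"
    by (auto simp: box_def Basis_complex_def space_pair_measure)
  then have "emeasure (distr (lborel \<Otimes>\<^sub>M lborel) borel (\<lambda>(x, y). Complex x y)) (box l u)
      = emeasure (lborel \<Otimes>\<^sub>M lborel) ({Re l<..<Re u} \<times> {Im l<..<Im u})"
    by (simp add: emeasure_distr)
  also have "\<dots> = ennreal (Re u - Re l) * ennreal (Im u - Im l)"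
    using le' by (subst lborel.emeasure_pair_measure_Times) auto
  also have "\<dots> = (\<Prod>b\<in>Basis. (u - l) \<bullet> b)"
    using le' by (simp add: Basis_complex_def ennreal_mult complex_eq_iff)
  finally show "emeasure (distr (lborel \<Otimes>\<^sub>M lborel) borel (\<lambda>(x, y). Complex x y)) (box l u)
      = (\<Prod>b\<in>Basis. (u - l) \<bullet> b)" .
qed simp

lemma borel_measurable_Complex [measurable (raw)]:
  assumes [measurable]: "f \<in> borel_measurable M" "g \<in> borel_measurable M"
  shows "(\<lambda>x. Complex (f x) (g x)) \<in> borel_measurable M"
  by (simp add: Complex_eq)

lemma nn_integral_lborel_complex:
  fixes f :: "complex \<Rightarrow> ennreal"
  assumes [measurable]: "f \<in> borel_measurable borel"
  shows "(\<integral>\<^sup>+z. f z \<partial>lborel) = (\<integral>\<^sup>+x. \<integral>\<^sup>+y. f (Complex x y) \<partial>lborel \<partial>lborel)"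
proof -
  have "(\<integral>\<^sup>+z. f z \<partial>lborel) = (\<integral>\<^sup>+p. f (case p of (x, y) \<Rightarrow> Complex x y) \<partial>(lborel \<Otimes>\<^sub>M lborel))"
    by (subst distr_Complex_lborel[symmetric], subst nn_integral_distr) (auto simp: split_beta)
  also have "\<dots> = (\<integral>\<^sup>+x. \<integral>\<^sup>+y. f (Complex x y) \<partial>lborel \<partial>lborel)"
    by (subst lborel.nn_integral_fst[symmetric]) (auto simp: split_beta)
  finally show ?thesis .
qed

lemma nn_integral_lborel_complex':
  fixes f :: "complex \<Rightarrow> ennreal"
  assumes [measurable]: "f \<in> borel_measurable borel"
  shows "(\<integral>\<^sup>+z. f z \<partial>lborel) = (\<integral>\<^sup>+y. \<integral>\<^sup>+x. f (Complex x y) \<partial>lborel \<partial>lborel)"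
  unfolding nn_integral_lborel_complex[OF assms]
  by (subst lborel_pair.Fubini'[symmetric]) (auto simp: split_beta)

text \<open>Multiplication by \<open>a + b\<i>\<close> with \<open>a \<noteq> 0\<close> is a product of two shears with diagonal entries \<open>a\<close> and
  \<open>(a\<^sup>2 + b\<^sup>2) / a\<close>; each is an affine substitution in one real variable.\<close>

lemma nn_integral_lborel_mult_complex:
  fixes f :: "complex \<Rightarrow> ennreal"
  assumes [measurable]: "f \<in> borel_measurable borel" and h: "h \<noteq> 0"
  shows "(\<integral>\<^sup>+z. f z \<partial>lborel) = ennreal ((cmod h)\<^sup>2) * (\<integral>\<^sup>+z. f (h * z) \<partial>lborel)"
proof -
  define a b where "a = Re h" and "b = Im h"
  have hm: "h * Complex x y = Complex (a * x - b * y) (b * x + a * y)" for x y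
    by (simp add: a_def b_def complex_eq_iff)
  have cm: "(cmod h)\<^sup>2 = a\<^sup>2 + b\<^sup>2" by (simp add: cmod_power2 a_def b_def)
  show ?thesis
  proof (cases "a = 0")
    case True
    \<comment> \<open>With \<open>a = 0\<close> the shears have no pivot; here \<open>h\<close>
      merely swaps the two axes and scales each by \<open>b\<close> up to sign.\<close>
    then have b: "b \<noteq> 0" using h by (auto simp: a_def b_def complex_eq_iff)
    have "(\<integral>\<^sup>+z. f (h * z) \<partial>lborel) = (\<integral>\<^sup>+x. \<integral>\<^sup>+y. f (Complex (- b * y) (b * x)) \<partial>lborel \<partial>lborel)"
      using True by (subst nn_integral_lborel_complex) (auto simp: hm)
    also have "ennreal \<bar>b\<bar> * \<dots> = (\<integral>\<^sup>+x. ennreal \<bar>b\<bar> * (\<integral>\<^sup>+y. f (Complex (- b * y) (b * x)) \<partial>lborel) \<partial>lborel)"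
      by (simp add: nn_integral_cmult)
    also have "\<dots> = (\<integral>\<^sup>+x. (\<integral>\<^sup>+y. f (Complex y (b * x)) \<partial>lborel) \<partial>lborel)"
      using b by (subst (2) nn_integral_real_affine[where c="-b" and t=0]) auto
    also have "ennreal \<bar>b\<bar> * \<dots> = (\<integral>\<^sup>+x. (\<integral>\<^sup>+y. f (Complex y x) \<partial>lborel) \<partial>lborel)"
      using b by (subst (2) nn_integral_real_affine[where c="b" and t=0]) auto
    also have "\<dots> = (\<integral>\<^sup>+z. f z \<partial>lborel)"
      by (rule nn_integral_lborel_complex'[symmetric]) simp
    finally show ?thesis
      unfolding cm using True by (simp add: ennreal_mult[symmetric] mult.assoc[symmetric] power2_eq_square)
  next
    case False
    define k where "k = (a\<^sup>2 + b\<^sup>2) / a"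
    have k: "k \<noteq> 0" using False by (simp add: k_def sum_power2_eq_zero_iff)
    have "(\<integral>\<^sup>+z. f (h * z) \<partial>lborel)
        = (\<integral>\<^sup>+y. \<integral>\<^sup>+x. f (Complex (a * x - b * y) (b * x + a * y)) \<partial>lborel \<partial>lborel)"
      by (subst nn_integral_lborel_complex') (auto simp: hm)
    also have "ennreal \<bar>a\<bar> * \<dots>
        = (\<integral>\<^sup>+y. ennreal \<bar>a\<bar> * (\<integral>\<^sup>+x. f (Complex (a * x - b * y) (b * x + a * y)) \<partial>lborel) \<partial>lborel)"
      by (simp add: nn_integral_cmult)
    also have "\<dots> = (\<integral>\<^sup>+y. (\<integral>\<^sup>+x. f (Complex x (b / a * x + k * y)) \<partial>lborel) \<partial>lborel)"
    proof (rule nn_integral_cong)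
      fix y :: real
      have eq: "b / a * (- b * y + a * x) + k * y = b * x + a * y" for x
        using False by (simp add: k_def field_simps power2_eq_square)
      show "ennreal \<bar>a\<bar> * (\<integral>\<^sup>+x. f (Complex (a * x - b * y) (b * x + a * y)) \<partial>lborel)
          = (\<integral>\<^sup>+x. f (Complex x (b / a * x + k * y)) \<partial>lborel)"
        using nn_integral_real_affine[where c=a and t="- b * y" and f="\<lambda>x. f (Complex x (b / a * x + k * y))"] False
        unfolding eq by simp
    qed
    also have "\<dots> = (\<integral>\<^sup>+x. \<integral>\<^sup>+y. f (Complex x (b / a * x + k * y)) \<partial>lborel \<partial>lborel)"
      by (subst lborel_pair.Fubini') (auto simp: split_beta)
    also have "ennreal \<bar>k\<bar> * \<dots> = (\<integral>\<^sup>+x. ennreal \<bar>k\<bar> * (\<integral>\<^sup>+y. f (Complex x (b / a * x + k * y)) \<partial>lborel) \<partial>lborel)"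
      by (simp add: nn_integral_cmult)
    also have "\<dots> = (\<integral>\<^sup>+x. \<integral>\<^sup>+y. f (Complex x y) \<partial>lborel \<partial>lborel)"
    proof (rule nn_integral_cong)
      fix x :: real
      show "ennreal \<bar>k\<bar> * (\<integral>\<^sup>+y. f (Complex x (b / a * x + k * y)) \<partial>lborel)
          = (\<integral>\<^sup>+y. f (Complex x y) \<partial>lborel)"
        using k by (subst (2) nn_integral_real_affine[where c=k and t="b / a * x"]) auto
    qed
    also have "\<dots> = (\<integral>\<^sup>+z. f z \<partial>lborel)"
      by (rule nn_integral_lborel_complex[symmetric]) simp
    finally have "(\<integral>\<^sup>+z. f z \<partial>lborel) = ennreal (\<bar>k\<bar> * \<bar>a\<bar>) * (\<integral>\<^sup>+z. f (h * z) \<partial>lborel)"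
      by (simp add: ennreal_mult mult.assoc)
    moreover have "\<bar>k\<bar> * \<bar>a\<bar> = (cmod h)\<^sup>2"
      using False by (simp add: cm k_def abs_mult[symmetric])
    ultimately show ?thesis by simp
  qed
qed

lemma nn_integral_lborel_add_complex:
  fixes f :: "complex \<Rightarrow> ennreal"
  assumes [measurable]: "f \<in> borel_measurable borel"
  shows "(\<integral>\<^sup>+z. f (a + z) \<partial>lborel) = (\<integral>\<^sup>+z. f z \<partial>lborel)"
  by (subst (2) lborel_affine[of 1 a])
     (simp_all add: nn_integral_density nn_integral_distr one_ennreal_def[symmetric])

lemma nn_integral_exp_square_real:
  assumes "k > (0::real)"
  shows "(\<integral>\<^sup>+x. ennreal (exp (- (k * x\<^sup>2))) \<partial>lborel) = ennreal (sqrt (pi / k))"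
proof -
  \<comment> \<open>For variance \<open>1 / (2 * k)\<close> the exponent of the normal density is
    exactly that of the integrand, so total mass 1 gives the integral.\<close>
  define s where "s = sqrt (1 / (2 * k))"
  have s: "s > 0" "s\<^sup>2 = 1 / (2 * k)" using assms by (auto simp: s_def)
  interpret prob_space "density lborel (normal_density 0 s)"
    by (rule prob_space_normal_density) (use s in auto)
  have "1 = (\<integral>\<^sup>+x. ennreal (normal_density 0 s x) \<partial>lborel)"
    using emeasure_space_1 by (simp add: emeasure_density)
  also have "\<dots> = (\<integral>\<^sup>+x. ennreal (1 / sqrt (pi / k)) * ennreal (exp (- (k * x\<^sup>2))) \<partial>lborel)"
    by (intro nn_integral_cong, subst ennreal_mult[symmetric])
       (use assms in \<open>auto simp: normal_density_def s real_sqrt_divide field_simps\<close>)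
  also have "\<dots> = ennreal (1 / sqrt (pi / k)) * (\<integral>\<^sup>+x. ennreal (exp (- (k * x\<^sup>2))) \<partial>lborel)"
    by (simp add: nn_integral_cmult)
  finally have "ennreal (sqrt (pi / k)) * 1 = ennreal (sqrt (pi / k)) * (ennreal (1 / sqrt (pi / k)) * (\<integral>\<^sup>+x. ennreal (exp (- (k * x\<^sup>2))) \<partial>lborel))"
    by simp
  also have "\<dots> = (\<integral>\<^sup>+x. ennreal (exp (- (k * x\<^sup>2))) \<partial>lborel)"
    using assms by (simp add: mult.assoc[symmetric] ennreal_mult[symmetric])
  finally show ?thesis by simp
qed

lemma nn_integral_exp_square_complex:
  assumes k: "k > 0"
  shows "(\<integral>\<^sup>+z. ennreal (exp (- (k * (cmod (a + z))\<^sup>2))) \<partial>lborel) = ennreal (pi / k)"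
proof -
  have "(\<integral>\<^sup>+z. ennreal (exp (- (k * (cmod (a + z))\<^sup>2))) \<partial>lborel) = (\<integral>\<^sup>+z. ennreal (exp (- (k * (cmod z)\<^sup>2))) \<partial>lborel)"
    by (rule nn_integral_lborel_add_complex) simp
  also have "\<dots> = (\<integral>\<^sup>+x. \<integral>\<^sup>+y. ennreal (exp (- (k * x\<^sup>2))) * ennreal (exp (- (k * y\<^sup>2))) \<partial>lborel \<partial>lborel)"
    by (subst nn_integral_lborel_complex)
       (auto simp: ennreal_mult[symmetric] exp_add[symmetric] cmod_power2 algebra_simps)
  also have "\<dots> = ennreal (sqrt (pi / k)) * ennreal (sqrt (pi / k))"
    by (simp add: nn_integral_cmult nn_integral_multc nn_integral_exp_square_real[OF k])
  also have "\<dots> = ennreal (pi / k)"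
    using k by (simp add: ennreal_mult[symmetric])
  finally show ?thesis .
qed


section \<open>Circularly-symmetric Gaussian measures\<close>

lemma space_cgauss [simp]: "space (cgauss s) = UNIV"
  by (simp add: cgauss_def)

lemma sets_cgauss [simp, measurable_cong]: "sets (cgauss s) = sets borel"
  by (simp add: cgauss_def)

lemma cgauss_density_measurable [measurable]: "cgauss_density s \<in> borel_measurable borel"
  unfolding cgauss_density_def by measurable

lemma cgauss_density_pos: "s > 0 \<Longrightarrow> cgauss_density s z > 0"
  by (simp add: cgauss_density_def)

lemma nn_integral_cgauss:
  "f \<in> borel_measurable borel \<Longrightarrow>
    (\<integral>\<^sup>+z. f z \<partial>cgauss s) = (\<integral>\<^sup>+z. ennreal (cgauss_density s z) * f z \<partial>lborel)"
  unfolding cgauss_def by (subst nn_integral_density) auto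

lemma complete_square:
  fixes c s x n :: real
  assumes "s > 0" "1 + c * s > 0"
  shows "x\<^sup>2 / s + c * (x + n)\<^sup>2
    = (c + 1 / s) * (c * s / (1 + c * s) * n + x)\<^sup>2 + c / (1 + c * s) * n\<^sup>2"
proof -
  define u where "u = 1 + c * s"
  have c: "c = (u - 1) / s" and u: "u > 0" using assms by (auto simp: u_def)
  show ?thesis unfolding u_def[symmetric] unfolding c using u assms(1)
    by (simp add: field_simps power2_eq_square)
qed

text \<open>Completing the square merges density and exponential into one shifted Gaussian of
  precision \<open>c + 1 / s\<close>, which is positive because \<open>1 + c * s > 0\<close>. Thus
  \<open>c\<close> may be negative, which both signs of the moment order require.\<close>

lemma nn_integral_cgauss_exp:
  assumes s: "s > 0" and c: "1 + c * s > 0"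
  shows "(\<integral>\<^sup>+x. ennreal (exp (- (c * (cmod (x + n))\<^sup>2))) \<partial>cgauss s)
    = ennreal (exp (- (c / (1 + c * s) * (cmod n)\<^sup>2)) / (1 + c * s))"
proof -
  define k where "k = c + 1 / s"
  define w where "w = of_real (c * s / (1 + c * s)) * n"
  have k: "k > 0" and ks: "k * s = 1 + c * s" using assms by (auto simp: k_def field_simps)
  have sq: "(cmod x)\<^sup>2 / s + c * (cmod (x + n))\<^sup>2 = k * (cmod (w + x))\<^sup>2 + c / (1 + c * s) * (cmod n)\<^sup>2" for x
    using complete_square[OF s c, of "Re x" "Re n"] complete_square[OF s c, of "Im x" "Im n"]
    unfolding cmod_power2 k_def[symmetric]
    by (simp add: w_def add_divide_distrib distrib_left)
  have "(\<integral>\<^sup>+x. ennreal (exp (- (c * (cmod (x + n))\<^sup>2))) \<partial>cgauss s)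
    = (\<integral>\<^sup>+x. ennreal (exp (- (c / (1 + c * s) * (cmod n)\<^sup>2)) / (pi * s))
        * ennreal (exp (- (k * (cmod (w + x))\<^sup>2))) \<partial>lborel)"
  proof (subst nn_integral_cgauss, simp, rule nn_integral_cong)
    fix x
    have "exp (- (cmod x)\<^sup>2 / s) * exp (- (c * (cmod (x + n))\<^sup>2))
      = exp (- (c / (1 + c * s) * (cmod n)\<^sup>2)) * exp (- (k * (cmod (w + x))\<^sup>2))"
      using sq[of x] by (simp add: exp_add[symmetric])
    then show "ennreal (cgauss_density s x) * ennreal (exp (- (c * (cmod (x + n))\<^sup>2)))
      = ennreal (exp (- (c / (1 + c * s) * (cmod n)\<^sup>2)) / (pi * s)) * ennreal (exp (- (k * (cmod (w + x))\<^sup>2)))"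
      using s by (simp add: cgauss_density_def ennreal_mult[symmetric])
  qed
  also have "\<dots> = ennreal (exp (- (c / (1 + c * s) * (cmod n)\<^sup>2)) / (pi * s)) * ennreal (pi / k)"
    by (simp add: nn_integral_cmult nn_integral_exp_square_complex[OF k])
  also have "\<dots> = ennreal (exp (- (c / (1 + c * s) * (cmod n)\<^sup>2)) / (1 + c * s))"
    using s k by (subst ennreal_mult[symmetric]) (auto simp: ks[symmetric] mult_ac)
  finally show ?thesis .
qed

lemma prob_space_cgauss: "s > 0 \<Longrightarrow> prob_space (cgauss s)"
  using nn_integral_cgauss_exp[of s 0 0] by (intro prob_spaceI) simp

lemma distr_cgauss_mult:
  assumes s: "s > 0" and h: "h \<noteq> 0"
  shows "distr (cgauss s) borel (\<lambda>z. h * z) = cgauss ((cmod h)\<^sup>2 * s)"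
proof (rule measure_eqI)
  fix A assume "A \<in> sets (distr (cgauss s) borel (\<lambda>z. h * z))"
  then have [measurable]: "A \<in> sets borel" by simp
  have "emeasure (distr (cgauss s) borel (\<lambda>z. h * z)) A = (\<integral>\<^sup>+z. indicator A (h * z) \<partial>cgauss s)"
    by (subst nn_integral_indicator[symmetric], simp, subst nn_integral_distr) auto
  also have "\<dots> = (\<integral>\<^sup>+z. ennreal (cgauss_density s z) * indicator A (h * z) \<partial>lborel)"
    by (subst nn_integral_cgauss) auto
  also have "\<dots> = (\<integral>\<^sup>+z. ennreal ((cmod h)\<^sup>2) * (ennreal (cgauss_density ((cmod h)\<^sup>2 * s) (h * z)) * indicator A (h * z)) \<partial>lborel)"
    using h s by (intro nn_integral_cong) (simp add: cgauss_density_def mult.assoc[symmetric] ennreal_mult[symmetric] norm_mult power_mult_distrib)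
  also have "\<dots> = ennreal ((cmod h)\<^sup>2) * (\<integral>\<^sup>+z. (ennreal (cgauss_density ((cmod h)\<^sup>2 * s) (h * z)) * indicator A (h * z)) \<partial>lborel)"
    by (subst nn_integral_cmult) auto
  also have "\<dots> = (\<integral>\<^sup>+z. (ennreal (cgauss_density ((cmod h)\<^sup>2 * s) z) * indicator A z) \<partial>lborel)"
    by (rule nn_integral_lborel_mult_complex[symmetric]) (use h in auto)
  also have "\<dots> = emeasure (cgauss ((cmod h)\<^sup>2 * s)) A"
    by (simp add: cgauss_def emeasure_density)
  finally show "emeasure (distr (cgauss s) borel (\<lambda>z. h * z)) A = emeasure (cgauss ((cmod h)\<^sup>2 * s)) A" .
qed simp

lemma cgauss_density_convolution:
  assumes s: "s > 0" and t: "t > 0"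
  shows "(\<integral>\<^sup>+x. ennreal (cgauss_density t (z - x)) \<partial>cgauss s) = ennreal (cgauss_density (s + t) z)"
proof -
  have c: "1 + 1 / t * s = (s + t) / t" using t by (simp add: field_simps)
  have "(\<integral>\<^sup>+x. ennreal (cgauss_density t (z - x)) \<partial>cgauss s)
    = (\<integral>\<^sup>+x. ennreal (1 / (pi * t)) * ennreal (exp (- (1 / t * (cmod (x + (- z)))\<^sup>2))) \<partial>cgauss s)"
    using t by (intro nn_integral_cong, subst ennreal_mult[symmetric]) (auto simp: cgauss_density_def norm_minus_commute)
  also have "\<dots> = ennreal (1 / (pi * t)) * (\<integral>\<^sup>+x. ennreal (exp (- (1 / t * (cmod (x + (- z)))\<^sup>2))) \<partial>cgauss s)"
    by (rule nn_integral_cmult) simp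
  also have "\<dots> = ennreal (cgauss_density (s + t) z)"
    using s t by (subst nn_integral_cgauss_exp) (simp_all only: c, auto simp: cgauss_density_def ennreal_mult[symmetric])
  finally show ?thesis .
qed

lemma distr_cgauss_add:
  assumes s: "s > 0" and t: "t > 0"
  shows "distr (cgauss s \<Otimes>\<^sub>M cgauss t) borel (\<lambda>(x, y). x + y) = cgauss (s + t)"
proof (rule measure_eqI)
  interpret S: prob_space "cgauss s" by (rule prob_space_cgauss[OF s])
  interpret T: prob_space "cgauss t" by (rule prob_space_cgauss[OF t])
  interpret P: pair_sigma_finite "cgauss s" lborel ..
  fix A assume "A \<in> sets (distr (cgauss s \<Otimes>\<^sub>M cgauss t) borel (\<lambda>(x, y). x + y))"
  then have [measurable]: "A \<in> sets borel" by simp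
  have "emeasure (distr (cgauss s \<Otimes>\<^sub>M cgauss t) borel (\<lambda>(x, y). x + y)) A
    = (\<integral>\<^sup>+p. indicator A (fst p + snd p) \<partial>(cgauss s \<Otimes>\<^sub>M cgauss t))"
    by (subst nn_integral_indicator[symmetric], simp, subst nn_integral_distr) (auto simp: split_beta)
  also have "\<dots> = (\<integral>\<^sup>+x. \<integral>\<^sup>+y. indicator A (x + y) \<partial>cgauss t \<partial>cgauss s)"
    by (subst T.nn_integral_fst[symmetric]) auto
  also have "\<dots> = (\<integral>\<^sup>+x. \<integral>\<^sup>+y. ennreal (cgauss_density t y) * indicator A (x + y) \<partial>lborel \<partial>cgauss s)"
    by (subst nn_integral_cgauss) auto
  also have "\<dots> = (\<integral>\<^sup>+x. \<integral>\<^sup>+z. ennreal (cgauss_density t (z - x)) * indicator A z \<partial>lborel \<partial>cgauss s)"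
  proof (rule nn_integral_cong)
    fix x :: complex
    show "(\<integral>\<^sup>+y. ennreal (cgauss_density t y) * indicator A (x + y) \<partial>lborel)
      = (\<integral>\<^sup>+z. ennreal (cgauss_density t (z - x)) * indicator A z \<partial>lborel)"
      by (subst nn_integral_lborel_add_complex[of "\<lambda>z. ennreal (cgauss_density t (z - x)) * indicator A z" x, symmetric]) auto
  qed
  also have "\<dots> = (\<integral>\<^sup>+z. \<integral>\<^sup>+x. ennreal (cgauss_density t (z - x)) * indicator A z \<partial>cgauss s \<partial>lborel)"
    by (rule P.Fubini'[symmetric]) (auto simp: split_beta)
  also have "\<dots> = (\<integral>\<^sup>+z. ennreal (cgauss_density (s + t) z) * indicator A z \<partial>lborel)"
    by (simp add: nn_integral_multc cgauss_density_convolution[OF s t])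
  also have "\<dots> = emeasure (cgauss (s + t)) A"
    by (simp add: cgauss_def emeasure_density)
  finally show "emeasure (distr (cgauss s \<Otimes>\<^sub>M cgauss t) borel (\<lambda>(x, y). x + y)) A = emeasure (cgauss (s + t)) A" .
qed simp

lemma AE_cgauss_nonzero: "AE z in cgauss s. z \<noteq> 0"
  unfolding cgauss_def by (subst AE_density) (auto intro: AE_mp[OF AE_lborel_singleton[of 0]])

text \<open>The density is at most \<open>1 / pi\<close> and the disc lies in a square of area
  \<open>4 * a\<close>; then \<open>4 / pi \<le> 2\<close>.\<close>

lemma cgauss_ball_le:
  assumes a: "a \<ge> 0"
  shows "emeasure (cgauss 1) {z. (cmod z)\<^sup>2 \<le> a} \<le> ennreal (2 * a)"
proof -
  have "emeasure (cgauss 1) {z. (cmod z)\<^sup>2 \<le> a}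
    = (\<integral>\<^sup>+z. ennreal (cgauss_density 1 z) * indicator {z. (cmod z)\<^sup>2 \<le> a} z \<partial>lborel)"
    by (simp add: cgauss_def emeasure_density)
  also have "\<dots> \<le> (\<integral>\<^sup>+z. ennreal (1 / pi) * indicator (cbox (Complex (- sqrt a) (- sqrt a)) (Complex (sqrt a) (sqrt a))) z \<partial>lborel)"
  proof (rule nn_integral_mono)
    fix z :: complex
    have "z \<in> cbox (Complex (- sqrt a) (- sqrt a)) (Complex (sqrt a) (sqrt a))" if "(cmod z)\<^sup>2 \<le> a"
    proof -
      have "(Re z)\<^sup>2 \<le> a" "(Im z)\<^sup>2 \<le> a"
        using that zero_le_power2[of "Re z"] zero_le_power2[of "Im z"] unfolding cmod_power2 by linarith+
      then have "\<bar>Re z\<bar> \<le> sqrt a" "\<bar>Im z\<bar> \<le> sqrt a" by (auto intro!: real_le_rsqrt)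
      then show ?thesis by (auto simp: in_cbox_complex_iff)
    qed
    then show "ennreal (cgauss_density 1 z) * indicator {z. (cmod z)\<^sup>2 \<le> a} z
      \<le> ennreal (1 / pi) * indicator (cbox (Complex (- sqrt a) (- sqrt a)) (Complex (sqrt a) (sqrt a))) z"
      by (auto simp: cgauss_density_def divide_right_mono intro!: ennreal_leI split: split_indicator)
  qed
  also have "\<dots> = ennreal (1 / pi) * ennreal (4 * a)"
    using a by (subst nn_integral_cmult_indicator) (auto simp: emeasure_lborel_cbox_eq Basis_complex_def complex_eq_iff)
  also have "\<dots> \<le> ennreal (2 * a)"
    using a pi_ge_two mult_right_mono[OF pi_ge_two a]
    by (subst ennreal_mult[symmetric]) (auto intro!: ennreal_leI simp: field_simps)
  finally show ?thesis .
qed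

text \<open>For \<open>a \<le> 1\<close> the density on the disc is at least
  \<open>exp (- 1) / pi\<close>, and the disc contains an inscribed square of area
  \<open>2 * a\<close>.\<close>

lemma cgauss_ball_ge:
  assumes a: "a \<ge> 0" "a \<le> 1"
  shows "ennreal (2 * exp (- 1) / pi * a) \<le> emeasure (cgauss 1) {z. (cmod z)\<^sup>2 \<le> a}"
proof -
  let ?B = "cbox (Complex (- sqrt (a / 2)) (- sqrt (a / 2))) (Complex (sqrt (a / 2)) (sqrt (a / 2)))"
  have "ennreal (2 * exp (- 1) / pi * a) = ennreal (exp (- 1) / pi) * ennreal (2 * a)"
    using a by (subst ennreal_mult[symmetric]) auto
  also have "\<dots> = (\<integral>\<^sup>+z. ennreal (exp (- 1) / pi) * indicator ?B z \<partial>lborel)"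
    using a by (subst nn_integral_cmult_indicator)
      (auto simp: emeasure_lborel_cbox_eq Basis_complex_def complex_eq_iff algebra_simps)
  also have "\<dots> \<le> (\<integral>\<^sup>+z. ennreal (cgauss_density 1 z) * indicator {z. (cmod z)\<^sup>2 \<le> a} z \<partial>lborel)"
  proof (rule nn_integral_mono)
    fix z :: complex
    have "(cmod z)\<^sup>2 \<le> a" if "z \<in> ?B"
    proof -
      have "\<bar>Re z\<bar> \<le> sqrt (a / 2)" "\<bar>Im z\<bar> \<le> sqrt (a / 2)"
        using that by (auto simp: in_cbox_complex_iff)
      then have "\<bar>Re z\<bar>\<^sup>2 \<le> (sqrt (a / 2))\<^sup>2" "\<bar>Im z\<bar>\<^sup>2 \<le> (sqrt (a / 2))\<^sup>2"
        by (intro power_mono; simp)+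
      then show ?thesis using a by (simp add: cmod_power2)
    qed
    then show "ennreal (exp (- 1) / pi) * indicator ?B z
        \<le> ennreal (cgauss_density 1 z) * indicator {z. (cmod z)\<^sup>2 \<le> a} z"
      using a by (auto simp: cgauss_density_def divide_right_mono intro!: ennreal_leI split: split_indicator)
  qed
  also have "\<dots> = emeasure (cgauss 1) {z. (cmod z)\<^sup>2 \<le> a}"
    by (simp add: cgauss_def emeasure_density)
  finally show ?thesis .
qed

text \<open>Dyadic decomposition: where the squared modulus is about \<open>2 powr - k\<close> the
  integrand is at most \<open>2 powr ((k + 1) * (1 - e))\<close>, while the disc has mass of order
  \<open>2 powr - k\<close>. The resulting series is geometric with ratio
  \<open>2 powr (- e) < 1\<close>.\<close>

lemma nn_integral_cgauss_min_powr_finite: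
  assumes e: "0 < e" "e < 1"
  shows "(\<integral>\<^sup>+z. ennreal ((min 1 ((cmod z)\<^sup>2)) powr (- (1 - e))) \<partial>cgauss 1) < \<infinity>"
proof -
  interpret prob_space "cgauss 1" by (rule prob_space_cgauss) simp
  define c where "c k = 2 powr ((real k + 1) * (1 - e))" for k
  define B where "B k = {z. (cmod z)\<^sup>2 \<le> 2 powr - real k}" for k
  have [measurable]: "B k \<in> sets borel" for k unfolding B_def by measurable
  have "ennreal ((min 1 ((cmod z)\<^sup>2)) powr (- (1 - e))) \<le> 1 + (\<Sum>k. ennreal (c k) * indicator (B k) z)" for z
  proof -
    consider "z = 0" | "(cmod z)\<^sup>2 \<ge> 1" | "0 < (cmod z)\<^sup>2" "(cmod z)\<^sup>2 < 1" by fastforce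
    then show ?thesis
    proof cases
      \<comment> \<open>The integrand is 0 here, not infinite, since \<open>0 powr x = 0\<close> in
        HOL.\<close>
      case 1 then show ?thesis by simp
    next
      case 2 then show ?thesis by (simp add: min_absorb1)
    next
      case 3
      define x where "x = (cmod z)\<^sup>2"
      \<comment> \<open>Index of the dyadic shell:
        \<open>2 powr - (k + 1) < x \<le> 2 powr - k\<close>.\<close>
      define k where "k = nat \<lfloor>- log 2 x\<rfloor>"
      have x: "0 < x" "x < 1" using 3 by (auto simp: x_def)
      have l: "0 \<le> - log 2 x" using x by simp
      have k1: "real k \<le> - log 2 x" "- log 2 x < real k + 1" using l unfolding k_def by linarith+
      have "z \<in> B k"
      proof -
        have "x = 2 powr (log 2 x)" using x by simp
        also have "\<dots> \<le> 2 powr (- real k)" using k1 by (intro powr_mono) auto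
        finally show ?thesis by (simp add: B_def x_def)
      qed
      have "x powr (- (1 - e)) = (2 powr log 2 x) powr (- (1 - e))"
        using x by simp
      also have "\<dots> = 2 powr (- log 2 x * (1 - e))"
        unfolding powr_powr by (simp add: algebra_simps)
      also have "\<dots> \<le> c k" unfolding c_def using e k1 by (intro powr_mono mult_right_mono) auto
      finally have "ennreal (x powr (- (1 - e))) \<le> ennreal (c k) * indicator (B k) z"
        using \<open>z \<in> B k\<close> by (simp add: ennreal_leI)
      also have "\<dots> = (\<Sum>j\<in>{k}. ennreal (c j) * indicator (B j) z)"
        by (simp only: sum.insert finite.emptyI empty_iff not_False_eq_True sum.empty add_0_right)
      also have "\<dots> \<le> (\<Sum>k. ennreal (c k) * indicator (B k) z)"
        by (rule sum_le_suminf) auto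
      finally show ?thesis using x by (auto simp: x_def[symmetric] min_absorb2 intro: order_trans add_increasing)
    qed
  qed
  then have "(\<integral>\<^sup>+z. ennreal ((min 1 ((cmod z)\<^sup>2)) powr (- (1 - e))) \<partial>cgauss 1)
    \<le> (\<integral>\<^sup>+z. 1 + (\<Sum>k. ennreal (c k) * indicator (B k) z) \<partial>cgauss 1)"
    by (intro nn_integral_mono)
  also have "\<dots> = 1 + (\<Sum>k. ennreal (c k) * emeasure (cgauss 1) (B k))"
    using emeasure_space_1 by (simp add: nn_integral_add nn_integral_suminf nn_integral_cmult_indicator)
  also have "\<dots> \<le> 1 + (\<Sum>k. ennreal (4 * (2 powr (- e)) ^ k))"
  proof (intro add_left_mono suminf_le)
    fix k
    have "emeasure (cgauss 1) (B k) \<le> ennreal (2 * 2 powr - real k)"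
      unfolding B_def by (rule cgauss_ball_le) simp
    then have "ennreal (c k) * emeasure (cgauss 1) (B k) \<le> ennreal (c k) * ennreal (2 * 2 powr - real k)"
      by (rule mult_left_mono) simp
    also have "\<dots> = ennreal (c k * (2 * 2 powr - real k))"
      by (subst ennreal_mult) (auto simp: c_def)
    also have "c k * (2 * 2 powr - real k) = 2 * 2 powr (1 - e) * 2 powr (- e * real k)"
      by (simp add: c_def powr_add[symmetric] algebra_simps)
    also have "2 powr (- e * real k) = (2 powr (- e)) ^ k"
      by (simp add: powr_realpow[symmetric] powr_powr)
    also have "2 * 2 powr (1 - e) * (2 powr (- e)) ^ k \<le> 4 * (2 powr (- e)) ^ k"
      using powr_mono[of "1 - e" 1 2] e by (intro mult_right_mono) auto
    finally show "ennreal (c k) * emeasure (cgauss 1) (B k) \<le> ennreal (4 * (2 powr (- e)) ^ k)"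
      by (simp add: ennreal_leI)
  qed auto
  also have "\<dots> < \<infinity>"
  proof -
    have "summable (\<lambda>k. 4 * (2 powr (- e)) ^ k)"
      using e powr_less_mono[of "-e" 0 2] by (intro summable_mult summable_geometric) auto
    then have "(\<Sum>k. ennreal (4 * (2 powr (- e)) ^ k)) = ennreal (\<Sum>k. 4 * (2 powr (- e)) ^ k)"
      by (intro suminf_ennreal2) auto
    then show ?thesis by simp
  qed
  finally show ?thesis .
qed

text \<open>The function \<open>info_ratio \<sigma> \<tau>\<close> is the exponential of the information density of a channel use
  with noise \<open>n\<close> of variance \<open>\<sigma>\<close>, received value \<open>y\<close> and Gaussian input of variance \<open>\<tau>\<close>.\<close>

definition info_ratio :: "real \<Rightarrow> real \<Rightarrow> complex \<Rightarrow> complex \<Rightarrow> real" where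
  "info_ratio \<sigma> \<tau> n y = cgauss_density \<sigma> n / cgauss_density (\<sigma> + \<tau>) y"

lemma info_ratio_measurable [measurable (raw)]:
  assumes [measurable]: "f \<in> borel_measurable M" "g \<in> borel_measurable M"
  shows "(\<lambda>x. info_ratio \<sigma> \<tau> (f x) (g x)) \<in> borel_measurable M"
  unfolding info_ratio_def by measurable

lemma info_ratio_pos: "\<sigma> > 0 \<Longrightarrow> \<tau> > 0 \<Longrightarrow> info_ratio \<sigma> \<tau> n y > 0"
  by (simp add: info_ratio_def cgauss_density_pos)

text \<open>Both integrals are of the form of \<open>nn_integral_cgauss_exp\<close>, first over the
  input with coefficient \<open>c\<close>, then over the noise with coefficient \<open>c'\<close>;
  \<open>\<bar>s\<bar> < 1\<close> keeps both precisions positive. The correction to the leading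
  term \<open>(1 + \<tau> / \<sigma>) powr s\<close> is of second order in \<open>s\<close> and
  bounded independently of the signal-to-noise ratio.\<close>

lemma nn_integral_info_ratio_powr:
  assumes sg: "\<sigma> > 0" and tau: "\<tau> > 0" and s: "-1 < s" "s < 1"
  shows "(\<integral>\<^sup>+n. \<integral>\<^sup>+x. ennreal (info_ratio \<sigma> \<tau> n (x + n) powr s) \<partial>cgauss \<tau> \<partial>cgauss \<sigma>)
    \<le> ennreal ((1 + \<tau> / \<sigma>) powr s / (1 - s\<^sup>2))"
proof -
  define c where "c = - s / (\<sigma> + \<tau>)"
  define c' where "c' = s / \<sigma> + c / (1 + c * \<tau>)"
  define K where "K = ((\<sigma> + \<tau>) / \<sigma>) powr s"
  have st: "\<sigma> + \<tau> > 0" using sg tau by simp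
  have d: "\<sigma> + \<tau> - s * \<tau> > 0" using mult_strict_right_mono[OF s(2) tau] sg by linarith
  have c1: "1 + c * \<tau> = (\<sigma> + \<tau> - s * \<tau>) / (\<sigma> + \<tau>)"
    using st by (simp add: c_def field_simps)
  have c1p: "1 + c * \<tau> > 0" using d st by (simp add: c1)
  have s2: "s\<^sup>2 < 1" using s by (simp add: abs_square_less_1)
  have d2: "\<sigma> + \<tau> - s\<^sup>2 * \<tau> > 0" using mult_strict_right_mono[OF s2 tau] sg by linarith
  have c'0: "c' = s / \<sigma> - s / (\<sigma> + \<tau> - s * \<tau>)"
    using st by (simp add: c'_def c1, simp add: c_def)
  have c2: "1 + c' * \<sigma> = (\<sigma> + \<tau> - s\<^sup>2 * \<tau>) / (\<sigma> + \<tau> - s * \<tau>)"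
  proof -
    have "1 + c' * \<sigma> = 1 + (s - s * \<sigma> / (\<sigma> + \<tau> - s * \<tau>))"
      using sg by (simp add: c'0 left_diff_distrib)
    also have "\<dots> = ((1 + s) * (\<sigma> + \<tau> - s * \<tau>) - s * \<sigma>) / (\<sigma> + \<tau> - s * \<tau>)"
      using d by (simp add: diff_divide_distrib)
    also have "(1 + s) * (\<sigma> + \<tau> - s * \<tau>) - s * \<sigma> = \<sigma> + \<tau> - s\<^sup>2 * \<tau>"
      by (simp add: algebra_simps power2_eq_square)
    finally show ?thesis .
  qed
  have c2p: "1 + c' * \<sigma> > 0" using d d2 by (simp add: c2)
  have K: "K > 0" using sg st by (simp add: K_def)
  have r: "info_ratio \<sigma> \<tau> n y powr s = K * exp (- (s / \<sigma> * (cmod n)\<^sup>2)) * exp (- (c * (cmod y)\<^sup>2))" for n y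
  proof -
    have 1: "info_ratio \<sigma> \<tau> n y = (\<sigma> + \<tau>) / \<sigma> * exp (- (cmod n)\<^sup>2 / \<sigma> + (cmod y)\<^sup>2 / (\<sigma> + \<tau>))"
    proof -
      have "\<And>a b :: real. b > 0 \<Longrightarrow> a / (pi * \<sigma>) / (b / (pi * (\<sigma> + \<tau>))) = (\<sigma> + \<tau>) / \<sigma> * (a * inverse b)"
        using sg st by (simp add: field_simps)
      then show ?thesis
        unfolding info_ratio_def cgauss_density_def exp_add by (simp add: exp_minus[symmetric])
    qed
    have 2: "exp (- (cmod n)\<^sup>2 / \<sigma> + (cmod y)\<^sup>2 / (\<sigma> + \<tau>)) powr s
        = exp (- (s / \<sigma> * (cmod n)\<^sup>2)) * exp (- (c * (cmod y)\<^sup>2))"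
      unfolding powr_def by (simp add: exp_add[symmetric] c_def algebra_simps)
    have "info_ratio \<sigma> \<tau> n y powr s = ((\<sigma> + \<tau>) / \<sigma>) powr s * exp (- (cmod n)\<^sup>2 / \<sigma> + (cmod y)\<^sup>2 / (\<sigma> + \<tau>)) powr s"
      unfolding 1 by (rule powr_mult)
    then show ?thesis
      unfolding 2 K_def by simp
  qed
  have "(\<integral>\<^sup>+x. ennreal (info_ratio \<sigma> \<tau> n (x + n) powr s) \<partial>cgauss \<tau>)
      = ennreal (K / (1 + c * \<tau>)) * ennreal (exp (- (c' * (cmod (n + 0))\<^sup>2)))" for n
  proof -
    have "(\<integral>\<^sup>+x. ennreal (info_ratio \<sigma> \<tau> n (x + n) powr s) \<partial>cgauss \<tau>)
      = (\<integral>\<^sup>+x. ennreal (K * exp (- (s / \<sigma> * (cmod n)\<^sup>2))) * ennreal (exp (- (c * (cmod (x + n))\<^sup>2))) \<partial>cgauss \<tau>)"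
      using K by (intro nn_integral_cong, subst ennreal_mult[symmetric]) (auto simp: r)
    also have "\<dots> = ennreal (K * exp (- (s / \<sigma> * (cmod n)\<^sup>2))) * ennreal (exp (- (c / (1 + c * \<tau>) * (cmod n)\<^sup>2)) / (1 + c * \<tau>))"
      using K tau c1p by (subst nn_integral_cmult) (auto simp: nn_integral_cgauss_exp)
    also have "\<dots> = ennreal (K / (1 + c * \<tau>) * (exp (- (s / \<sigma> * (cmod n)\<^sup>2)) * exp (- (c / (1 + c * \<tau>) * (cmod n)\<^sup>2))))"
      using K c1p by (subst ennreal_mult[symmetric]) (auto simp: field_simps)
    also have "exp (- (s / \<sigma> * (cmod n)\<^sup>2)) * exp (- (c / (1 + c * \<tau>) * (cmod n)\<^sup>2)) = exp (- (c' * (cmod (n + 0))\<^sup>2))"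
      by (simp add: exp_add[symmetric] c'_def distrib_right)
    finally show ?thesis using K c1p by (subst ennreal_mult[symmetric]) auto
  qed
  then have "(\<integral>\<^sup>+n. \<integral>\<^sup>+x. ennreal (info_ratio \<sigma> \<tau> n (x + n) powr s) \<partial>cgauss \<tau> \<partial>cgauss \<sigma>)
      = ennreal (K / (1 + c * \<tau>)) * (\<integral>\<^sup>+n. ennreal (exp (- (c' * (cmod (n + 0))\<^sup>2))) \<partial>cgauss \<sigma>)"
    by (simp add: nn_integral_cmult)
  also have "\<dots> = ennreal (K / (1 + c * \<tau>)) * ennreal (1 / (1 + c' * \<sigma>))"
    by (subst nn_integral_cgauss_exp) (use sg c2p in auto)
  also have "\<dots> = ennreal (K / ((1 + c * \<tau>) * (1 + c' * \<sigma>)))"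
    using K c1p c2p by (subst ennreal_mult[symmetric]) auto
  also have "\<dots> \<le> ennreal (K / (1 - s\<^sup>2))"
  proof (intro ennreal_leI divide_left_mono)
    have "(1 + c * \<tau>) * (1 + c' * \<sigma>) = (\<sigma> + \<tau> - s\<^sup>2 * \<tau>) / (\<sigma> + \<tau>)"
      unfolding c1 c2 using d by simp
    also have "\<dots> \<ge> 1 - s\<^sup>2"
      using st sg by (simp add: field_simps)
    finally show "1 - s\<^sup>2 \<le> (1 + c * \<tau>) * (1 + c' * \<sigma>)" .
    show "0 < (1 + c * \<tau>) * (1 + c' * \<sigma>) * (1 - s\<^sup>2)" using c1p c2p s2 by simp
  qed (use K in simp)
  also have "K = (1 + \<tau> / \<sigma>) powr s"
    using sg by (simp add: K_def add_divide_distrib)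
  finally show ?thesis .
qed

section \<open>Resampling and products of Gaussian measures\<close>

definition mix :: "'i set \<Rightarrow> ('i \<Rightarrow> 'a) \<Rightarrow> ('i \<Rightarrow> 'a) \<Rightarrow> 'i \<Rightarrow> 'a" where
  "mix A \<omega> \<omega>' = (\<lambda>k. if k \<in> A then \<omega> k else \<omega>' k)"

lemma mix_apply [simp]: "k \<in> A \<Longrightarrow> mix A \<omega> \<omega>' k = \<omega> k" "k \<notin> A \<Longrightarrow> mix A \<omega> \<omega>' k = \<omega>' k"
  by (auto simp: mix_def)

lemma measurable_mix_pair [measurable]:
  "(\<lambda>p. mix A (fst p) (snd p)) \<in> PiM UNIV M \<Otimes>\<^sub>M PiM UNIV M \<rightarrow>\<^sub>M PiM UNIV M"
  unfolding mix_def by (rule measurable_PiM_single') (auto simp: space_PiM space_pair_measure PiE_iff)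

text \<open>A cylinder over \<open>J\<close> pulls back to a rectangle of cylinders over
  \<open>J \<inter> A\<close> and \<open>J - A\<close>, one on each independent copy, and its mass
  factors accordingly.\<close>

lemma distr_mix:
  assumes "\<And>k. prob_space (M k)"
  shows "distr (PiM UNIV M \<Otimes>\<^sub>M PiM UNIV M) (PiM UNIV M) (\<lambda>p. mix A (fst p) (snd p)) = PiM UNIV M"
    (is "?D = ?P")
proof -
  interpret product_prob_space M UNIV
    by (simp add: product_prob_space_def product_prob_space_axioms_def product_sigma_finite_def assms prob_space_imp_sigma_finite)
  show ?thesis
  proof (rule PiM_eq)
    fix J F assume J: "finite J" "J \<subseteq> UNIV" "\<And>j. j \<in> J \<Longrightarrow> F j \<in> sets (M j)"
    let ?X = "prod_emb UNIV M J (\<Pi>\<^sub>E j\<in>J. F j)"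
    have sp: "\<And>j x. j \<in> J \<Longrightarrow> x \<in> F j \<Longrightarrow> x \<in> space (M j)"
      using J(3)[THEN sets.sets_into_space] by blast
    have "(\<lambda>p. mix A (fst p) (snd p)) -` ?X \<inter> space (?P \<Otimes>\<^sub>M ?P)
      = prod_emb UNIV M (J \<inter> A) (\<Pi>\<^sub>E j\<in>J \<inter> A. F j) \<times> prod_emb UNIV M (J - A) (\<Pi>\<^sub>E j\<in>J - A. F j)"
      (is "_ = ?E \<times> ?G")
      using sp by (auto simp: space_pair_measure space_PiM prod_emb_def PiE_iff mix_def split: if_splits)
    then have "emeasure ?D ?X = emeasure (?P \<Otimes>\<^sub>M ?P) (?E \<times> ?G)"
      using J by (subst emeasure_distr) auto
    also have "\<dots> = emeasure ?P ?E * emeasure ?P ?G"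
      using J by (intro P.emeasure_pair_measure_Times) auto
    also have "\<dots> = (\<Prod>j\<in>J \<inter> A. emeasure (M j) (F j)) * (\<Prod>j\<in>J - A. emeasure (M j) (F j))"
      using J by (subst (1 2) emeasure_PiM_emb) auto
    also have "\<dots> = (\<Prod>j\<in>J. emeasure (M j) (F j))"
      using J by (subst prod.Int_Diff[of J _ A]) auto
    finally show "emeasure ?D ?X = (\<Prod>j\<in>J. emeasure (M j) (F j))" .
  qed simp
qed

lemma measurable_mix [measurable]:
  assumes "\<omega> \<in> space (PiM UNIV M)"
  shows "mix A \<omega> \<in> PiM UNIV M \<rightarrow>\<^sub>M PiM UNIV M"
proof -
  have "(\<lambda>\<omega>'. mix A (fst (\<omega>, \<omega>')) (snd (\<omega>, \<omega>'))) \<in> PiM UNIV M \<rightarrow>\<^sub>M PiM UNIV M"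
    using assms by (intro measurable_compose[OF measurable_Pair1' measurable_mix_pair]) auto
  then show ?thesis by simp
qed

text \<open>This plays the role of conditioning on the coordinates in \<open>A\<close>.\<close>

lemma emeasure_PiM_resample:
  assumes M: "\<And>k. prob_space (M k)" and E [measurable]: "E \<in> sets (PiM UNIV M)"
  shows "emeasure (PiM UNIV M) E
    = (\<integral>\<^sup>+\<omega>. emeasure (PiM UNIV M) {\<omega>' \<in> space (PiM UNIV M). mix A \<omega> \<omega>' \<in> E} \<partial>PiM UNIV M)"
proof -
  let ?P = "PiM UNIV M"
  interpret P: prob_space ?P by (rule prob_space_PiM) (rule M)
  have "emeasure ?P E = emeasure (distr (?P \<Otimes>\<^sub>M ?P) ?P (\<lambda>p. mix A (fst p) (snd p))) E"
    using distr_mix[of M A] M by simp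
  also have "\<dots> = emeasure (?P \<Otimes>\<^sub>M ?P) ((\<lambda>p. mix A (fst p) (snd p)) -` E \<inter> space (?P \<Otimes>\<^sub>M ?P))"
    by (rule emeasure_distr) auto
  also have "\<dots> = (\<integral>\<^sup>+\<omega>. emeasure ?P (Pair \<omega> -` ((\<lambda>p. mix A (fst p) (snd p)) -` E \<inter> space (?P \<Otimes>\<^sub>M ?P))) \<partial>?P)"
    by (rule P.emeasure_pair_measure_alt) measurable
  also have "\<dots> = (\<integral>\<^sup>+\<omega>. emeasure ?P {\<omega>' \<in> space ?P. mix A \<omega> \<omega>' \<in> E} \<partial>?P)"
    by (intro nn_integral_cong arg_cong2[where f=emeasure] refl) (auto simp: space_pair_measure)
  finally show ?thesis .
qed

lemma ml_decode_measurable [measurable (raw)]: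
  assumes [measurable]: "\<And>m t. m < M \<Longrightarrow> t \<in> T \<Longrightarrow> (\<lambda>\<omega>. x \<omega> m t) \<in> borel_measurable N"
    "\<And>t. t \<in> T \<Longrightarrow> (\<lambda>\<omega>. y \<omega> t) \<in> borel_measurable N"
  shows "(\<lambda>\<omega>. ml_decode s M T (x \<omega>) (y \<omega>)) \<in> N \<rightarrow>\<^sub>M count_space UNIV"
proof -
  have f: "(\<lambda>\<omega>. \<Prod>t\<in>T. cgauss_density s (y \<omega> t - x \<omega> m t)) \<in> borel_measurable N" if "m < M" for m
    by (intro borel_measurable_prod) (use that in measurable)
  \<comment> \<open>For \<open>M > 0\<close> the condition \<open>m < M\<close> can be moved under
    the bounded quantifier, so that maximality becomes a finite conjunction of measurable
    comparisons.\<close>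
  have "ml_decode s M T (x \<omega>) (y \<omega>) = (LEAST m. \<forall>k<M. m < M \<and> \<not> (\<Prod>t\<in>T. cgauss_density s (y \<omega> t - x \<omega> m t)) < (\<Prod>t\<in>T. cgauss_density s (y \<omega> t - x \<omega> k t)))"
    if "M > 0" for \<omega>
    unfolding ml_decode_def is_arg_max_def using that by (intro arg_cong[where f=Least]) auto
  moreover have "(\<lambda>\<omega>. LEAST m. \<forall>k<M. m < M \<and> \<not> (\<Prod>t\<in>T. cgauss_density s (y \<omega> t - x \<omega> m t)) < (\<Prod>t\<in>T. cgauss_density s (y \<omega> t - x \<omega> k t)))
      \<in> N \<rightarrow>\<^sub>M count_space UNIV"
  proof (rule measurable_Least)
    fix m
    show "Measurable.pred N (\<lambda>\<omega>. \<forall>k<M. m < M \<and> \<not> (\<Prod>t\<in>T. cgauss_density s (y \<omega> t - x \<omega> m t)) < (\<Prod>t\<in>T. cgauss_density s (y \<omega> t - x \<omega> k t)))"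
    proof (cases "m < M")
      case True
      have "Measurable.pred N (\<lambda>\<omega>. \<forall>k\<in>{..<M}. \<not> (\<Prod>t\<in>T. cgauss_density s (y \<omega> t - x \<omega> m t)) < (\<Prod>t\<in>T. cgauss_density s (y \<omega> t - x \<omega> k t)))"
        by (intro pred_intros_finite pred_intros_logic borel_measurable_pred_less f True) auto
      then show ?thesis using True by simp
    next
      case False then show ?thesis by simp
    qed
  qed
  ultimately show ?thesis
    by (cases "M > 0") (auto simp: ml_decode_def is_arg_max_def cong: measurable_cong)
qed

text \<open>Strict inequality against every competitor makes the tie rule immaterial.\<close>

lemma ml_decode_eqI:
  assumes w: "w < M"
    and less: "\<And>m. m < M \<Longrightarrow> m \<noteq> w \<Longrightarrow>
      (\<Prod>t\<in>T. cgauss_density s (y t - x m t)) < (\<Prod>t\<in>T. cgauss_density s (y t - x w t))"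
  shows "ml_decode s M T x y = w"
  unfolding ml_decode_def is_arg_max_def
proof (rule Least_equality)
  show "w < M \<and> (\<nexists>m. m < M \<and> (\<Prod>t\<in>T. cgauss_density s (y t - x w t)) < (\<Prod>t\<in>T. cgauss_density s (y t - x m t)))"
    using w less by (metis less_asym less_irrefl)
qed (use w less in force)

section \<open>Sums and moments of independent Gaussian variables, and the change of measure by a
  shift\<close>

lemma (in prob_space) nn_integral_prod_groups:
  assumes ind: "indep_vars (\<lambda>_. borel) Z I" and T: "finite T"
    and K: "\<And>t. t \<in> T \<Longrightarrow> K t \<subseteq> I" "disjoint_family_on K T"
    and G: "\<And>t. t \<in> T \<Longrightarrow> G t \<in> borel_measurable (PiM (K t) (\<lambda>_. borel))"
  shows "(\<integral>\<^sup>+\<omega>. (\<Prod>t\<in>T. (G t (\<lambda>i\<in>K t. Z i \<omega>) :: ennreal)) \<partial>M) = (\<Prod>t\<in>T. \<integral>\<^sup>+\<omega>. G t (\<lambda>i\<in>K t. Z i \<omega>) \<partial>M)"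
  by (intro indep_vars_nn_integral T indep_vars_compose2[OF indep_vars_restrict[OF ind K] G]) auto

lemma (in prob_space) indep_var_of_indep_vars:
  assumes ind: "indep_vars (\<lambda>_. N) Z I" and "i \<in> I" "j \<in> I" "i \<noteq> j"
  shows "indep_var N (Z i) N (Z j)"
proof -
  have "indep_var N ((\<lambda>f. f i) \<circ> (\<lambda>\<omega>. restrict (\<lambda>i. Z i \<omega>) {i})) N ((\<lambda>f. f j) \<circ> (\<lambda>\<omega>. restrict (\<lambda>i. Z i \<omega>) {j}))"
    by (rule indep_var_compose[OF indep_var_restrict[OF ind]]) (use assms in auto)
  then show ?thesis by (simp add: comp_def)
qed

lemma (in prob_space) nn_integral_indep_pair:
  assumes "indep_var N1 X N2 Y" and "f \<in> borel_measurable (N1 \<Otimes>\<^sub>M N2)"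
  shows "(\<integral>\<^sup>+\<omega>. f (X \<omega>, Y \<omega>) \<partial>M) = (\<integral>\<^sup>+x. \<integral>\<^sup>+y. f (x, y) \<partial>distr M N2 Y \<partial>distr M N1 X)"
proof -
  note * = indep_var_distribution_eq[THEN iffD1, OF assms(1)]
  have rv[measurable]: "random_variable N1 X" "random_variable N2 Y" using * by auto
  interpret Y: prob_space "distr M N2 Y" by (rule prob_space_distr) (use * in auto)
  have "(\<integral>\<^sup>+\<omega>. f (X \<omega>, Y \<omega>) \<partial>M) = (\<integral>\<^sup>+p. f p \<partial>distr M (N1 \<Otimes>\<^sub>M N2) (\<lambda>x. (X x, Y x)))"
    by (subst nn_integral_distr) (use assms in auto)
  also have "\<dots> = (\<integral>\<^sup>+p. f p \<partial>(distr M N1 X \<Otimes>\<^sub>M distr M N2 Y))"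
    using * by simp
  also have "\<dots> = (\<integral>\<^sup>+x. \<integral>\<^sup>+y. f (x, y) \<partial>distr M N2 Y \<partial>distr M N1 X)"
    by (rule Y.nn_integral_fst[symmetric]) (use assms in simp)
  finally show ?thesis .
qed

lemma (in prob_space) distr_indep_add_cgauss:
  assumes ind: "indep_var borel X borel Y"
    and X: "distr M borel X = cgauss s" and Y: "distr M borel Y = cgauss t" and st: "s > 0" "t > 0"
  shows "distr M borel (\<lambda>\<omega>. X \<omega> + Y \<omega>) = cgauss (s + t)"
proof -
  note * = indep_var_distribution_eq[THEN iffD1, OF ind]
  have rv[measurable]: "random_variable borel X" "random_variable borel Y" using * by auto
  have "distr M borel (\<lambda>\<omega>. X \<omega> + Y \<omega>)
      = distr (distr M (borel \<Otimes>\<^sub>M borel) (\<lambda>x. (X x, Y x))) borel (\<lambda>(x, y). x + y)"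
    by (subst distr_distr) (auto simp: comp_def)
  also have "\<dots> = cgauss (s + t)"
    using * by (simp add: X Y distr_cgauss_add[OF st, symmetric])
  finally show ?thesis .
qed

text \<open>Vanishing coefficients are excluded because \<open>cgauss 0\<close> has density 0
  (division by 0 is 0): it is the null measure, not the point mass at 0.\<close>

lemma (in prob_space) distr_indep_sum_cgauss:
  assumes "finite U" "U \<noteq> {}" and "indep_vars (\<lambda>_. borel) Z U" and "v > 0"
    and "\<And>i. i \<in> U \<Longrightarrow> distr M borel (Z i) = cgauss v" and "\<And>i. i \<in> U \<Longrightarrow> h i \<noteq> 0"
  shows "distr M borel (\<lambda>\<omega>. \<Sum>i\<in>U. h i * Z i \<omega>) = cgauss (v * (\<Sum>i\<in>U. (cmod (h i))\<^sup>2))"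
  using assms
proof (induction U rule: finite_ne_induct)
  case (singleton i)
  then have [measurable]: "random_variable borel (Z i)" by (auto simp: indep_vars_def)
  have "distr M borel (\<lambda>\<omega>. h i * Z i \<omega>) = distr (distr M borel (Z i)) borel (\<lambda>z. h i * z)"
    by (subst distr_distr) (auto simp: comp_def)
  then show ?case using singleton distr_cgauss_mult[of v "h i"] by (simp add: mult.commute)
next
  case (insert i U)
  have [measurable]: "random_variable borel (Z i)" using insert.prems by (auto simp: indep_vars_def)
  have "indep_var borel ((\<lambda>f. h i * f i) \<circ> (\<lambda>\<omega>. restrict (\<lambda>i. Z i \<omega>) {i}))
      borel ((\<lambda>f. \<Sum>j\<in>U. h j * f j) \<circ> (\<lambda>\<omega>. restrict (\<lambda>i. Z i \<omega>) U))"
    by (rule indep_var_compose[OF indep_var_restrict[OF insert.prems(1)]]) (use insert in auto)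
  then have ind: "indep_var borel (\<lambda>\<omega>. h i * Z i \<omega>) borel (\<lambda>\<omega>. \<Sum>j\<in>U. h j * Z j \<omega>)"
    by (simp add: comp_def)
  have "distr M borel (\<lambda>\<omega>. h i * Z i \<omega>) = distr (distr M borel (Z i)) borel (\<lambda>z. h i * z)"
    by (subst distr_distr) (auto simp: comp_def)
  then have "distr M borel (\<lambda>\<omega>. h i * Z i \<omega>) = cgauss ((cmod (h i))\<^sup>2 * v)"
    using insert.prems by (simp add: distr_cgauss_mult)
  moreover have "distr M borel (\<lambda>\<omega>. \<Sum>j\<in>U. h j * Z j \<omega>) = cgauss (v * (\<Sum>j\<in>U. (cmod (h j))\<^sup>2))"
    using insert.prems by (intro insert.IH) (auto intro: indep_vars_subset)
  moreover have "(\<Sum>j\<in>U. (cmod (h j))\<^sup>2) > 0"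
    using insert.prems insert.hyps by (intro sum_pos) auto
  ultimately have "distr M borel (\<lambda>\<omega>. h i * Z i \<omega> + (\<Sum>j\<in>U. h j * Z j \<omega>))
      = cgauss ((cmod (h i))\<^sup>2 * v + v * (\<Sum>j\<in>U. (cmod (h j))\<^sup>2))"
    using insert.prems by (intro distr_indep_add_cgauss[OF ind]) auto
  then show ?case using insert.hyps by (simp add: algebra_simps)
qed

text \<open>The law of the output given the input \<open>x\<close> has the exponentiated information
  density as its density with respect to the unconditional output law. This is the change of measure
  behind the converse.\<close>

lemma distr_cgauss_shift:
  assumes "\<sigma> > 0" "\<tau> > 0"
  shows "distr (cgauss \<sigma>) borel (\<lambda>n. x + n) = density (cgauss (\<sigma> + \<tau>)) (\<lambda>y. ennreal (info_ratio \<sigma> \<tau> (y - x) y))"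
proof (rule measure_eqI)
  fix A assume "A \<in> sets (distr (cgauss \<sigma>) borel (\<lambda>n. x + n))"
  then have [measurable]: "A \<in> sets borel" by simp
  have "emeasure (distr (cgauss \<sigma>) borel (\<lambda>n. x + n)) A = (\<integral>\<^sup>+n. indicator A (x + n) \<partial>cgauss \<sigma>)"
    by (subst nn_integral_indicator[symmetric], simp, subst nn_integral_distr) auto
  also have "\<dots> = (\<integral>\<^sup>+n. ennreal (cgauss_density \<sigma> n) * indicator A (x + n) \<partial>lborel)"
    by (subst nn_integral_cgauss) auto
  also have "\<dots> = (\<integral>\<^sup>+y. ennreal (cgauss_density \<sigma> (y - x)) * indicator A y \<partial>lborel)"
    by (subst nn_integral_lborel_add_complex[of "\<lambda>y. ennreal (cgauss_density \<sigma> (y - x)) * indicator A y" x, symmetric]) auto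
  also have "\<dots> = (\<integral>\<^sup>+y. ennreal (cgauss_density (\<sigma> + \<tau>) y) * (ennreal (info_ratio \<sigma> \<tau> (y - x) y) * indicator A y) \<partial>lborel)"
    using assms cgauss_density_pos[of "\<sigma> + \<tau>"] cgauss_density_pos[of "\<sigma>"]
    by (intro nn_integral_cong)
      (simp add: info_ratio_def mult.assoc[symmetric] ennreal_mult[symmetric] less_imp_le less_imp_neq[symmetric])
  also have "\<dots> = emeasure (density (cgauss (\<sigma> + \<tau>)) (\<lambda>y. ennreal (info_ratio \<sigma> \<tau> (y - x) y))) A"
    by (subst emeasure_density) (auto simp: nn_integral_cgauss)
  finally show "emeasure (distr (cgauss \<sigma>) borel (\<lambda>n. x + n)) A
    = emeasure (density (cgauss (\<sigma> + \<tau>)) (\<lambda>y. ennreal (info_ratio \<sigma> \<tau> (y - x) y))) A" .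
qed simp

lemma distr_PiM_cgauss_shift:
  assumes T: "finite T" and sg: "\<sigma> > 0" and tau: "\<And>t. t \<in> T \<Longrightarrow> \<tau> t > 0"
  shows "distr (PiM T (\<lambda>_. cgauss \<sigma>)) (PiM T (\<lambda>_. borel)) (\<lambda>n. \<lambda>t\<in>T. x t + n t)
    = density (PiM T (\<lambda>t. cgauss (\<sigma> + \<tau> t))) (\<lambda>y. \<Prod>t\<in>T. ennreal (info_ratio \<sigma> (\<tau> t) (y t - x t) (y t)))"
    (is "?L = ?R")
proof -
  \<comment> \<open>The product locales ask for a probability measure at every index, also outside
    \<open>T\<close>, where \<open>\<tau>\<close> is unconstrained.\<close>
  define \<tau>' where "\<tau>' t = (if t \<in> T then \<tau> t else 1)" for t
  have tau': "\<tau>' t > 0" for t using tau by (auto simp: \<tau>'_def)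
  have st: "\<sigma> + \<tau>' t > 0" for t using sg tau'[of t] by simp
  let ?Q = "PiM T (\<lambda>t. cgauss (\<sigma> + \<tau>' t))"
  let ?f = "\<lambda>t y. ennreal (info_ratio \<sigma> (\<tau>' t) (y t - x t) (y t))"
  let ?d = "\<lambda>y. \<Prod>t\<in>T. ?f t y"
  let ?K = "\<lambda>t. distr (cgauss \<sigma>) borel (\<lambda>n. x t + n)"
  interpret K: product_prob_space ?K T
    unfolding product_prob_space_def product_prob_space_axioms_def product_sigma_finite_def
    by (auto intro!: prob_space_imp_sigma_finite prob_space.prob_space_distr prob_space_cgauss sg)
  interpret N: product_prob_space "\<lambda>_. cgauss \<sigma>" T
    unfolding product_prob_space_def product_prob_space_axioms_def product_sigma_finite_def
    by (auto intro!: prob_space_imp_sigma_finite prob_space_cgauss sg)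
  interpret Q: product_prob_space "\<lambda>t. cgauss (\<sigma> + \<tau>' t)" T
    unfolding product_prob_space_def product_prob_space_axioms_def product_sigma_finite_def
    by (auto intro!: prob_space_imp_sigma_finite prob_space_cgauss st)
  have R: "?R = density ?Q ?d"
    by (intro arg_cong2[where f=density] PiM_cong ext prod.cong) (auto simp: \<tau>'_def)
  have setsQ: "sets ?Q = sets (PiM T (\<lambda>_. borel))" by (intro sets_PiM_cong) auto
  have mQ [measurable]: "?d \<in> borel_measurable ?Q"
    unfolding measurable_cong_sets[OF setsQ refl] by measurable
  \<comment> \<open>Both sides are identified with the product of the shifted one-dimensional laws,
    which is determined by its values on boxes.\<close>
  have "?L = PiM T ?K"
  proof (rule K.PiM_eqI)
    fix A assume A: "\<And>t. t \<in> T \<Longrightarrow> A t \<in> sets (?K t)"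
    have "emeasure ?L (Pi\<^sub>E T A) = emeasure (PiM T (\<lambda>_. cgauss \<sigma>)) ((\<lambda>n. \<lambda>t\<in>T. x t + n t) -` Pi\<^sub>E T A \<inter> space (PiM T (\<lambda>_. cgauss \<sigma>)))"
      by (rule emeasure_distr) (use A T in \<open>auto intro!: sets_PiM_I_finite measurable_restrict\<close>)
    also have "(\<lambda>n. \<lambda>t\<in>T. x t + n t) -` Pi\<^sub>E T A \<inter> space (PiM T (\<lambda>_. cgauss \<sigma>)) = Pi\<^sub>E T (\<lambda>t. (\<lambda>n. x t + n) -` A t)"
      by (auto simp: space_PiM PiE_iff)
    also have "emeasure (PiM T (\<lambda>_. cgauss \<sigma>)) \<dots> = (\<Prod>t\<in>T. emeasure (cgauss \<sigma>) ((\<lambda>n. x t + n) -` A t))"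
    proof (intro N.emeasure_PiM T)
      fix t assume "t \<in> T"
      then show "(\<lambda>n. x t + n) -` A t \<in> sets (cgauss \<sigma>)"
        using measurable_sets[of "\<lambda>n. x t + n" borel borel "A t"] A by simp
    qed
    also have "\<dots> = (\<Prod>t\<in>T. emeasure (?K t) (A t))"
      using A by (intro prod.cong refl) (simp add: emeasure_distr)
    finally show "emeasure ?L (Pi\<^sub>E T A) = (\<Prod>t\<in>T. emeasure (?K t) (A t))" .
  qed (auto simp: T intro!: sets_PiM_cong)
  moreover have "?R = PiM T ?K"
    unfolding R
  proof (rule K.PiM_eqI)
    show "sets (density ?Q ?d) = sets (PiM T ?K)"
      by (auto intro!: sets_PiM_cong)
    fix A assume A: "\<And>t. t \<in> T \<Longrightarrow> A t \<in> sets (?K t)"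
    have [measurable]: "Pi\<^sub>E T A \<in> sets ?Q"
      using A by (intro sets_PiM_I_finite T) auto
    have "emeasure (density ?Q ?d) (Pi\<^sub>E T A)
        = (\<integral>\<^sup>+y. (\<Prod>t\<in>T. ?f t y) * indicator (Pi\<^sub>E T A) y \<partial>?Q)"
      by (rule emeasure_density) auto
    also have "\<dots> = (\<integral>\<^sup>+y. (\<Prod>t\<in>T. ?f t y * indicator (A t) (y t)) \<partial>?Q)"
    proof (rule nn_integral_cong)
      fix y assume y: "y \<in> space ?Q"
      have "indicator (Pi\<^sub>E T A) y = (\<Prod>t\<in>T. indicator (A t) (y t) :: ennreal)"
        using y T by (auto simp: space_PiM PiE_iff prod_zero_iff split: split_indicator)
      then show "(\<Prod>t\<in>T. ?f t y) * indicator (Pi\<^sub>E T A) y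
          = (\<Prod>t\<in>T. ?f t y * indicator (A t) (y t))"
        by (simp add: prod.distrib)
    qed
    also have "\<dots> = (\<Prod>t\<in>T. \<integral>\<^sup>+y. ennreal (info_ratio \<sigma> (\<tau>' t) (y - x t) y) * indicator (A t) y \<partial>cgauss (\<sigma> + \<tau>' t))"
      using A by (intro Q.product_nn_integral_prod T) auto
    also have "\<dots> = (\<Prod>t\<in>T. emeasure (?K t) (A t))"
      using A by (intro prod.cong refl, subst distr_cgauss_shift[OF sg tau'], subst emeasure_density) auto
    finally show "emeasure (density ?Q ?d) (Pi\<^sub>E T A)
      = (\<Prod>t\<in>T. emeasure (?K t) (A t))" .
  qed (rule T)
  ultimately show ?thesis by simp
qed

section \<open>Maximum-likelihood decoding of a Gaussian code\<close>

text \<open>\<open>X m t\<close> is the noiseless received signal for message \<open>m\<close>, of variance \<open>\<tau> t\<close>, and \<open>W t\<close> the noise,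
  of variance \<open>\<sigma>\<close>. The index \<open>(None, t)\<close> stands for \<open>W t\<close> and \<open>(Some m, t)\<close> for \<open>X m t\<close>.\<close>

locale gaussian_code = prob_space P for P :: "'a measure" +
  fixes \<sigma> :: real and \<tau> :: "nat \<Rightarrow> real" and T :: "nat set" and M :: nat
    and X :: "nat \<Rightarrow> nat \<Rightarrow> 'a \<Rightarrow> complex" and W :: "nat \<Rightarrow> 'a \<Rightarrow> complex"
  assumes finite_T: "finite T" and sigma_pos: "\<sigma> > 0" and tau_pos: "t \<in> T \<Longrightarrow> \<tau> t > 0"
    and indep: "indep_vars (\<lambda>_. borel) (\<lambda>(a, t). case a of None \<Rightarrow> W t | Some m \<Rightarrow> X m t)
      (insert None (Some ` {..<M}) \<times> T)"
    and distr_X: "m < M \<Longrightarrow> t \<in> T \<Longrightarrow> distr P borel (X m t) = cgauss (\<tau> t)"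
    and distr_W: "t \<in> T \<Longrightarrow> distr P borel (W t) = cgauss \<sigma>"
begin

definition Z :: "nat option \<times> nat \<Rightarrow> 'a \<Rightarrow> complex" where
  "Z = (\<lambda>(a, t). case a of None \<Rightarrow> W t | Some m \<Rightarrow> X m t)"

lemma indep_Z: "indep_vars (\<lambda>_. borel) Z (insert None (Some ` {..<M}) \<times> T)"
  using indep by (simp add: Z_def)

lemma Z_simps [simp]: "Z (None, t) = W t" "Z (Some m, t) = X m t"
  by (auto simp: Z_def)

lemma measurable_X [measurable]: "m < M \<Longrightarrow> t \<in> T \<Longrightarrow> X m t \<in> borel_measurable P"
  using indep_Z by (auto simp: indep_vars_def Z_def)

lemma measurable_W [measurable]: "t \<in> T \<Longrightarrow> W t \<in> borel_measurable P"
  using indep_Z by (auto simp: indep_vars_def Z_def)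

lemma indep_WX: "m < M \<Longrightarrow> t \<in> T \<Longrightarrow> indep_var borel (W t) borel (X m t)"
  using indep_var_of_indep_vars[OF indep_Z, of "(None, t)" "(Some m, t)"] by auto

definition dec :: "nat \<Rightarrow> 'a \<Rightarrow> nat" where
  "dec w \<omega> = ml_decode \<sigma> M T (\<lambda>m t. X m t \<omega>) (\<lambda>t. X w t \<omega> + W t \<omega>)"

lemma measurable_dec [measurable]: "w < M \<Longrightarrow> dec w \<in> P \<rightarrow>\<^sub>M count_space UNIV"
  unfolding dec_def by measurable

text \<open>Likelihood of the sent codeword relative to the output law, i.e. the exponential of the
  information density accumulated over \<open>T\<close>.\<close>

definition ratio :: "nat \<Rightarrow> 'a \<Rightarrow> real" where
  "ratio w \<omega> = (\<Prod>t\<in>T. info_ratio \<sigma> (\<tau> t) (W t \<omega>) (X w t \<omega> + W t \<omega>))"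

lemma measurable_ratio [measurable]: "w < M \<Longrightarrow> ratio w \<in> borel_measurable P"
  unfolding ratio_def by measurable

lemma ratio_pos: "ratio w \<omega> > 0"
  unfolding ratio_def by (intro prod_pos info_ratio_pos sigma_pos tau_pos)

lemma nn_integral_ratio_powr:
  assumes w: "w < M" and s: "-1 < s" "s < 1"
  shows "(\<integral>\<^sup>+\<omega>. ennreal (ratio w \<omega> powr s) \<partial>P) \<le> ennreal (\<Prod>t\<in>T. (1 + \<tau> t / \<sigma>) powr s / (1 - s\<^sup>2))"
proof -
  have s2: "s\<^sup>2 < 1" using s by (simp add: abs_square_less_1)
  define G where "G t z = ennreal (info_ratio \<sigma> (\<tau> t) (z (None, t)) (z (Some w, t) + z (None, t)) powr s)" for t z
  define K where "K t = {(None :: nat option, t), (Some w, t)}" for t :: nat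
  have "(\<integral>\<^sup>+\<omega>. ennreal (ratio w \<omega> powr s) \<partial>P) = (\<integral>\<^sup>+\<omega>. (\<Prod>t\<in>T. G t (\<lambda>i\<in>K t. Z i \<omega>)) \<partial>P)"
  proof (rule nn_integral_cong)
    fix \<omega>
    have "ratio w \<omega> powr s = (\<Prod>t\<in>T. info_ratio \<sigma> (\<tau> t) (W t \<omega>) (X w t \<omega> + W t \<omega>) powr s)"
      unfolding ratio_def by (intro prod_powr_distrib less_imp_le info_ratio_pos sigma_pos tau_pos)
    then show "ennreal (ratio w \<omega> powr s) = (\<Prod>t\<in>T. G t (\<lambda>i\<in>K t. Z i \<omega>))"
      by (simp add: prod_ennreal G_def K_def)
  qed
  also have "\<dots> = (\<Prod>t\<in>T. \<integral>\<^sup>+\<omega>. G t (\<lambda>i\<in>K t. Z i \<omega>) \<partial>P)"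
    by (rule nn_integral_prod_groups[OF indep_Z finite_T])
       (auto simp: K_def G_def disjoint_family_on_def w)
  also have "\<dots> \<le> (\<Prod>t\<in>T. ennreal ((1 + \<tau> t / \<sigma>) powr s / (1 - s\<^sup>2)))"
  proof (rule prod_mono_ennreal)
    fix t assume t: "t \<in> T"
    have "(\<integral>\<^sup>+\<omega>. G t (\<lambda>i\<in>K t. Z i \<omega>) \<partial>P) = (\<integral>\<^sup>+\<omega>. (\<lambda>p. ennreal (info_ratio \<sigma> (\<tau> t) (fst p) (snd p + fst p) powr s)) (W t \<omega>, X w t \<omega>) \<partial>P)"
      by (simp add: G_def K_def)
    also have "\<dots> = (\<integral>\<^sup>+n. \<integral>\<^sup>+x. ennreal (info_ratio \<sigma> (\<tau> t) n (x + n) powr s) \<partial>cgauss (\<tau> t) \<partial>cgauss \<sigma>)"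
      by (subst nn_integral_indep_pair[OF indep_WX[OF w t]]) (auto simp: distr_X[OF w t] distr_W[OF t])
    also have "\<dots> \<le> ennreal ((1 + \<tau> t / \<sigma>) powr s / (1 - s\<^sup>2))"
      by (rule nn_integral_info_ratio_powr) (use sigma_pos tau_pos t s in auto)
    finally show "(\<integral>\<^sup>+\<omega>. G t (\<lambda>i\<in>K t. Z i \<omega>) \<partial>P) \<le> ennreal ((1 + \<tau> t / \<sigma>) powr s / (1 - s\<^sup>2))" .
  qed
  also have "\<dots> = ennreal (\<Prod>t\<in>T. (1 + \<tau> t / \<sigma>) powr s / (1 - s\<^sup>2))"
    using s2 by (subst prod_ennreal) auto
  finally show ?thesis .
qed

text \<open>The same quotient for a competing message \<open>m\<close> while \<open>w\<close> is
  sent; the denominator is that of \<open>ratio\<close>, so comparing the two compares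
  likelihoods.\<close>

definition wrong_ratio :: "nat \<Rightarrow> nat \<Rightarrow> 'a \<Rightarrow> real" where
  "wrong_ratio w m \<omega> = (\<Prod>t\<in>T. info_ratio \<sigma> (\<tau> t) (X w t \<omega> + W t \<omega> - X m t \<omega>) (X w t \<omega> + W t \<omega>))"

lemma measurable_wrong_ratio [measurable]:
  "w < M \<Longrightarrow> m < M \<Longrightarrow> wrong_ratio w m \<in> borel_measurable P"
  unfolding wrong_ratio_def by measurable

text \<open>A competing codeword is independent of the received signal. Averaging its likelihood
  over it therefore gives the output density, and the quotient has mean 1.\<close>

lemma nn_integral_wrong_ratio:
  assumes w: "w < M" and m: "m < M" and ne: "m \<noteq> w"
  shows "(\<integral>\<^sup>+\<omega>. ennreal (wrong_ratio w m \<omega>) \<partial>P) = 1"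
proof -
  define G where "G t z = ennreal (info_ratio \<sigma> (\<tau> t) (z (Some w, t) + z (None, t) - z (Some m, t)) (z (Some w, t) + z (None, t)))" for t z
  define K where "K t = {(None :: nat option, t), (Some w, t), (Some m, t)}" for t :: nat
  have "(\<integral>\<^sup>+\<omega>. ennreal (wrong_ratio w m \<omega>) \<partial>P) = (\<integral>\<^sup>+\<omega>. (\<Prod>t\<in>T. G t (\<lambda>i\<in>K t. Z i \<omega>)) \<partial>P)"
  proof (rule nn_integral_cong)
    fix \<omega>
    have "ennreal (wrong_ratio w m \<omega>) = (\<Prod>t\<in>T. ennreal (info_ratio \<sigma> (\<tau> t) (X w t \<omega> + W t \<omega> - X m t \<omega>) (X w t \<omega> + W t \<omega>)))"
      unfolding wrong_ratio_def by (intro prod_ennreal[symmetric] less_imp_le info_ratio_pos sigma_pos tau_pos)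
    then show "ennreal (wrong_ratio w m \<omega>) = (\<Prod>t\<in>T. G t (\<lambda>i\<in>K t. Z i \<omega>))"
      by (simp add: G_def K_def)
  qed
  also have "\<dots> = (\<Prod>t\<in>T. \<integral>\<^sup>+\<omega>. G t (\<lambda>i\<in>K t. Z i \<omega>) \<partial>P)"
    by (rule nn_integral_prod_groups[OF indep_Z finite_T])
       (auto simp: K_def G_def disjoint_family_on_def w m)
  also have "\<dots> = 1"
  proof (rule prod.neutral, rule ballI)
    fix t assume t: "t \<in> T"
    have st: "\<sigma> + \<tau> t > 0" using sigma_pos tau_pos[OF t] by simp
    have "indep_var borel ((\<lambda>f. f (Some w, t) + f (None, t)) \<circ> (\<lambda>\<omega>. restrict (\<lambda>i. Z i \<omega>) {(Some w, t), (None, t)}))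
      borel ((\<lambda>f. f (Some m, t)) \<circ> (\<lambda>\<omega>. restrict (\<lambda>i. Z i \<omega>) {(Some m, t)}))"
      by (rule indep_var_compose[OF indep_var_restrict[OF indep_Z]]) (use w m ne t in auto)
    then have ind: "indep_var borel (\<lambda>\<omega>. X w t \<omega> + W t \<omega>) borel (X m t)"
      by (simp add: comp_def)
    have dY: "distr P borel (\<lambda>\<omega>. X w t \<omega> + W t \<omega>) = cgauss (\<sigma> + \<tau> t)"
      using distr_indep_add_cgauss[OF indep_WX[OF w t] distr_W[OF t] distr_X[OF w t] sigma_pos tau_pos[OF t]]
      by (simp add: add.commute)
    have "(\<integral>\<^sup>+\<omega>. G t (\<lambda>i\<in>K t. Z i \<omega>) \<partial>P)
      = (\<integral>\<^sup>+\<omega>. (\<lambda>p. ennreal (info_ratio \<sigma> (\<tau> t) (fst p - snd p) (fst p))) (X w t \<omega> + W t \<omega>, X m t \<omega>) \<partial>P)"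
      by (simp add: G_def K_def)
    also have "\<dots> = (\<integral>\<^sup>+y. \<integral>\<^sup>+x. ennreal (info_ratio \<sigma> (\<tau> t) (y - x) y) \<partial>cgauss (\<tau> t) \<partial>cgauss (\<sigma> + \<tau> t))"
      by (subst nn_integral_indep_pair[OF ind]) (auto simp: distr_X[OF m t] dY)
    also have "\<dots> = (\<integral>\<^sup>+y. 1 \<partial>cgauss (\<sigma> + \<tau> t))"
    proof (rule nn_integral_cong)
      fix y
      have q: "cgauss_density (\<sigma> + \<tau> t) y > 0" by (rule cgauss_density_pos[OF st])
      have "(\<integral>\<^sup>+x. ennreal (info_ratio \<sigma> (\<tau> t) (y - x) y) \<partial>cgauss (\<tau> t))
        = (\<integral>\<^sup>+x. ennreal (1 / cgauss_density (\<sigma> + \<tau> t) y) * ennreal (cgauss_density \<sigma> (y - x)) \<partial>cgauss (\<tau> t))"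
        using q cgauss_density_pos[OF sigma_pos]
        by (intro nn_integral_cong, subst ennreal_mult[symmetric]) (auto simp: info_ratio_def less_imp_le)
      also have "\<dots> = ennreal (1 / cgauss_density (\<sigma> + \<tau> t) y) * ennreal (cgauss_density (\<sigma> + \<tau> t) y)"
        by (subst nn_integral_cmult) (auto simp: cgauss_density_convolution[OF tau_pos[OF t] sigma_pos] add.commute)
      also have "\<dots> = 1" using q by (subst ennreal_mult[symmetric]) auto
      finally show "(\<integral>\<^sup>+x. ennreal (info_ratio \<sigma> (\<tau> t) (y - x) y) \<partial>cgauss (\<tau> t)) = 1" .
    qed
    also have "\<dots> = 1"
      using prob_space.emeasure_space_1[OF prob_space_cgauss[OF st]] by simp
    finally show "(\<integral>\<^sup>+\<omega>. G t (\<lambda>i\<in>K t. Z i \<omega>) \<partial>P) = 1" .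
  qed
  finally show ?thesis .
qed

abbreviation "correct w \<equiv> {\<omega>\<in>space P. dec w \<omega> = w}"

abbreviation "wrong w \<equiv> {\<omega>\<in>space P. dec w \<omega> \<noteq> w}"

abbreviation "correct_below \<beta> w \<equiv> {\<omega>\<in>space P. dec w \<omega> = w \<and> ratio w \<omega> < \<beta>}"

abbreviation "ratio_above \<beta> w \<equiv> {\<omega>\<in>space P. \<beta> \<le> ratio w \<omega>}"

text \<open>An error needs a competitor at least as likely as the sent message; both likelihoods are
  divided by the same output density.\<close>

lemma dec_wrong:
  assumes w: "w < M" and ne: "dec w \<omega> \<noteq> w"
  shows "\<exists>m<M. m \<noteq> w \<and> ratio w \<omega> \<le> wrong_ratio w m \<omega>"
proof -
  obtain m where m: "m < M" "m \<noteq> w" "\<not> (\<Prod>t\<in>T. cgauss_density \<sigma> (X w t \<omega> + W t \<omega> - X m t \<omega>))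
    < (\<Prod>t\<in>T. cgauss_density \<sigma> (X w t \<omega> + W t \<omega> - X w t \<omega>))"
    using ne ml_decode_eqI[OF w, where T=T and s=\<sigma> and y="\<lambda>t. X w t \<omega> + W t \<omega>" and x="\<lambda>m t. X m t \<omega>"] unfolding dec_def by blast
  have "(\<Prod>t\<in>T. cgauss_density (\<sigma> + \<tau> t) (X w t \<omega> + W t \<omega>)) > 0"
    using sigma_pos tau_pos by (intro prod_pos cgauss_density_pos) (simp add: add_pos_pos)
  then have "ratio w \<omega> \<le> wrong_ratio w m \<omega>"
    using m(3) unfolding ratio_def wrong_ratio_def info_ratio_def prod_dividef by (intro divide_right_mono) auto
  then show ?thesis using m by blast
qed

text \<open>Threshold argument: an error forces either the sent message to stay at or below
  \<open>\<beta>\<close>, which a negative moment makes rare, or some competitor to reach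
  \<open>\<beta>\<close>, which has probability at most \<open>1 / \<beta>\<close> for each of fewer
  than \<open>M\<close> competitors.\<close>

lemma decoding_error_le:
  assumes w: "w < M" and s: "0 \<le> s" "s < 1" and b: "\<beta> > 0"
  shows "prob (wrong w) \<le> \<beta> powr s * (\<Prod>t\<in>T. (1 + \<tau> t / \<sigma>) powr (-s) / (1 - s\<^sup>2)) + real M / \<beta>"
proof -
  have s2: "s\<^sup>2 < 1" using s by (simp add: abs_square_less_1)
  have bs: "\<beta> powr s * \<beta> powr (-s) = 1" using b by (simp add: powr_add[symmetric])
  \<comment> \<open>\<open>?A\<close> contains the event that the sent message stays at or below
    \<open>\<beta>\<close>, and \<open>?B m\<close> says that competitor \<open>m\<close> reaches
    \<open>\<beta>\<close>; both are in the form of Markov's inequality.\<close>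
  let ?A = "{\<omega>\<in>space P. 1 \<le> ennreal (\<beta> powr s) * ennreal (ratio w \<omega> powr (-s))}"
  let ?B = "\<lambda>m. {\<omega>\<in>space P. 1 \<le> ennreal (1 / \<beta>) * ennreal (wrong_ratio w m \<omega>)}"
  let ?pr = "\<Prod>t\<in>T. (1 + \<tau> t / \<sigma>) powr (-s) / (1 - s\<^sup>2)"
  have pr: "?pr \<ge> 0" using s2 by (intro prod_nonneg) auto
  have mA: "?A \<in> events" and mB: "m < M \<Longrightarrow> ?B m \<in> events" for m
    using w by measurable
  have mUB: "(\<Union>m\<in>{..<M}-{w}. ?B m) \<in> events"
    by (rule sets.finite_UN) (use mB in blast)+
  have sub: "(wrong w) \<subseteq> ?A \<union> (\<Union>m\<in>{..<M}-{w}. ?B m)"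
  proof safe
    fix \<omega> assume o: "\<omega> \<in> space P" "dec w \<omega> \<noteq> w" "\<omega> \<notin> (\<Union>m\<in>{..<M}-{w}. ?B m)"
    obtain m where m: "m < M" "m \<noteq> w" "ratio w \<omega> \<le> wrong_ratio w m \<omega>"
      using dec_wrong[OF w o(2)] by auto
    have "\<not> 1 \<le> ennreal (1 / \<beta>) * ennreal (wrong_ratio w m \<omega>)"
      using m o by auto
    moreover have "wrong_ratio w m \<omega> > 0" using m(3) ratio_pos[of w \<omega>] by linarith
    ultimately have "\<not> 1 \<le> wrong_ratio w m \<omega> / \<beta>"
      using b by (simp add: ennreal_mult[symmetric])
    then have "ratio w \<omega> \<le> \<beta>" using m b by (simp add: field_simps)
    then have "\<beta> powr (-s) \<le> ratio w \<omega> powr (-s)"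
      using ratio_pos s by (intro powr_mono2') auto
    then have "\<beta> powr s * \<beta> powr (-s) \<le> \<beta> powr s * ratio w \<omega> powr (-s)"
      by (intro mult_left_mono) auto
    then show "1 \<le> ennreal (\<beta> powr s) * ennreal (ratio w \<omega> powr (-s))"
      unfolding bs by (simp add: ennreal_mult[symmetric])
  qed
  have "emeasure P ?A \<le> ennreal (\<beta> powr s) * (\<integral>\<^sup>+\<omega>. ennreal (ratio w \<omega> powr (-s)) * indicator (space P) \<omega> \<partial>P)"
    using nn_integral_Markov_inequality[where u="\<lambda>\<omega>. ennreal (ratio w \<omega> powr (-s))" and M=P and A="space P" and c="ennreal (\<beta> powr s)"] w by simp
  also have "(\<integral>\<^sup>+\<omega>. ennreal (ratio w \<omega> powr (-s)) * indicator (space P) \<omega> \<partial>P) = (\<integral>\<^sup>+\<omega>. ennreal (ratio w \<omega> powr (-s)) \<partial>P)"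
    by (intro nn_integral_cong) simp
  also have "\<dots> \<le> ennreal ?pr"
    using nn_integral_ratio_powr[OF w, of "-s"] s by simp
  finally have A: "emeasure P ?A \<le> ennreal (\<beta> powr s * ?pr)"
    using pr by (simp add: ennreal_mult mult_left_mono)
  have B: "emeasure P (?B m) \<le> ennreal (1 / \<beta>)" if "m < M" "m \<noteq> w" for m
  proof -
    have "emeasure P (?B m) \<le> ennreal (1 / \<beta>) * (\<integral>\<^sup>+\<omega>. ennreal (wrong_ratio w m \<omega>) * indicator (space P) \<omega> \<partial>P)"
      using nn_integral_Markov_inequality[where u="\<lambda>\<omega>. ennreal (wrong_ratio w m \<omega>)" and M=P and A="space P" and c="ennreal (1 / \<beta>)"] w that by simp
    also have "(\<integral>\<^sup>+\<omega>. ennreal (wrong_ratio w m \<omega>) * indicator (space P) \<omega> \<partial>P) = 1"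
      using nn_integral_wrong_ratio[OF w that] by (subst nn_integral_cong[where v="\<lambda>\<omega>. ennreal (wrong_ratio w m \<omega>)"]) auto
    finally show ?thesis by simp
  qed
  have "emeasure P (wrong w) \<le> emeasure P (?A \<union> (\<Union>m\<in>{..<M}-{w}. ?B m))"
    by (rule emeasure_mono[OF sub]) (rule sets.Un[OF mA mUB])
  also have "\<dots> \<le> emeasure P ?A + emeasure P (\<Union>m\<in>{..<M}-{w}. ?B m)"
    by (rule emeasure_subadditive[OF mA mUB])
  also have "\<dots> \<le> emeasure P ?A + (\<Sum>m\<in>{..<M}-{w}. emeasure P (?B m))"
    using mB by (intro add_left_mono emeasure_subadditive_finite) blast+
  also have "\<dots> \<le> ennreal (\<beta> powr s * ?pr) + (\<Sum>m\<in>{..<M}-{w}. ennreal (1 / \<beta>))"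
    using B by (intro add_mono A sum_mono) auto
  also have "\<dots> \<le> ennreal (\<beta> powr s * ?pr) + ennreal (real M / \<beta>)"
  proof (intro add_left_mono)
    have "(\<Sum>m\<in>{..<M}-{w}. ennreal (1 / \<beta>)) = ennreal (\<Sum>m\<in>{..<M}-{w}. 1 / \<beta>)"
      using b by (intro sum_ennreal) auto
    also have "\<dots> \<le> ennreal (\<Sum>m\<in>{..<M}. 1 / \<beta>)"
      using b by (intro ennreal_leI sum_mono2) auto
    finally show "(\<Sum>m\<in>{..<M}-{w}. ennreal (1 / \<beta>)) \<le> ennreal (real M / \<beta>)" by simp
  qed
  also have "\<dots> = ennreal (\<beta> powr s * ?pr + real M / \<beta>)"
    using b pr by simp
  finally show ?thesis
    using b pr unfolding emeasure_eq_measure by (subst (asm) ennreal_le_iff) auto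
qed

lemma prob_ratio_ge:
  assumes w: "w < M" and s: "0 \<le> s" "s < 1" and b: "\<beta> > 0"
  shows "prob (ratio_above \<beta> w) \<le> \<beta> powr (-s) * (\<Prod>t\<in>T. (1 + \<tau> t / \<sigma>) powr s / (1 - s\<^sup>2))"
proof -
  have s2: "s\<^sup>2 < 1" using s by (simp add: abs_square_less_1)
  let ?pr = "\<Prod>t\<in>T. (1 + \<tau> t / \<sigma>) powr s / (1 - s\<^sup>2)"
  have pr: "?pr \<ge> 0" using s2 by (intro prod_nonneg) auto
  have bs: "\<beta> powr (-s) * \<beta> powr s = 1" using b by (simp add: powr_add[symmetric])
  let ?A = "{\<omega>\<in>space P. 1 \<le> ennreal (\<beta> powr (-s)) * ennreal (ratio w \<omega> powr s)}"
  have "emeasure P (ratio_above \<beta> w) \<le> emeasure P ?A"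
  proof (rule emeasure_mono)
    show "(ratio_above \<beta> w) \<subseteq> ?A"
    proof safe
      fix \<omega> assume "\<beta> \<le> ratio w \<omega>"
      then have "\<beta> powr (-s) * \<beta> powr s \<le> \<beta> powr (-s) * ratio w \<omega> powr s"
        using s b by (intro mult_left_mono powr_mono2) auto
      then show "1 \<le> ennreal (\<beta> powr (-s)) * ennreal (ratio w \<omega> powr s)"
        unfolding bs by (simp add: ennreal_mult[symmetric])
    qed
  qed (use w in measurable)
  also have "emeasure P ?A \<le> ennreal (\<beta> powr (-s)) * (\<integral>\<^sup>+\<omega>. ennreal (ratio w \<omega> powr s) * indicator (space P) \<omega> \<partial>P)"
    using nn_integral_Markov_inequality[where u="\<lambda>\<omega>. ennreal (ratio w \<omega> powr s)" and M=P and A="space P" and c="ennreal (\<beta> powr (-s))"] w by simp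
  also have "(\<integral>\<^sup>+\<omega>. ennreal (ratio w \<omega> powr s) * indicator (space P) \<omega> \<partial>P) = (\<integral>\<^sup>+\<omega>. ennreal (ratio w \<omega> powr s) \<partial>P)"
    by (intro nn_integral_cong) simp
  also have "\<dots> \<le> ennreal ?pr"
    using nn_integral_ratio_powr[OF w, of s] s by simp
  finally show ?thesis
    using pr unfolding emeasure_eq_measure by (simp add: ennreal_mult[symmetric] mult_left_mono)
qed

text \<open>Replacing the law of the received signal by the output law \<open>Q\<close>, which does not depend on the
  message, costs at most a factor \<open>\<beta>\<close> where \<open>ratio < \<beta>\<close>; under \<open>Q\<close> the decoding events of distinct
  messages are disjoint.\<close>

lemma sum_prob_correct_small_ratio:
  assumes b: "\<beta> > 0"
  shows "(\<Sum>w<M. prob (correct_below \<beta> w)) \<le> \<beta>"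
proof -
  define KC where "KC = Some ` {..<M} \<times> T"
  define KN where "KN = {None :: nat option} \<times> T"
  let ?BC = "PiM KC (\<lambda>_. borel :: complex measure)" and ?BN = "PiM KN (\<lambda>_. borel :: complex measure)"
  let ?BT = "PiM T (\<lambda>_. borel :: complex measure)"
  \<comment> \<open>\<open>C\<close> is the received code-book, \<open>V\<close> the noise and
    \<open>Q\<close> the output law. \<open>D\<close> and \<open>L\<close> are the decision and the
    likelihood ratio as functions of code-book and received vector, so that the latter can be
    integrated out for a fixed code-book.\<close>
  define C where "C \<omega> = restrict (\<lambda>i. Z i \<omega>) KC" for \<omega>
  define V where "V \<omega> = (\<lambda>t\<in>T. W t \<omega>)" for \<omega>
  define Q where "Q = PiM T (\<lambda>t. cgauss (\<sigma> + \<tau> t))"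
  define D where "D c y = ml_decode \<sigma> M T (\<lambda>m t. c (Some m, t)) y" for c :: "nat option \<times> nat \<Rightarrow> complex" and y
  define L where "L c w y = (\<Prod>t\<in>T. info_ratio \<sigma> (\<tau> t) (y t - c (Some w, t)) (y t))" for c :: "nat option \<times> nat \<Rightarrow> complex" and w y
  define F where "F w c y = (indicator {(c, y). D c y = w \<and> L c w y < \<beta>} (c, y) :: ennreal)" for w c y
  have [measurable]: "(\<lambda>p. fst p (Some m, t)) \<in> borel_measurable (?BC \<Otimes>\<^sub>M ?BT)" if "m < M" "t \<in> T" for m t
    by (rule measurable_compose[OF measurable_fst measurable_component_singleton]) (use that in \<open>auto simp: KC_def\<close>)
  have [measurable]: "(\<lambda>p. snd p t) \<in> borel_measurable (?BC \<Otimes>\<^sub>M ?BT)" if "t \<in> T" for t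
    by (rule measurable_compose[OF measurable_snd measurable_component_singleton]) (use that in auto)
  have D[measurable]: "(\<lambda>p. D (fst p) (snd p)) \<in> ?BC \<Otimes>\<^sub>M ?BT \<rightarrow>\<^sub>M count_space UNIV"
    unfolding D_def by measurable
  have L[measurable]: "(\<lambda>p. L (fst p) w (snd p)) \<in> borel_measurable (?BC \<Otimes>\<^sub>M ?BT)" if "w < M" for w
    unfolding L_def using that by measurable
  have F_alt: "F w (fst p) (snd p) = (if D (fst p) (snd p) = w \<and> L (fst p) w (snd p) < \<beta> then 1 else 0)" for w p
    by (cases p) (simp add: F_def)
  have F[measurable]: "(\<lambda>p. F w (fst p) (snd p)) \<in> borel_measurable (?BC \<Otimes>\<^sub>M ?BT)" if "w < M" for w
    unfolding F_alt using that by measurable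
  have KT: "finite T" by (rule finite_T)
  define V' where "V' \<omega> = restrict (\<lambda>i. Z i \<omega>) KN" for \<omega>
  define conv where "conv v = (\<lambda>t\<in>T. v (None, t))" for v :: "nat option \<times> nat \<Rightarrow> complex"
  have ind: "indep_var ?BC C ?BN V'"
    unfolding C_def[abs_def] V'_def[abs_def]
    by (rule indep_var_restrict[OF indep_Z]) (auto simp: KC_def KN_def)
  have conv[measurable]: "conv \<in> ?BN \<rightarrow>\<^sub>M ?BT"
    unfolding conv_def by (intro measurable_restrict measurable_component_singleton) (auto simp: KN_def)
  have conv_V': "conv (V' \<omega>) = V \<omega>" for \<omega>
    by (auto simp: conv_def V'_def V_def KN_def fun_eq_iff)
  then have V_conv: "V = (\<lambda>\<omega>. conv (V' \<omega>))" by auto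
  have dV: "distr P ?BT V = PiM T (\<lambda>_. cgauss \<sigma>)"
  \<comment> \<open>The description of independence by product laws asks for a nonempty index set;
    for empty \<open>T\<close> both sides are the only probability measure on a one-point
    space.\<close>
  proof (cases "T = {}")
    case True
    interpret VV: prob_space "distr P ?BT V"
      by (rule prob_space_distr) (auto simp: V_def[abs_def] intro!: measurable_restrict)
    show ?thesis
      using VV.emeasure_space_1 unfolding True
      by (intro measure_eqI) (auto simp: PiM_empty space_PiM subset_singleton_iff)
  next
    case False
    have "indep_vars (\<lambda>_. borel) (\<lambda>t \<omega>. restrict (\<lambda>i. Z i \<omega>) {(None, t)} (None, t)) T"
      by (rule indep_vars_compose2[OF indep_vars_restrict[OF indep_Z, where K="\<lambda>t. {(None, t)}"]])
         (auto simp: disjoint_family_on_def)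
    then have "indep_vars (\<lambda>_. borel) W T" by simp
    then have "distr P ?BT V = PiM T (\<lambda>t. distr P borel (W t))"
      unfolding V_def[abs_def] by (subst (asm) indep_vars_iff_distr_eq_PiM'[OF False]) auto
    then show ?thesis by (simp add: distr_W cong: PiM_cong)
  qed
  have Qp: "prob_space Q"
    unfolding Q_def
    by (intro prob_space_PiM) (use sigma_pos tau_pos in \<open>auto intro!: prob_space_cgauss add_pos_pos\<close>)
  interpret Q: prob_space Q by (rule Qp)
  have setsQ: "sets Q = sets ?BT" unfolding Q_def by (intro sets_PiM_cong) auto
  have spQ: "space Q = space ?BT" by (rule sets_eq_imp_space_eq[OF setsQ])
  let ?dC = "distr P ?BC C"
  have Cm[measurable]: "C \<in> P \<rightarrow>\<^sub>M ?BC" and Vm[measurable]: "V' \<in> P \<rightarrow>\<^sub>M ?BN"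
    using indep_var_distribution_eq[THEN iffD1, OF ind] by auto
  interpret dC: prob_space ?dC by (rule prob_space_distr) simp
  have sets_NQ: "sets (PiM T (\<lambda>_. cgauss \<sigma>)) = sets ?BT" by (intro sets_PiM_cong) auto
  have "sets (?dC \<Otimes>\<^sub>M Q) = sets (?BC \<Otimes>\<^sub>M ?BT)"
    by (intro sets_pair_measure_cong) (auto simp: setsQ)
  then have D'[measurable]: "(\<lambda>p. D (fst p) (snd p)) \<in> ?dC \<Otimes>\<^sub>M Q \<rightarrow>\<^sub>M count_space UNIV"
    using D measurable_cong_sets by blast
  have mQ: "(\<lambda>c. emeasure Q {y\<in>space Q. D c y = w}) \<in> borel_measurable ?dC" for w
  proof -
    have "(\<lambda>c. emeasure Q (Pair c -` {p\<in>space (?dC \<Otimes>\<^sub>M Q). D (fst p) (snd p) = w})) \<in> borel_measurable ?dC"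
      by (rule Q.measurable_emeasure_Pair) measurable
    then show ?thesis
      by (rule measurable_cong[THEN iffD1, rotated]) (auto intro!: arg_cong2[where f=emeasure] simp: space_pair_measure)
  qed
  have step: "emeasure P (correct_below \<beta> w) \<le> ennreal \<beta> * (\<integral>\<^sup>+c. emeasure Q {y\<in>space Q. D c y = w} \<partial>?dC)"
    if w: "w < M" for w
  proof -
    define y where "y c n = (\<lambda>t\<in>T. c (Some w, t) + n t)" for c :: "nat option \<times> nat \<Rightarrow> complex" and n
    have ym[measurable]: "(\<lambda>p. y (fst p) (snd p)) \<in> ?BC \<Otimes>\<^sub>M ?BT \<rightarrow>\<^sub>M ?BT"
      unfolding y_def using w by (intro measurable_restrict) measurable
    have Fy[measurable]: "(\<lambda>p. F w (fst p) (y (fst p) (snd p))) \<in> borel_measurable (?BC \<Otimes>\<^sub>M ?BT)"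
      using measurable_compose[OF measurable_Pair[OF measurable_fst ym] F[OF w]] by simp
    have ev: "indicator (correct_below \<beta> w) \<omega> = F w (C \<omega>) (y (C \<omega>) (V \<omega>))"
      if "\<omega> \<in> space P" for \<omega>
    proof -
      have c: "C \<omega> (Some m, t) = X m t \<omega>" if "m < M" "t \<in> T" for m t
        using that by (simp add: C_def KC_def)
      have "dec w \<omega> = D (C \<omega>) (y (C \<omega>) (V \<omega>))"
        unfolding dec_def D_def ml_decode_def is_arg_max_def
        by (intro arg_cong[where f=Least] ext conj_cong refl arg_cong[where f=Not] ex_cong1)
           (auto simp: c[OF w] c y_def V_def)
      moreover have "ratio w \<omega> = L (C \<omega>) w (y (C \<omega>) (V \<omega>))"
        unfolding ratio_def L_def by (intro prod.cong) (auto simp: y_def V_def c[OF w])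
      ultimately show ?thesis using that by (simp add: F_def indicator_def)
    qed
    have "emeasure P (correct_below \<beta> w) = (\<integral>\<^sup>+\<omega>. indicator (correct_below \<beta> w) \<omega> \<partial>P)"
      using w by (subst nn_integral_indicator) measurable
    also have "\<dots> = (\<integral>\<^sup>+\<omega>. (\<lambda>p. F w (fst p) (y (fst p) (conv (snd p)))) (C \<omega>, V' \<omega>) \<partial>P)"
      by (intro nn_integral_cong) (simp add: ev conv_V')
    also have "\<dots> = (\<integral>\<^sup>+c. \<integral>\<^sup>+v. F w c (y c (conv v)) \<partial>distr P ?BN V' \<partial>?dC)"
    proof -
      have "(\<lambda>p. F w (fst p) (y (fst p) (conv (snd p)))) \<in> borel_measurable (?BC \<Otimes>\<^sub>M ?BN)"
        using measurable_compose[OF measurable_Pair[OF measurable_fst measurable_compose[OF measurable_snd conv]] Fy] by simp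
      then show ?thesis by (subst nn_integral_indep_pair[OF ind]) simp_all
    qed
    also have "\<dots> = (\<integral>\<^sup>+c. \<integral>\<^sup>+n. F w c (y c n) \<partial>PiM T (\<lambda>_. cgauss \<sigma>) \<partial>?dC)"
    proof (rule nn_integral_cong)
      fix c assume "c \<in> space ?dC"
      then have c: "c \<in> space ?BC" by simp
      have [measurable]: "(\<lambda>n. F w c (y c n)) \<in> borel_measurable ?BT"
        using measurable_compose[OF measurable_Pair1'[OF c] Fy] by simp
      show "(\<integral>\<^sup>+v. F w c (y c (conv v)) \<partial>distr P ?BN V') = (\<integral>\<^sup>+n. F w c (y c n) \<partial>PiM T (\<lambda>_. cgauss \<sigma>))"
        unfolding dV[symmetric] V_conv by (simp add: nn_integral_distr)
    qed
    also have "\<dots> \<le> (\<integral>\<^sup>+c. ennreal \<beta> * emeasure Q {y\<in>space Q. D c y = w} \<partial>?dC)"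
    proof (rule nn_integral_mono)
      fix c assume "c \<in> space ?dC"
      then have c: "c \<in> space ?BC" by simp
      have Fc[measurable]: "F w c \<in> borel_measurable ?BT"
        using measurable_compose[OF measurable_Pair1'[OF c] F[OF w]] by simp
      have yc[measurable]: "y c \<in> PiM T (\<lambda>_. cgauss \<sigma>) \<rightarrow>\<^sub>M ?BT"
        unfolding y_def using w by (intro measurable_restrict) measurable
      have Dc[measurable]: "D c \<in> ?BT \<rightarrow>\<^sub>M count_space UNIV"
        using measurable_compose[OF measurable_Pair1'[OF c] D] by simp
      have Lc[measurable]: "(\<lambda>y. \<Prod>t\<in>T. ennreal (info_ratio \<sigma> (\<tau> t) (y t - c (Some w, t)) (y t))) \<in> borel_measurable ?BT"
        by measurable
      have "(\<integral>\<^sup>+n. F w c (y c n) \<partial>PiM T (\<lambda>_. cgauss \<sigma>)) = (\<integral>\<^sup>+y. F w c y \<partial>distr (PiM T (\<lambda>_. cgauss \<sigma>)) ?BT (y c))"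
        by (subst nn_integral_distr) auto
      also have "\<dots> = (\<integral>\<^sup>+y. F w c y \<partial>density Q (\<lambda>y. \<Prod>t\<in>T. ennreal (info_ratio \<sigma> (\<tau> t) (y t - c (Some w, t)) (y t))))"
        unfolding y_def Q_def by (subst distr_PiM_cgauss_shift[OF finite_T sigma_pos tau_pos]) auto
      also have "\<dots> = (\<integral>\<^sup>+y. (\<Prod>t\<in>T. ennreal (info_ratio \<sigma> (\<tau> t) (y t - c (Some w, t)) (y t))) * F w c y \<partial>Q)"
        by (rule nn_integral_density) (auto simp: measurable_cong_sets[OF setsQ refl])
      also have "\<dots> = (\<integral>\<^sup>+y. ennreal (L c w y) * F w c y \<partial>Q)"
        by (intro nn_integral_cong arg_cong2[where f="(*)"] refl)
           (auto simp: L_def intro!: prod_ennreal less_imp_le info_ratio_pos sigma_pos tau_pos)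
      also have "\<dots> \<le> (\<integral>\<^sup>+y. ennreal \<beta> * indicator {y\<in>space Q. D c y = w} y \<partial>Q)"
        by (intro nn_integral_mono) (auto simp: F_def intro!: ennreal_leI split: split_indicator)
      also have "\<dots> = ennreal \<beta> * emeasure Q {y\<in>space Q. D c y = w}"
        by (subst nn_integral_cmult_indicator) (auto simp: setsQ spQ)
      finally show "(\<integral>\<^sup>+n. F w c (y c n) \<partial>PiM T (\<lambda>_. cgauss \<sigma>)) \<le> ennreal \<beta> * emeasure Q {y\<in>space Q. D c y = w}" .
    qed
    also have "\<dots> = ennreal \<beta> * (\<integral>\<^sup>+c. emeasure Q {y\<in>space Q. D c y = w} \<partial>?dC)"
      by (rule nn_integral_cmult) (rule mQ)
    finally show ?thesis .
  qed
  have "(\<Sum>w<M. emeasure P (correct_below \<beta> w))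
    \<le> (\<Sum>w<M. ennreal \<beta> * (\<integral>\<^sup>+c. emeasure Q {y\<in>space Q. D c y = w} \<partial>?dC))"
    by (intro sum_mono step) auto
  also have "\<dots> = ennreal \<beta> * (\<integral>\<^sup>+c. (\<Sum>w<M. emeasure Q {y\<in>space Q. D c y = w}) \<partial>?dC)"
    by (simp add: sum_distrib_left[symmetric] nn_integral_sum mQ)
  also have "\<dots> \<le> ennreal \<beta> * (\<integral>\<^sup>+c. 1 \<partial>?dC)"
  proof (intro mult_left_mono nn_integral_mono)
    fix c assume "c \<in> space ?dC"
    then have c: "c \<in> space ?BC" by simp
    have Dc[measurable]: "D c \<in> ?BT \<rightarrow>\<^sub>M count_space UNIV"
      using measurable_compose[OF measurable_Pair1'[OF c] D] by simp
    have "(\<Sum>w<M. emeasure Q {y\<in>space Q. D c y = w}) = emeasure Q (\<Union>w<M. {y\<in>space Q. D c y = w})"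
      by (rule sum_emeasure) (auto simp: disjoint_family_on_def setsQ spQ)
    also have "\<dots> \<le> 1" by (rule Q.emeasure_le_1)
    finally show "(\<Sum>w<M. emeasure Q {y\<in>space Q. D c y = w}) \<le> 1" .
  qed simp
  also have "\<dots> = ennreal \<beta>" using dC.emeasure_space_1 by simp
  finally show ?thesis
    using b unfolding emeasure_eq_measure by (subst (asm) sum_ennreal) auto
qed

text \<open>Correct decoding with a ratio of at least \<open>\<beta>\<close> is rare by a positive
  moment; with a smaller ratio, the messages share a total probability of at most
  \<open>\<beta>\<close>, i.e. \<open>\<beta> / M\<close> on average.\<close>

lemma decoding_correct_le:
  assumes s: "0 \<le> s" "s < 1" and b: "\<beta> > 0" and M: "M > 0"
  shows "(\<Sum>w<M. prob (correct w)) / real M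
    \<le> \<beta> powr (-s) * (\<Prod>t\<in>T. (1 + \<tau> t / \<sigma>) powr s / (1 - s\<^sup>2)) + \<beta> / real M"
proof -
  let ?q = "\<beta> powr (-s) * (\<Prod>t\<in>T. (1 + \<tau> t / \<sigma>) powr s / (1 - s\<^sup>2))"
  have "(\<Sum>w<M. prob (correct w))
    \<le> (\<Sum>w<M. prob (correct_below \<beta> w) + ?q)"
  proof (rule sum_mono)
    fix w assume "w \<in> {..<M}"
    then have w: "w < M" by simp
    have [measurable]: "(correct_below \<beta> w) \<in> events" "(ratio_above \<beta> w) \<in> events"
      using w by measurable
    have "prob (correct w) \<le> prob ((correct_below \<beta> w) \<union> (ratio_above \<beta> w))"
      by (rule finite_measure_mono) auto
    also have "\<dots> \<le> prob (correct_below \<beta> w) + prob (ratio_above \<beta> w)"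
      by (rule measure_Un_le) auto
    finally show "prob (correct w) \<le> prob (correct_below \<beta> w) + ?q"
      using prob_ratio_ge[OF w s b] by linarith
  qed
  also have "\<dots> = (\<Sum>w<M. prob (correct_below \<beta> w)) + real M * ?q"
    by (simp add: sum.distrib)
  also have "\<dots> \<le> \<beta> + real M * ?q"
    using sum_prob_correct_small_ratio[OF b] by simp
  finally show ?thesis
    using M by (simp add: field_simps)
qed

end

section \<open>Decoding errors for fixed channel gains\<close>

lemma power_one_minus_ge_half:
  assumes "real n \<le> l" "l > 0"
  shows "(1 - 1 / (4 * l)) ^ n \<ge> (1 / 2 :: real)"
proof (cases "n = 0")
  case False
  then have l: "l \<ge> 1" using assms by (cases n) auto
  have "1 / 2 \<le> 1 + real n * (- 1 / (4 * l))" using assms l by (simp add: field_simps)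
  also have "\<dots> \<le> (1 + - 1 / (4 * l)) ^ n"
    using l by (intro Bernoulli_inequality) (simp add: field_simps)
  finally show ?thesis by simp
qed simp

context gaussian_code
begin

definition info :: real where
  "info = (\<Sum>t\<in>T. log 2 (1 + \<tau> t / \<sigma>))"

lemma prod_powr_info: "(\<Prod>t\<in>T. (1 + \<tau> t / \<sigma>) powr x) = 2 powr (x * info)"
proof -
  have "(\<Prod>t\<in>T. (1 + \<tau> t / \<sigma>) powr x) = (\<Prod>t\<in>T. 2 powr (x * log 2 (1 + \<tau> t / \<sigma>)))"
  proof (intro prod.cong refl)
    fix t assume "t \<in> T"
    then have "1 + \<tau> t / \<sigma> > 0" using sigma_pos tau_pos[of t] by (simp add: add_pos_pos)
    then have "1 + \<tau> t / \<sigma> = 2 powr log 2 (1 + \<tau> t / \<sigma>)" by simp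
    then show "(1 + \<tau> t / \<sigma>) powr x = 2 powr (x * log 2 (1 + \<tau> t / \<sigma>))"
      by (metis powr_powr mult.commute)
  qed
  also have "\<dots> = 2 powr (\<Sum>t\<in>T. x * log 2 (1 + \<tau> t / \<sigma>))"
    by (rule powr_sum[symmetric]) (use finite_T in auto)
  finally show ?thesis by (simp add: info_def sum_distrib_left)
qed

lemma prod_div_const: "(\<Prod>t\<in>T. f t / (c::real)) = (\<Prod>t\<in>T. f t) / c ^ card T"
  by (simp add: prod_dividef)

text \<open>The exponent \<open>s = 1 / (2 * sqrt l)\<close> keeps the second-order factor \<open>(1 - s\<^sup>2) ^ l\<close> bounded, while an
  excess information \<open>\<Delta>\<close> that dominates \<open>sqrt l\<close> still gives a vanishing bound.\<close>

lemma decoding_error_le_info: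
  assumes w: "w < M" and l: "real (card T) \<le> l" "l \<ge> 1" and M: "real M \<le> 2 powr b" and i: "info \<ge> b + \<Delta>"
  shows "prob (wrong w) \<le> 2 * 2 powr (- \<Delta> / (4 * sqrt l)) + 2 powr (- \<Delta> / 2)"
proof -
  define s where "s = 1 / (2 * sqrt l)"
  have "1 < 2 * sqrt l" using real_sqrt_ge_one[OF l(2)] by linarith
  then have s: "0 \<le> s" "s < 1" "s\<^sup>2 = 1 / (4 * l)"
    using l by (auto simp: s_def field_simps power2_eq_square)
  have half: "(1 - s\<^sup>2) ^ card T \<ge> 1 / 2"
    unfolding s using l by (intro power_one_minus_ge_half) auto
  \<comment> \<open>The threshold lies halfway, on the logarithmic scale, between the bound on the
    code size and the guaranteed information, so both error terms decay with
    \<open>\<Delta>\<close>.\<close>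
  have "prob (wrong w)
      \<le> (2 powr (b + \<Delta> / 2)) powr s * (\<Prod>t\<in>T. (1 + \<tau> t / \<sigma>) powr (- s) / (1 - s\<^sup>2)) + real M / 2 powr (b + \<Delta> / 2)"
    by (rule decoding_error_le[OF w s(1,2)]) simp
  also have "\<dots> = 2 powr (s * (b + \<Delta> / 2)) * 2 powr (- s * info) / (1 - s\<^sup>2) ^ card T + real M / 2 powr (b + \<Delta> / 2)"
    by (simp only: prod_div_const prod_powr_info powr_powr) (simp add: mult.commute)
  also have "2 powr (s * (b + \<Delta> / 2)) * 2 powr (- s * info) = 2 powr (s * (b + \<Delta> / 2 - info))"
    by (simp add: powr_add[symmetric] algebra_simps)
  also have "2 powr (s * (b + \<Delta> / 2 - info)) / (1 - s\<^sup>2) ^ card T \<le> 2 powr (s * (- \<Delta> / 2)) / (1 / 2)"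
    using half i s by (intro frac_le powr_mono mult_left_mono) auto
  also have "real M / 2 powr (b + \<Delta> / 2) \<le> 2 powr b / 2 powr (b + \<Delta> / 2)"
    using M by (intro divide_right_mono) auto
  also have "2 powr b / 2 powr (b + \<Delta> / 2) = 2 powr (- \<Delta> / 2)"
    by (simp add: powr_diff[symmetric])
  finally show ?thesis by (simp add: s_def)
qed

lemma decoding_correct_le_info:
  assumes l: "real (card T) \<le> l" "l \<ge> 1" and M: "2 powr b / 2 \<le> real M" and i: "info \<le> b - \<Delta>"
  shows "(\<Sum>w<M. prob (correct w)) / real M \<le> 2 * 2 powr (- \<Delta> / (4 * sqrt l)) + 2 * 2 powr (- \<Delta> / 2)"
proof -
  define s where "s = 1 / (2 * sqrt l)"
  have "1 < 2 * sqrt l" using real_sqrt_ge_one[OF l(2)] by linarith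
  then have s: "0 \<le> s" "s < 1" "s\<^sup>2 = 1 / (4 * l)"
    using l by (auto simp: s_def field_simps power2_eq_square)
  have half: "(1 - s\<^sup>2) ^ card T \<ge> 1 / 2"
    unfolding s using l by (intro power_one_minus_ge_half) auto
  have "2 powr b / 2 > 0" by simp
  then have Mp: "real M > 0" using M by linarith
  \<comment> \<open>Again halfway, now between the information and the larger code size.\<close>
  have "(\<Sum>w<M. prob (correct w)) / real M
      \<le> (2 powr (b - \<Delta> / 2)) powr (- s) * (\<Prod>t\<in>T. (1 + \<tau> t / \<sigma>) powr s / (1 - s\<^sup>2)) + 2 powr (b - \<Delta> / 2) / real M"
    by (rule decoding_correct_le[OF s(1,2)]) (use Mp in auto)
  also have "\<dots> = 2 powr (- s * (b - \<Delta> / 2)) * 2 powr (s * info) / (1 - s\<^sup>2) ^ card T + 2 powr (b - \<Delta> / 2) / real M"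
    by (simp only: prod_div_const prod_powr_info powr_powr) (simp add: mult.commute)
  also have "2 powr (- s * (b - \<Delta> / 2)) * 2 powr (s * info) = 2 powr (s * (info - b + \<Delta> / 2))"
    by (simp add: powr_add[symmetric] algebra_simps)
  also have "2 powr (s * (info - b + \<Delta> / 2)) / (1 - s\<^sup>2) ^ card T \<le> 2 powr (s * (- \<Delta> / 2)) / (1 / 2)"
    using half i s by (intro frac_le powr_mono mult_left_mono) auto
  also have "2 powr (b - \<Delta> / 2) / real M \<le> 2 powr (b - \<Delta> / 2) / (2 powr b / 2)"
    using M by (intro divide_left_mono) (use Mp in auto)
  also have "2 powr (b - \<Delta> / 2) / (2 powr b / 2) = 2 * 2 powr (- \<Delta> / 2)"
    by (simp add: powr_diff powr_minus_divide)
  finally show ?thesis by (simp add: s_def)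
qed

end

section \<open>Real and fictitious decisions: coupling and measurability\<close>

fun gain_coord :: "coord \<Rightarrow> bool" where
  "gain_coord (Relay_Gain i j) = True"
| "gain_coord (Dest_Gain i) = True"
| "gain_coord _ = False"

abbreviation "resample \<equiv> mix {k. gain_coord k}"

abbreviation "relay_signal p \<omega> \<omega>' j m t \<equiv>
  \<Sum>i\<in>transmitting p \<omega> t. \<omega> (Relay_Gain i j) * \<omega>' (Code_Symbol i m t)"

abbreviation "dest_signal p \<omega> \<omega>' m t \<equiv>
  \<Sum>i\<in>transmitting p \<omega> t. \<omega> (Dest_Gain i) * \<omega>' (Code_Symbol i m t)"

abbreviation "relay_variance p \<omega> j t \<equiv>
  symbol_energy p * (\<Sum>i\<in>transmitting p \<omega> t. (cmod (\<omega> (Relay_Gain i j)))\<^sup>2)"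

abbreviation "dest_variance p \<omega> t \<equiv>
  symbol_energy p * (\<Sum>i\<in>transmitting p \<omega> t. (cmod (\<omega> (Dest_Gain i)))\<^sup>2)"

abbreviation "listening p \<omega> j \<equiv> {\<tau>. \<tau> < len p \<and> j \<notin> transmitting p \<omega> \<tau>}"

text \<open>The decisions that a relay and the destination would take if all active relays sent the correct
  codeword.\<close>

definition relay_genie :: "ddf \<Rightarrow> (coord \<Rightarrow> complex) \<Rightarrow> nat \<Rightarrow> nat \<Rightarrow> nat" where
  "relay_genie p \<omega> w j = ml_decode (relay_noise_var p) (num_messages p) (listening p \<omega> j)
       (\<lambda>m \<tau>. relay_signal p \<omega> \<omega> j m \<tau>)
       (\<lambda>\<tau>. (relay_signal p \<omega> \<omega> j w \<tau>) + \<omega> (Relay_Noise j \<tau>))"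

definition dest_genie :: "ddf \<Rightarrow> (coord \<Rightarrow> complex) \<Rightarrow> nat \<Rightarrow> nat" where
  "dest_genie p \<omega> w = ml_decode (dest_noise_var p) (num_messages p) {..<len p}
       (\<lambda>m t. dest_signal p \<omega> \<omega> m t)
       (\<lambda>t. (dest_signal p \<omega> \<omega> w t) + \<omega> (Dest_Noise t))"

text \<open>The random index set is replaced by a fixed one with indicator weights.\<close>

lemma measurable_sum_random_set:
  fixes f :: "nat \<Rightarrow> 'a \<Rightarrow> 'b :: {second_countable_topology, topological_comm_monoid_add}"
  assumes "\<And>\<omega>. S \<omega> \<subseteq> {..<n}"
    and [measurable]: "\<And>i. i < n \<Longrightarrow> Measurable.pred M (\<lambda>\<omega>. i \<in> S \<omega>)" "\<And>i. i < n \<Longrightarrow> f i \<in> borel_measurable M"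
  shows "(\<lambda>\<omega>. \<Sum>i\<in>S \<omega>. f i \<omega>) \<in> borel_measurable M"
proof -
  have "(\<Sum>i\<in>S \<omega>. f i \<omega>) = (\<Sum>i<n. if i \<in> S \<omega> then f i \<omega> else 0)" for \<omega>
    using assms(1)[of \<omega>] by (simp add: sum.If_cases Int_absorb1)
  then show ?thesis by simp
qed

text \<open>The random set of observed intervals takes finitely many values, and for each of them
  the decoder is measurable.\<close>

lemma measurable_ml_decode_random_set:
  assumes T: "finite T" "\<And>\<omega>. S \<omega> \<subseteq> T" "\<And>t. t \<in> T \<Longrightarrow> Measurable.pred N (\<lambda>\<omega>. t \<in> S \<omega>)"
    and x: "\<And>m t. m < M \<Longrightarrow> t \<in> T \<Longrightarrow> (\<lambda>\<omega>. x \<omega> m t) \<in> borel_measurable N"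
    and y: "\<And>t. t \<in> T \<Longrightarrow> (\<lambda>\<omega>. y \<omega> t) \<in> borel_measurable N"
  shows "(\<lambda>\<omega>. ml_decode s M (S \<omega>) (x \<omega>) (y \<omega>)) \<in> N \<rightarrow>\<^sub>M count_space UNIV"
proof (rule measurable_compose_countable'[where f="\<lambda>A \<omega>. ml_decode s M A (x \<omega>) (y \<omega>)" and I="Pow T"])
  fix A assume "A \<in> Pow T"
  then show "(\<lambda>\<omega>. ml_decode s M A (x \<omega>) (y \<omega>)) \<in> N \<rightarrow>\<^sub>M count_space UNIV"
    by (intro ml_decode_measurable x y) auto
next
  show "S \<in> N \<rightarrow>\<^sub>M count_space (Pow T)"
    unfolding measurable_count_space_eq2[OF finite_Pow_iff[THEN iffD2, OF T(1)]]
  proof (intro conjI ballI)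
    fix A assume A: "A \<in> Pow T"
    have "Measurable.pred N (\<lambda>\<omega>. \<forall>t\<in>T. (t \<in> S \<omega>) = (t \<in> A))"
      using T by (intro pred_intros_finite pred_intros_logic) auto
    then have "{\<omega>\<in>space N. \<forall>t\<in>T. (t \<in> S \<omega>) = (t \<in> A)} \<in> sets N" by measurable
    also have "{\<omega>\<in>space N. \<forall>t\<in>T. (t \<in> S \<omega>) = (t \<in> A)} = S -` {A} \<inter> space N"
      using A T(2) by blast
    finally show "S -` {A} \<inter> space N \<in> sets N" .
  qed (use T in auto)
qed (use T in \<open>auto intro: countable_finite\<close>)

locale ddf_system =
  fixes p :: ddf
  assumes relay_noise_pos: "relay_noise_var p > 0" and dest_noise_pos: "dest_noise_var p > 0"
    and snr_pos: "snr p > 0" and rate_pos: "rate p > 0" and nodes_pos: "nodes p > 0"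
begin

abbreviation "P \<equiv> ddf_space p"

lemma energy_pos: "symbol_energy p > 0"
  by (simp add: symbol_energy_def snr_pos dest_noise_pos)

lemma noise_ratio_pos: "noise_ratio p > 0"
  by (simp add: noise_ratio_def relay_noise_pos dest_noise_pos)

lemma coord_variance_pos: "coord_variance p k > 0"
  by (cases k) (auto simp: relay_noise_pos dest_noise_pos energy_pos)

lemma prob_space_coord: "prob_space (cgauss (coord_variance p k))"
  by (rule prob_space_cgauss[OF coord_variance_pos])

sublocale prob_space P
  unfolding ddf_space_def by (intro prob_space_PiM prob_space_coord)

lemma space_P [simp]: "space P = UNIV"
  by (simp add: ddf_space_def space_PiM)

lemma measurable_coord [measurable]: "(\<lambda>\<omega>. \<omega> k) \<in> borel_measurable P"
proof -
  have "(\<lambda>\<omega>. \<omega> k) \<in> P \<rightarrow>\<^sub>M cgauss (coord_variance p k)"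
    unfolding ddf_space_def by (rule measurable_component_singleton) simp
  then show ?thesis by (simp only: measurable_cong_sets[OF refl sets_cgauss])
qed

lemma distr_coord: "distr P borel (\<lambda>\<omega>. \<omega> k) = cgauss (coord_variance p k)"
proof -
  have "distr P borel (\<lambda>\<omega>. \<omega> k) = distr P (cgauss (coord_variance p k)) (\<lambda>\<omega>. \<omega> k)"
    by (rule distr_cong) auto
  also have "\<dots> = cgauss (coord_variance p k)"
    unfolding ddf_space_def by (rule distr_PiM_component) (auto intro: prob_space_coord)
  finally show ?thesis .
qed

lemma indep_coords: "indep_vars (\<lambda>_. borel) (\<lambda>k \<omega>. \<omega> k) UNIV"
proof -
  have "distr P (PiM UNIV (\<lambda>_. borel)) (\<lambda>\<omega>. \<lambda>k\<in>UNIV. \<omega> k) = distr P P (\<lambda>\<omega>. \<omega>)"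
    by (rule distr_cong) (auto simp: ddf_space_def intro!: sets_PiM_cong)
  also have "\<dots> = PiM UNIV (\<lambda>k. distr P borel (\<lambda>\<omega>. \<omega> k))"
    by (simp add: distr_id[unfolded id_def] distr_coord) (simp add: ddf_space_def)
  finally show ?thesis
    by (subst indep_vars_iff_distr_eq_PiM') auto
qed

text \<open>Once the gains \<open>h\<close> and the transmitting sets \<open>U t\<close> are frozen,
  the signals of different messages or intervals use disjoint sets of code symbols, none of which is
  a noise coordinate; grouping the coordinates gives the independence. The parameter
  \<open>nz\<close> covers relay noise and destination noise at once.\<close>

lemma gaussian_code_coords:
  assumes T: "finite T" and U: "\<And>t. t \<in> T \<Longrightarrow> finite (U t)" "\<And>t. t \<in> T \<Longrightarrow> U t \<noteq> {}"
    and h: "\<And>t i. t \<in> T \<Longrightarrow> i \<in> U t \<Longrightarrow> h i \<noteq> 0"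
    and nz: "inj nz" "\<And>t i m t'. nz t \<noteq> Code_Symbol i m t'" "\<And>t. coord_variance p (nz t) = \<sigma>"
  shows "gaussian_code P \<sigma> (\<lambda>t. symbol_energy p * (\<Sum>i\<in>U t. (cmod (h i))\<^sup>2)) T M
    (\<lambda>m t \<omega>. \<Sum>i\<in>U t. h i * \<omega> (Code_Symbol i m t)) (\<lambda>t \<omega>. \<omega> (nz t))"
proof
  show "finite T" by fact
  show "\<sigma> > 0" using coord_variance_pos[of "nz 0"] nz(3) by simp
  show "symbol_energy p * (\<Sum>i\<in>U t. (cmod (h i))\<^sup>2) > 0" if "t \<in> T" for t
    using that U h by (intro mult_pos_pos energy_pos sum_pos) auto
  define K where "K = (\<lambda>(a, t). case a of None \<Rightarrow> {nz t} | Some m \<Rightarrow> (\<lambda>i. Code_Symbol i m t) ` U t)"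
  define G where "G = (\<lambda>(a, t) f. case a of None \<Rightarrow> f (nz t) | Some m \<Rightarrow> \<Sum>i\<in>U t. h i * (f (Code_Symbol i m t) :: complex))"
  let ?L = "insert None (Some ` {..<M}) \<times> T"
  have "indep_vars (\<lambda>_. borel) (\<lambda>a \<omega>. G a (restrict (\<lambda>k. \<omega> k) (K a))) ?L"
  proof (rule indep_vars_compose2[OF indep_vars_restrict[OF indep_coords]])
    show "disjoint_family_on K ?L"
      using nz by (auto simp: disjoint_family_on_def K_def inj_eq split: option.splits)
    fix a assume "a \<in> ?L"
    then show "G a \<in> borel_measurable (PiM (K a) (\<lambda>_. borel))"
      by (auto simp: G_def K_def)
  qed auto
  moreover have "G a (restrict (\<lambda>k. \<omega> k) (K a)) = (case a of (a, t) \<Rightarrow> case a of None \<Rightarrow> \<lambda>\<omega>. \<omega> (nz t) | Some m \<Rightarrow> \<lambda>\<omega>. \<Sum>i\<in>U t. h i * \<omega> (Code_Symbol i m t)) \<omega>" for a \<omega>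
    by (auto simp: G_def K_def split: option.splits prod.splits intro!: sum.cong)
  ultimately show "indep_vars (\<lambda>_. borel) (\<lambda>(a, t). case a of None \<Rightarrow> \<lambda>\<omega>. \<omega> (nz t) | Some m \<Rightarrow> \<lambda>\<omega>. \<Sum>i\<in>U t. h i * \<omega> (Code_Symbol i m t)) ?L"
    by (simp add: case_prod_unfold)
  show "distr P borel (\<lambda>\<omega>. \<omega> (nz t)) = cgauss \<sigma>" for t
    by (simp add: distr_coord nz)
  show "distr P borel (\<lambda>\<omega>. \<Sum>i\<in>U t. h i * \<omega> (Code_Symbol i m t)) = cgauss (symbol_energy p * (\<Sum>i\<in>U t. (cmod (h i))\<^sup>2))"
    if "t \<in> T" for m t
  proof (rule distr_indep_sum_cgauss)
    have "indep_vars (\<lambda>_. borel) (\<lambda>i \<omega>. (\<lambda>f. f (Code_Symbol i m t)) (restrict (\<lambda>k. \<omega> k) {Code_Symbol i m t})) (U t)"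
      by (rule indep_vars_compose2[OF indep_vars_restrict[OF indep_coords]]) (auto simp: disjoint_family_on_def)
    then show "indep_vars (\<lambda>_. borel) (\<lambda>i \<omega>. \<omega> (Code_Symbol i m t)) (U t)" by simp
  qed (use that U h in \<open>auto simp: energy_pos distr_coord\<close>)
qed

lemma transmitting_subset: "transmitting p \<omega> t \<subseteq> {..<nodes p}"
  using nodes_pos by (subst transmitting.simps) auto

lemma finite_transmitting [simp]: "finite (transmitting p \<omega> t)"
  by (rule finite_subset[OF transmitting_subset]) simp

lemma zero_in_transmitting [simp]: "0 \<in> transmitting p \<omega> t"
  by (subst transmitting.simps) auto

definition relay_rate :: "(coord \<Rightarrow> complex) \<Rightarrow> nat \<Rightarrow> nat \<Rightarrow> real" where
  "relay_rate \<omega> j \<tau> = log 2 (1 + noise_ratio p * snr p * (\<Sum>i\<in>transmitting p \<omega> \<tau> - {j}. (cmod (\<omega> (Relay_Gain i j)))\<^sup>2))"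

definition dest_rate :: "(coord \<Rightarrow> complex) \<Rightarrow> nat \<Rightarrow> real" where
  "dest_rate \<omega> t = log 2 (1 + snr p * (\<Sum>i\<in>transmitting p \<omega> t. (cmod (\<omega> (Dest_Gain i)))\<^sup>2))"

lemma in_transmitting_iff:
  "j \<in> transmitting p \<omega> t \<longleftrightarrow> j = 0 \<or> (0 < j \<and> j < nodes p \<and> real (len p) * rate p < (\<Sum>\<tau><t - margin p. relay_rate \<omega> j \<tau>))"
  unfolding relay_rate_def by (subst transmitting.simps) auto

lemma relay_rate_nonneg: "relay_rate \<omega> j \<tau> \<ge> 0"
proof -
  have "0 \<le> noise_ratio p * snr p * (\<Sum>i\<in>transmitting p \<omega> \<tau> - {j}. (cmod (\<omega> (Relay_Gain i j)))\<^sup>2)"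
    using noise_ratio_pos snr_pos by (intro mult_nonneg_nonneg sum_nonneg) auto
  then show ?thesis unfolding relay_rate_def by (subst zero_le_log_cancel_iff) auto
qed

lemma transmitting_mono: "s \<le> t \<Longrightarrow> transmitting p \<omega> s \<subseteq> transmitting p \<omega> t"
proof
  fix j assume st: "s \<le> t" and "j \<in> transmitting p \<omega> s"
  moreover have "(\<Sum>\<tau><s - margin p. relay_rate \<omega> j \<tau>) \<le> (\<Sum>\<tau><t - margin p. relay_rate \<omega> j \<tau>)"
    using st by (intro sum_mono2) (auto intro: relay_rate_nonneg)
  ultimately show "j \<in> transmitting p \<omega> t"
    unfolding in_transmitting_iff by auto
qed

text \<open>The transmitting set at \<open>t\<close> is computed from gains and from the
  transmitting sets at strictly earlier times, hence the induction over time.\<close>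

lemma transmitting_resample: "transmitting p (resample \<omega> \<omega>') t = transmitting p \<omega> t"
proof (induction t rule: less_induct)
  case (less t)
  have "relay_rate (resample \<omega> \<omega>') j \<tau> = relay_rate \<omega> j \<tau>" if "\<tau> < t" for j \<tau>
    using less that by (simp add: relay_rate_def)
  then have "(\<Sum>\<tau><t - margin p. relay_rate (resample \<omega> \<omega>') j \<tau>) = (\<Sum>\<tau><t - margin p. relay_rate \<omega> j \<tau>)" for j
    by (intro sum.cong) auto
  then show ?case by (auto simp: in_transmitting_iff)
qed

lemma pred_transmitting: "Measurable.pred P (\<lambda>\<omega>. j \<in> transmitting p \<omega> t)"
proof (induction t arbitrary: j rule: less_induct)
  case (less t)
  have [measurable]: "(\<lambda>\<omega>. relay_rate \<omega> j \<tau>) \<in> borel_measurable P" if "\<tau> < t" for j \<tau>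
  proof -
    have "(\<lambda>\<omega>. \<Sum>i\<in>transmitting p \<omega> \<tau> - {j}. (cmod (\<omega> (Relay_Gain i j)))\<^sup>2) \<in> borel_measurable P"
    proof (rule measurable_sum_random_set[where n="nodes p"])
      show "transmitting p \<omega> \<tau> - {j} \<subseteq> {..<nodes p}" for \<omega> using transmitting_subset by blast
      show "Measurable.pred P (\<lambda>\<omega>. i \<in> transmitting p \<omega> \<tau> - {j})" for i
        using less[OF that, of i] by simp
    qed simp
    then show ?thesis unfolding relay_rate_def by measurable
  qed
  show ?case unfolding in_transmitting_iff by measurable
qed

lemma encoded_measurable: "(\<lambda>\<omega>. encoded p \<omega> w t j) \<in> P \<rightarrow>\<^sub>M count_space UNIV"
proof (induction t arbitrary: j rule: less_induct)
  case (less t)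
  show ?case
  proof (cases "j = 0")
    case True then show ?thesis by (subst encoded.simps) simp
  next
    case False
    have "(\<lambda>\<omega>. ml_decode (relay_noise_var p) (num_messages p) {\<tau>. \<tau> < t \<and> j \<notin> transmitting p \<omega> \<tau>}
       (\<lambda>m \<tau>. relay_signal p \<omega> \<omega> j m \<tau>)
       (\<lambda>\<tau>. (\<Sum>i\<in>transmitting p \<omega> \<tau>. \<omega> (Relay_Gain i j) * \<omega> (Code_Symbol i (encoded p \<omega> w \<tau> i) \<tau>))
            + \<omega> (Relay_Noise j \<tau>))) \<in> P \<rightarrow>\<^sub>M count_space UNIV"
    proof (rule measurable_ml_decode_random_set[where T="{..<t}"])
      show "Measurable.pred P (\<lambda>\<omega>. \<tau> \<in> {\<tau>. \<tau> < t \<and> j \<notin> transmitting p \<omega> \<tau>})" if "\<tau> \<in> {..<t}" for \<tau>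
        using that pred_transmitting[of j \<tau>] by simp
      show "(\<lambda>\<omega>. relay_signal p \<omega> \<omega> j m \<tau>) \<in> borel_measurable P" for m \<tau>
        by (rule measurable_sum_random_set[OF transmitting_subset pred_transmitting]) simp
      show "(\<lambda>\<omega>. (\<Sum>i\<in>transmitting p \<omega> \<tau>. \<omega> (Relay_Gain i j) * \<omega> (Code_Symbol i (encoded p \<omega> w \<tau> i) \<tau>))
            + \<omega> (Relay_Noise j \<tau>)) \<in> borel_measurable P" if "\<tau> \<in> {..<t}" for \<tau>
      proof (intro borel_measurable_add measurable_sum_random_set[OF transmitting_subset pred_transmitting] borel_measurable_times)
        fix i
        have "(\<lambda>\<omega>. encoded p \<omega> w \<tau> i) \<in> P \<rightarrow>\<^sub>M count_space UNIV" using less that by simp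
        then show "(\<lambda>\<omega>. \<omega> (Code_Symbol i (encoded p \<omega> w \<tau> i) \<tau>)) \<in> borel_measurable P"
          \<comment> \<open>The code symbol is looked up at a random message, which has only
            countably many values.\<close>
          by (rule measurable_compose_countable[where f="\<lambda>e \<omega>. \<omega> (Code_Symbol i e \<tau>)", rotated]) simp
      qed simp_all
    qed auto
    then show ?thesis using False by (subst encoded.simps) simp
  qed
qed

lemma dest_decision_measurable: "(\<lambda>\<omega>. dest_decision p \<omega> w) \<in> P \<rightarrow>\<^sub>M count_space UNIV"
  unfolding dest_decision_def
proof (rule ml_decode_measurable)
  show "(\<lambda>\<omega>. dest_signal p \<omega> \<omega> m t) \<in> borel_measurable P" for m t
    by (rule measurable_sum_random_set[OF transmitting_subset pred_transmitting]) simp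
  show "(\<lambda>\<omega>. dest_received p \<omega> w t) \<in> borel_measurable P" for t
    unfolding dest_received_def
  proof (intro borel_measurable_add measurable_sum_random_set[OF transmitting_subset pred_transmitting] borel_measurable_times)
    fix i
    show "(\<lambda>\<omega>. \<omega> (Code_Symbol i (encoded p \<omega> w t i) t)) \<in> borel_measurable P"
      by (rule measurable_compose_countable[where f="\<lambda>e \<omega>. \<omega> (Code_Symbol i e t)", OF _ encoded_measurable]) simp
  qed simp_all
qed

lemma relay_genie_measurable: "(\<lambda>\<omega>. relay_genie p \<omega> w j) \<in> P \<rightarrow>\<^sub>M count_space UNIV"
  unfolding relay_genie_def
proof (rule measurable_ml_decode_random_set[where T="{..<len p}"])
  show "Measurable.pred P (\<lambda>\<omega>. \<tau> \<in> (listening p \<omega> j))" if "\<tau> \<in> {..<len p}" for \<tau>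
    using that pred_transmitting[of j \<tau>] by simp
  have *: "(\<lambda>\<omega>. relay_signal p \<omega> \<omega> j m \<tau>) \<in> borel_measurable P" for m \<tau>
    by (rule measurable_sum_random_set[OF transmitting_subset pred_transmitting]) simp
  then show "(\<lambda>\<omega>. relay_signal p \<omega> \<omega> j m \<tau>) \<in> borel_measurable P" for m \<tau> .
  show "(\<lambda>\<omega>. (relay_signal p \<omega> \<omega> j w \<tau>) + \<omega> (Relay_Noise j \<tau>)) \<in> borel_measurable P" for \<tau>
    by (intro borel_measurable_add *) simp
qed auto

lemma dest_genie_measurable: "(\<lambda>\<omega>. dest_genie p \<omega> w) \<in> P \<rightarrow>\<^sub>M count_space UNIV"
  unfolding dest_genie_def
proof (rule ml_decode_measurable)
  have *: "(\<lambda>\<omega>. dest_signal p \<omega> \<omega> m t) \<in> borel_measurable P" for m t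
    by (rule measurable_sum_random_set[OF transmitting_subset pred_transmitting]) simp
  then show "(\<lambda>\<omega>. dest_signal p \<omega> \<omega> m t) \<in> borel_measurable P" for m t .
  show "(\<lambda>\<omega>. (dest_signal p \<omega> \<omega> w t) + \<omega> (Dest_Noise t)) \<in> borel_measurable P" for t
    by (intro borel_measurable_add *) simp
qed

definition active :: "(coord \<Rightarrow> complex) \<Rightarrow> nat set" where
  "active \<omega> = {j. 0 < j \<and> (\<exists>t<len p. j \<in> transmitting p \<omega> t)}"

lemma active_subset: "active \<omega> \<subseteq> {..<nodes p}"
  unfolding active_def using transmitting_subset by blast

text \<open>Induction over time: if all nodes active before \<open>t\<close> really send the
  codeword of \<open>w\<close>, a relay starting by \<open>t\<close> has observed exactly what its
  fictitious counterpart observes, and so takes the same, correct decision.\<close>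

lemma encoded_genie:
  assumes "\<And>j. j \<in> active \<omega> \<Longrightarrow> relay_genie p \<omega> w j = w"
  shows "t < len p \<Longrightarrow> j \<in> transmitting p \<omega> t \<Longrightarrow> encoded p \<omega> w t j = w"
proof (induction t arbitrary: j rule: less_induct)
  case (less t)
  show ?case
  proof (cases "j = 0")
    case True then show ?thesis by (subst encoded.simps) simp
  next
    case False
    \<comment> \<open>A relay that transmits at \<open>t\<close> never listens again, so its
      observations before \<open>t\<close> are all it makes during the codeword.\<close>
    have set: "{\<tau>. \<tau> < t \<and> j \<notin> transmitting p \<omega> \<tau>} = (listening p \<omega> j)"
      using less.prems transmitting_mono[of t _ \<omega>] by (auto simp: not_less) (meson not_le subsetD)
    have "encoded p \<omega> w t j = relay_genie p \<omega> w j"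
      unfolding relay_genie_def set[symmetric] using False less
      by (subst encoded.simps) (auto intro!: ml_decode_cong sum.cong)
    also have "\<dots> = w"
      using assms[of j] False less.prems by (auto simp: active_def)
    finally show ?thesis .
  qed
qed

lemma dest_decision_genie:
  assumes "\<And>j. j \<in> active \<omega> \<Longrightarrow> relay_genie p \<omega> w j = w"
  shows "dest_decision p \<omega> w = dest_genie p \<omega> w"
  unfolding dest_decision_def dest_genie_def
  by (intro ml_decode_cong refl) (auto simp: dest_received_def encoded_genie[OF assms] intro!: sum.cong)

end

section \<open>Error probabilities given the gains\<close>

context ddf_system
begin

text \<open>Excludes a null set of gains on which a signal could be degenerate, a case that
  \<open>cgauss\<close> does not represent.\<close>

definition nonzero_gains :: "(coord \<Rightarrow> complex) \<Rightarrow> bool" where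
  "nonzero_gains \<omega> \<longleftrightarrow> (\<forall>i<nodes p. \<omega> (Dest_Gain i) \<noteq> 0 \<and> (\<forall>j<nodes p. \<omega> (Relay_Gain i j) \<noteq> 0))"

lemma AE_coord_nonzero: "AE \<omega> in P. \<omega> k \<noteq> 0"
  unfolding ddf_space_def
  by (rule AE_PiM_component) (auto intro: prob_space_coord AE_cgauss_nonzero)

lemma AE_nonzero_gains: "AE \<omega> in P. nonzero_gains \<omega>"
proof -
  have "AE \<omega> in P. \<forall>i\<in>{..<nodes p}. \<omega> (Dest_Gain i) \<noteq> 0 \<and> (\<forall>j\<in>{..<nodes p}. \<omega> (Relay_Gain i j) \<noteq> 0)"
    by (intro AE_finite_allI AE_conjI finite_lessThan AE_coord_nonzero)
  then show ?thesis by eventually_elim (auto simp: nonzero_gains_def)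
qed

lemma measurable_resample [measurable]: "resample \<omega> \<in> P \<rightarrow>\<^sub>M P"
proof -
  have "\<omega> \<in> space P" by simp
  then show ?thesis unfolding ddf_space_def by (rule measurable_mix)
qed

lemma energy_over_relay_noise: "symbol_energy p / relay_noise_var p = noise_ratio p * snr p"
  by (simp add: symbol_energy_def noise_ratio_def)

lemma energy_over_dest_noise: "symbol_energy p / dest_noise_var p = snr p"
  using dest_noise_pos by (simp add: symbol_energy_def)

lemma relay_code:
  assumes good: "nonzero_gains \<omega>" and j: "j < nodes p"
  shows "gaussian_code P (relay_noise_var p) (\<lambda>t. relay_variance p \<omega> j t)
    (listening p \<omega> j) M
    (\<lambda>m t \<omega>'. relay_signal p \<omega> \<omega>' j m t) (\<lambda>t \<omega>'. \<omega>' (Relay_Noise j t))"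
proof (rule gaussian_code_coords)
  show "transmitting p \<omega> t \<noteq> {}" for t using zero_in_transmitting[of \<omega> t] by blast
  show "\<omega> (Relay_Gain i j) \<noteq> 0" if "i \<in> transmitting p \<omega> t" for t i
    using good j that transmitting_subset[of \<omega> t] unfolding nonzero_gains_def by blast
qed (auto simp: inj_def)

lemma dest_code:
  assumes good: "nonzero_gains \<omega>"
  shows "gaussian_code P (dest_noise_var p) (\<lambda>t. dest_variance p \<omega> t)
    {..<len p} M (\<lambda>m t \<omega>'. dest_signal p \<omega> \<omega>' m t) (\<lambda>t \<omega>'. \<omega>' (Dest_Noise t))"
proof (rule gaussian_code_coords)
  show "transmitting p \<omega> t \<noteq> {}" for t using zero_in_transmitting[of \<omega> t] by blast
  show "\<omega> (Dest_Gain i) \<noteq> 0" if "i \<in> transmitting p \<omega> t" for t i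
    using good that transmitting_subset[of \<omega> t] unfolding nonzero_gains_def by blast
qed (auto simp: inj_def)

lemma num_messages_le: "real (num_messages p) \<le> 2 powr (real (len p) * rate p)"
  unfolding num_messages_def by (simp add: of_nat_nat)

text \<open>Rounding down a number that is at least 1 loses at most a factor 2.\<close>

lemma num_messages_ge: "2 powr (real (len p) * rate p) / 2 \<le> real (num_messages p)"
proof -
  have "1 \<le> 2 powr (real (len p) * rate p)"
    using rate_pos by (intro ge_one_powr_ge_zero) auto
  then have f: "1 \<le> \<lfloor>2 powr (real (len p) * rate p)\<rfloor>" by (simp add: le_floor_iff)
  then have "real (num_messages p) = real_of_int \<lfloor>2 powr (real (len p) * rate p)\<rfloor>"
    unfolding num_messages_def by (intro of_nat_nat) linarith
  then show ?thesis
    using f real_of_int_floor_add_one_gt[of "2 powr (real (len p) * rate p)"] by linarith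
qed

lemma num_messages_pos: "num_messages p > 0"
proof -
  have "0 < 2 powr (real (len p) * rate p) / 2" by simp
  then show ?thesis using num_messages_ge by linarith
qed

definition source_relay_rate :: "(coord \<Rightarrow> complex) \<Rightarrow> nat \<Rightarrow> real" where
  "source_relay_rate \<omega> j = log 2 (1 + noise_ratio p * snr p * (cmod (\<omega> (Relay_Gain 0 j)))\<^sup>2)"

lemma source_relay_rate_le:
  assumes "j > 0"
  shows "source_relay_rate \<omega> j \<le> relay_rate \<omega> j \<tau>"
proof -
  have "(cmod (\<omega> (Relay_Gain 0 j)))\<^sup>2 \<le> (\<Sum>i\<in>transmitting p \<omega> \<tau> - {j}. (cmod (\<omega> (Relay_Gain i j)))\<^sup>2)"
    using assms by (intro member_le_sum) auto
  then have "noise_ratio p * snr p * (cmod (\<omega> (Relay_Gain 0 j)))\<^sup>2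
      \<le> noise_ratio p * snr p * (\<Sum>i\<in>transmitting p \<omega> \<tau> - {j}. (cmod (\<omega> (Relay_Gain i j)))\<^sup>2)"
    using noise_ratio_pos snr_pos by (intro mult_left_mono) auto
  moreover have "0 \<le> noise_ratio p * snr p * (cmod (\<omega> (Relay_Gain 0 j)))\<^sup>2"
    using noise_ratio_pos snr_pos by (intro mult_nonneg_nonneg) auto
  ultimately show ?thesis
    unfolding source_relay_rate_def relay_rate_def by (subst log_le_cancel_iff) auto
qed

text \<open>The information gathered during the additional \<open>margin p\<close> intervals is what makes the relay
  decision reliable.\<close>

lemma relay_info_ge:
  assumes j: "j \<in> active \<omega>"
  shows "(\<Sum>\<tau> | \<tau> < len p \<and> j \<notin> transmitting p \<omega> \<tau>. relay_rate \<omega> j \<tau>)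
    \<ge> real (len p) * rate p + real (margin p) * source_relay_rate \<omega> j"
proof -
  define t0 where "t0 = (LEAST t. j \<in> transmitting p \<omega> t)"
  obtain t where t: "t < len p" "j \<in> transmitting p \<omega> t" and j0: "j > 0" using j by (auto simp: active_def)
  have t0: "j \<in> transmitting p \<omega> t0" "t0 < len p"
    using t LeastI[of "\<lambda>t. j \<in> transmitting p \<omega> t" t] Least_le[of "\<lambda>t. j \<in> transmitting p \<omega> t" t] by (auto simp: t0_def)
  have set: "(listening p \<omega> j) = {..<t0}"
  proof safe
    fix \<tau> assume "j \<notin> transmitting p \<omega> \<tau>"
    then show "\<tau> < t0" using transmitting_mono[of t0 \<tau> \<omega>] t0(1) by (meson not_le subsetD)
  next
    fix \<tau> assume "\<tau> < t0" "j \<in> transmitting p \<omega> \<tau>"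
    then show False using not_less_Least[of \<tau> "\<lambda>t. j \<in> transmitting p \<omega> t"] by (simp add: t0_def)
  qed (use t0 in auto)
  have thr: "real (len p) * rate p < (\<Sum>\<tau><t0 - margin p. relay_rate \<omega> j \<tau>)"
    using t0(1) j0 by (simp add: in_transmitting_iff)
  moreover have "0 \<le> real (len p) * rate p" using rate_pos by simp
  \<comment> \<open>The truncated difference is not 0, since an empty sum cannot exceed the
    nonnegative threshold. So no truncation occurs and exactly \<open>margin p\<close> intervals lie
    between crossing the threshold and starting.\<close>
  ultimately have "t0 - margin p \<noteq> 0" by (intro notI) simp
  then have le: "t0 - margin p \<le> t0" "t0 - (t0 - margin p) = margin p" by auto
  have "(\<Sum>\<tau><t0. relay_rate \<omega> j \<tau>) = (\<Sum>\<tau><t0 - margin p. relay_rate \<omega> j \<tau>) + (\<Sum>\<tau>\<in>{t0 - margin p..<t0}. relay_rate \<omega> j \<tau>)"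
    by (subst sum.union_disjoint[symmetric]) (auto intro!: sum.cong)
  moreover have "(\<Sum>\<tau>\<in>{t0 - margin p..<t0}. source_relay_rate \<omega> j) \<le> (\<Sum>\<tau>\<in>{t0 - margin p..<t0}. relay_rate \<omega> j \<tau>)"
    by (intro sum_mono source_relay_rate_le j0)
  moreover have "(\<Sum>\<tau>\<in>{t0 - margin p..<t0}. source_relay_rate \<omega> j) = real (margin p) * source_relay_rate \<omega> j"
    using le by simp
  ultimately show ?thesis using thr unfolding set by linarith
qed

lemma source_relay_rate_pos:
  assumes "nonzero_gains \<omega>" "j < nodes p"
  shows "0 < source_relay_rate \<omega> j"
proof -
  have "0 < noise_ratio p * snr p * (cmod (\<omega> (Relay_Gain 0 j)))\<^sup>2"
    using noise_ratio_pos snr_pos assms nodes_pos by (intro mult_pos_pos) (auto simp: nonzero_gains_def)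
  then show ?thesis unfolding source_relay_rate_def by (subst zero_less_log_cancel_iff) auto
qed

text \<open>The bound of \<open>decoding_error_le_info\<close> for the excess information that the
  source alone provides during the margin.\<close>

definition relay_error_bound :: "(coord \<Rightarrow> complex) \<Rightarrow> nat \<Rightarrow> real" where
  "relay_error_bound \<omega> j = 2 * 2 powr (- (real (margin p) * source_relay_rate \<omega> j) / (4 * sqrt (real (len p))))
     + 2 powr (- (real (margin p) * source_relay_rate \<omega> j) / 2)"

abbreviation "relay_fails \<omega> w j \<equiv> {\<omega>'. relay_genie p (resample \<omega> \<omega>') w j \<noteq> w}"

abbreviation "dest_ok \<omega> w \<equiv> {\<omega>'. dest_genie p (resample \<omega> \<omega>') w = w}"

abbreviation "dest_fails \<omega> w \<equiv> {\<omega>'. dest_genie p (resample \<omega> \<omega>') w \<noteq> w}"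

lemma relay_genie_error:
  assumes good: "nonzero_gains \<omega>" and j: "j \<in> active \<omega>" and w: "w < num_messages p" and len: "len p > 0"
  shows "prob (relay_fails \<omega> w j) \<le> relay_error_bound \<omega> j"
proof -
  let ?T = "(listening p \<omega> j)"
  have jn: "j < nodes p" using j active_subset by blast
  interpret G: gaussian_code P "relay_noise_var p" "\<lambda>t. relay_variance p \<omega> j t"
    ?T "num_messages p" "\<lambda>m t \<omega>'. relay_signal p \<omega> \<omega>' j m t" "\<lambda>t \<omega>'. \<omega>' (Relay_Noise j t)"
    by (rule relay_code[OF good jn])
  have dec: "relay_genie p (resample \<omega> \<omega>') w j = G.dec w \<omega>'" for \<omega>'
    by (simp add: relay_genie_def G.dec_def transmitting_resample)
  have "G.info = (\<Sum>\<tau>\<in>?T. relay_rate \<omega> j \<tau>)"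
    unfolding G.info_def relay_rate_def
    by (intro sum.cong refl) (simp add: energy_over_relay_noise[symmetric])
  then have info: "G.info \<ge> real (len p) * rate p + real (margin p) * source_relay_rate \<omega> j"
    using relay_info_ge[OF j] by simp
  have "card ?T \<le> card {..<len p}" by (intro card_mono) auto
  then have "prob {\<omega>'\<in>space P. G.dec w \<omega>' \<noteq> w} \<le> relay_error_bound \<omega> j"
    unfolding relay_error_bound_def
    by (intro G.decoding_error_le_info[OF w _ _ num_messages_le info]) (use len in auto)
  then show ?thesis by (simp add: dec)
qed

lemma dest_genie_error:
  assumes good: "nonzero_gains \<omega>" and w: "w < num_messages p" and len: "len p > 0"
    and info: "(\<Sum>t<len p. dest_rate \<omega> t) \<ge> real (len p) * rate p + \<Delta>"
  shows "prob (dest_fails \<omega> w)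
    \<le> 2 * 2 powr (- \<Delta> / (4 * sqrt (real (len p)))) + 2 powr (- \<Delta> / 2)"
proof -
  interpret G: gaussian_code P "dest_noise_var p" "\<lambda>t. dest_variance p \<omega> t"
    "{..<len p}" "num_messages p" "\<lambda>m t \<omega>'. dest_signal p \<omega> \<omega>' m t" "\<lambda>t \<omega>'. \<omega>' (Dest_Noise t)"
    by (rule dest_code[OF good])
  have dec: "dest_genie p (resample \<omega> \<omega>') w = G.dec w \<omega>'" for \<omega>'
    by (simp add: dest_genie_def G.dec_def transmitting_resample)
  have "G.info = (\<Sum>t<len p. dest_rate \<omega> t)"
    unfolding G.info_def dest_rate_def
    by (intro sum.cong refl) (simp add: energy_over_dest_noise[symmetric])
  then show ?thesis
    using G.decoding_error_le_info[OF w, of "real (len p)" "real (len p) * rate p" \<Delta>] info len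
    by (simp add: dec num_messages_le)
qed

lemma dest_genie_correct:
  assumes good: "nonzero_gains \<omega>" and len: "len p > 0"
    and info: "(\<Sum>t<len p. dest_rate \<omega> t) \<le> real (len p) * rate p - \<Delta>"
  shows "(\<Sum>w<num_messages p. prob (dest_ok \<omega> w)) / real (num_messages p)
    \<le> 2 * 2 powr (- \<Delta> / (4 * sqrt (real (len p)))) + 2 * 2 powr (- \<Delta> / 2)"
proof -
  interpret G: gaussian_code P "dest_noise_var p" "\<lambda>t. dest_variance p \<omega> t"
    "{..<len p}" "num_messages p" "\<lambda>m t \<omega>'. dest_signal p \<omega> \<omega>' m t" "\<lambda>t \<omega>'. \<omega>' (Dest_Noise t)"
    by (rule dest_code[OF good])
  have dec: "dest_genie p (resample \<omega> \<omega>') w = G.dec w \<omega>'" for w \<omega>'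
    by (simp add: dest_genie_def G.dec_def transmitting_resample)
  have "G.info = (\<Sum>t<len p. dest_rate \<omega> t)"
    unfolding G.info_def dest_rate_def
    by (intro sum.cong refl) (simp add: energy_over_dest_noise[symmetric])
  then show ?thesis
    using G.decoding_correct_le_info[OF _ _ num_messages_ge, of "real (len p)" \<Delta>] info len
    by (simp add: dec)
qed

definition cond_error :: "(coord \<Rightarrow> complex) \<Rightarrow> nat \<Rightarrow> real" where
  "cond_error \<omega> w = prob {\<omega>'. dest_decision p (resample \<omega> \<omega>') w \<noteq> w}"

definition avg_error :: "(coord \<Rightarrow> complex) \<Rightarrow> real" where
  "avg_error \<omega> = (\<Sum>w<num_messages p. cond_error \<omega> w) / real (num_messages p)"

lemma events_resample:
  assumes "f \<in> P \<rightarrow>\<^sub>M count_space UNIV"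
  shows "{\<omega>'. f (resample \<omega> \<omega>') = a} \<in> events" "{\<omega>'. f (resample \<omega> \<omega>') \<noteq> a} \<in> events"
proof -
  have [measurable]: "(\<lambda>\<omega>'. f (resample \<omega> \<omega>')) \<in> P \<rightarrow>\<^sub>M count_space UNIV"
    using measurable_compose[OF measurable_resample assms] .
  have "{\<omega>'\<in>space P. f (resample \<omega> \<omega>') = a} \<in> events" "{\<omega>'\<in>space P. f (resample \<omega> \<omega>') \<noteq> a} \<in> events"
    by measurable
  then show "{\<omega>'. f (resample \<omega> \<omega>') = a} \<in> events" "{\<omega>'. f (resample \<omega> \<omega>') \<noteq> a} \<in> events" by simp_all
qed

lemma active_resample: "active (resample \<omega> \<omega>') = active \<omega>"
  by (simp add: active_def transmitting_resample)

definition relays_error_bound :: "(coord \<Rightarrow> complex) \<Rightarrow> real" where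
  "relays_error_bound \<omega> = (\<Sum>j<nodes p. relay_error_bound \<omega> j)"

lemma relays_genie_error:
  assumes good: "nonzero_gains \<omega>" and w: "w < num_messages p" and len: "len p > 0"
  shows "prob (\<Union>j\<in>active \<omega>. relay_fails \<omega> w j) \<le> relays_error_bound \<omega>"
proof -
  have fin: "finite (active \<omega>)" by (rule finite_subset[OF active_subset]) simp
  have "prob (\<Union>j\<in>active \<omega>. relay_fails \<omega> w j)
      \<le> (\<Sum>j\<in>active \<omega>. prob (relay_fails \<omega> w j))"
    by (intro finite_measure_subadditive_finite fin image_subsetI events_resample(2) relay_genie_measurable)
  also have "\<dots> \<le> (\<Sum>j\<in>active \<omega>. relay_error_bound \<omega> j)"
    by (intro sum_mono relay_genie_error good w len)
  also have "\<dots> \<le> relays_error_bound \<omega>"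
    unfolding relays_error_bound_def using active_subset
    by (intro sum_mono2) (auto simp: relay_error_bound_def)
  finally show ?thesis .
qed

text \<open>Outside the event that some active fictitious relay errs, the real and the fictitious
  destination decisions coincide; each inequality is a union bound with that event.\<close>

lemma cond_error_diff:
  assumes good: "nonzero_gains \<omega>" and w: "w < num_messages p" and len: "len p > 0"
  shows "cond_error \<omega> w \<le> relays_error_bound \<omega> + prob (dest_fails \<omega> w)"
    and "1 - cond_error \<omega> w \<le> relays_error_bound \<omega> + prob (dest_ok \<omega> w)"
proof -
  let ?R = "\<Union>j\<in>active \<omega>. relay_fails \<omega> w j"
  have R: "?R \<in> events"
    by (intro sets.finite_UN finite_subset[OF active_subset] events_resample(2) relay_genie_measurable) simp
  have eq: "dest_decision p (resample \<omega> \<omega>') w = dest_genie p (resample \<omega> \<omega>') w" if "\<omega>' \<notin> ?R" for \<omega>'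
    using that by (intro dest_decision_genie) (auto simp: active_resample)
  note ev = events_resample[OF dest_decision_measurable] events_resample[OF dest_genie_measurable]
  have "cond_error \<omega> w \<le> prob (?R \<union> (dest_fails \<omega> w))"
    unfolding cond_error_def using eq by (intro finite_measure_mono sets.Un R ev) auto
  also have "\<dots> \<le> prob ?R + prob (dest_fails \<omega> w)"
    by (intro measure_Un_le R ev)
  finally show "cond_error \<omega> w \<le> relays_error_bound \<omega> + prob (dest_fails \<omega> w)"
    using relays_genie_error[OF assms] by linarith
  have "1 - cond_error \<omega> w = prob (space P - {\<omega>'. dest_decision p (resample \<omega> \<omega>') w \<noteq> w})"
    unfolding cond_error_def by (rule prob_compl[symmetric]) (rule ev)
  also have "\<dots> \<le> prob (?R \<union> (dest_ok \<omega> w))"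
    using eq by (intro finite_measure_mono sets.Un R ev) auto
  also have "\<dots> \<le> prob ?R + prob (dest_ok \<omega> w)"
    by (intro measure_Un_le R ev)
  finally show "1 - cond_error \<omega> w \<le> relays_error_bound \<omega> + prob (dest_ok \<omega> w)"
    using relays_genie_error[OF assms] by linarith
qed

lemma avg_error_le:
  assumes good: "nonzero_gains \<omega>" and len: "len p > 0"
    and info: "(\<Sum>t<len p. dest_rate \<omega> t) \<ge> real (len p) * rate p + \<Delta>"
  shows "avg_error \<omega> \<le> relays_error_bound \<omega> + 2 * 2 powr (- \<Delta> / (4 * sqrt (real (len p)))) + 2 powr (- \<Delta> / 2)"
    (is "_ \<le> ?B")
proof -
  have "(\<Sum>w<num_messages p. cond_error \<omega> w) \<le> (\<Sum>w<num_messages p. ?B)"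
  proof (rule sum_mono)
    fix w assume "w \<in> {..<num_messages p}"
    then have w: "w < num_messages p" by simp
    show "cond_error \<omega> w \<le> ?B"
      using cond_error_diff(1)[OF good w len] dest_genie_error[OF good w len info] by linarith
  qed
  then show ?thesis
    unfolding avg_error_def using num_messages_pos by (simp add: field_simps)
qed

lemma avg_error_ge:
  assumes good: "nonzero_gains \<omega>" and len: "len p > 0"
    and info: "(\<Sum>t<len p. dest_rate \<omega> t) \<le> real (len p) * rate p - \<Delta>"
  shows "1 - avg_error \<omega> \<le> relays_error_bound \<omega> + 2 * 2 powr (- \<Delta> / (4 * sqrt (real (len p)))) + 2 * 2 powr (- \<Delta> / 2)"
proof -
  let ?M = "num_messages p"
  have "1 - avg_error \<omega> = (\<Sum>w<?M. 1 - cond_error \<omega> w) / real ?M"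
    unfolding avg_error_def using num_messages_pos by (simp add: sum_subtractf field_simps)
  also have "\<dots> \<le> (\<Sum>w<?M. relays_error_bound \<omega> + prob (dest_ok \<omega> w)) / real ?M"
    using num_messages_pos by (intro divide_right_mono sum_mono cond_error_diff(2)[OF good _ len]) auto
  also have "\<dots> = relays_error_bound \<omega> + (\<Sum>w<?M. prob (dest_ok \<omega> w)) / real ?M"
    using num_messages_pos by (simp add: sum.distrib field_simps)
  finally show ?thesis using dest_genie_correct[OF good len info] by linarith
qed

lemma cond_error_bounds: "0 \<le> cond_error \<omega> w" "cond_error \<omega> w \<le> 1"
  by (auto simp: cond_error_def)

lemma avg_error_bounds: "0 \<le> avg_error \<omega>" "avg_error \<omega> \<le> 1"
proof -
  have "(\<Sum>w<num_messages p. cond_error \<omega> w) \<le> (\<Sum>w<num_messages p. 1)"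
    by (intro sum_mono cond_error_bounds)
  then show "0 \<le> avg_error \<omega>" "avg_error \<omega> \<le> 1"
    unfolding avg_error_def using num_messages_pos by (auto intro!: sum_nonneg cond_error_bounds divide_nonneg_nonneg)
qed

lemma cond_error_measurable [measurable]: "(\<lambda>\<omega>. cond_error \<omega> w) \<in> borel_measurable P"
proof -
  have m: "(\<lambda>q. resample (fst q) (snd q)) \<in> P \<Otimes>\<^sub>M P \<rightarrow>\<^sub>M P"
    unfolding ddf_space_def by (rule measurable_mix_pair)
  have [measurable]: "(\<lambda>q. dest_decision p (resample (fst q) (snd q)) w) \<in> P \<Otimes>\<^sub>M P \<rightarrow>\<^sub>M count_space UNIV"
    by (rule measurable_compose[OF m dest_decision_measurable])
  have "(\<lambda>\<omega>. emeasure P (Pair \<omega> -` {q \<in> space (P \<Otimes>\<^sub>M P). dest_decision p (resample (fst q) (snd q)) w \<noteq> w})) \<in> borel_measurable P"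
    by (rule measurable_emeasure_Pair) measurable
  then have "(\<lambda>\<omega>. enn2real (emeasure P (Pair \<omega> -` {q \<in> space (P \<Otimes>\<^sub>M P). dest_decision p (resample (fst q) (snd q)) w \<noteq> w}))) \<in> borel_measurable P"
    by measurable
  then show ?thesis
    by (rule measurable_cong[THEN iffD1, rotated]) (simp add: cond_error_def measure_def space_pair_measure vimage_def)
qed

lemma avg_error_measurable [measurable]: "avg_error \<in> borel_measurable P"
  unfolding avg_error_def by measurable

lemma prob_dest_decision: "prob {\<omega>\<in>space P. dest_decision p \<omega> w \<noteq> w} = (\<integral>\<omega>. cond_error \<omega> w \<partial>P)"
proof -
  have "{\<omega>\<in>space P. dest_decision p \<omega> w \<noteq> w} \<in> events"
    using dest_decision_measurable[of w] by measurable
  then have "emeasure P {\<omega>\<in>space P. dest_decision p \<omega> w \<noteq> w}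
    = (\<integral>\<^sup>+\<omega>. emeasure P {\<omega>'\<in>space P. resample \<omega> \<omega>' \<in> {\<omega>\<in>space P. dest_decision p \<omega> w \<noteq> w}} \<partial>P)"
    unfolding ddf_space_def by (intro emeasure_PiM_resample prob_space_coord)
  also have "\<dots> = (\<integral>\<^sup>+\<omega>. ennreal (cond_error \<omega> w) \<partial>P)"
    by (simp add: cond_error_def emeasure_eq_measure)
  also have "\<dots> = ennreal (\<integral>\<omega>. cond_error \<omega> w \<partial>P)"
    by (intro nn_integral_eq_integral integrable_const_bound[where B=1]) (auto simp: cond_error_bounds)
  finally show ?thesis
    unfolding emeasure_eq_measure by (subst (asm) ennreal_inj) (auto intro!: integral_nonneg_AE simp: cond_error_bounds)
qed

lemma error_prob_eq_integral: "error_prob p = (\<integral>\<omega>. avg_error \<omega> \<partial>P)"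
proof -
  have "integrable P (\<lambda>\<omega>. cond_error \<omega> w)" for w
    by (intro integrable_const_bound[where B=1]) (auto simp: cond_error_bounds)
  then show ?thesis
    unfolding error_prob_def avg_error_def prob_dest_decision by simp
qed

end

section \<open>Limits of averaged conditional error probabilities\<close>

lemma (in prob_space) limsup_integral_le:
  fixes e :: "nat \<Rightarrow> 'a \<Rightarrow> real"
  assumes [measurable]: "\<And>l. e l \<in> borel_measurable M" "A \<in> events"
    and b: "\<And>l \<omega>. 0 \<le> e l \<omega>" "\<And>l \<omega>. e l \<omega> \<le> 1"
    and lim: "AE \<omega> in M. \<omega> \<notin> A \<longrightarrow> (\<lambda>l. e l \<omega>) \<longlonglongrightarrow> 0"
  shows "limsup (\<lambda>l. ereal (\<integral>\<omega>. e l \<omega> \<partial>M)) \<le> ereal (prob A)"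
proof -
  have int: "integrable M (e l)" for l
    by (intro integrable_const_bound[where B=1]) (auto simp: b)
  have int2: "integrable M (\<lambda>\<omega>. indicator (space M - A) \<omega> * e l \<omega>)" for l
    by (intro integrable_const_bound[where B=1]) (auto simp: b split: split_indicator)
  \<comment> \<open>On \<open>A\<close> the integrand is bounded by 1 and contributes at most
    \<open>prob A\<close>; off \<open>A\<close> dominated convergence applies.\<close>
  have "(\<lambda>l. \<integral>\<omega>. indicator (space M - A) \<omega> * e l \<omega> \<partial>M) \<longlonglongrightarrow> (\<integral>\<omega>. 0 \<partial>M)"
  proof (rule integral_dominated_convergence[where w="\<lambda>_. 1"])
    show "AE \<omega> in M. (\<lambda>l. indicator (space M - A) \<omega> * e l \<omega>) \<longlonglongrightarrow> 0"
      using lim by eventually_elim (auto split: split_indicator)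
  qed (auto simp: b split: split_indicator)
  then have *: "(\<lambda>l. ereal (prob A + (\<integral>\<omega>. indicator (space M - A) \<omega> * e l \<omega> \<partial>M))) \<longlonglongrightarrow> ereal (prob A + 0)"
    by (intro tendsto_intros) simp
  have "limsup (\<lambda>l. ereal (\<integral>\<omega>. e l \<omega> \<partial>M)) \<le> limsup (\<lambda>l. ereal (prob A + (\<integral>\<omega>. indicator (space M - A) \<omega> * e l \<omega> \<partial>M)))"
  proof (intro Limsup_mono always_eventually allI)
    fix l
    have "(\<integral>\<omega>. e l \<omega> \<partial>M) \<le> (\<integral>\<omega>. indicator A \<omega> + indicator (space M - A) \<omega> * e l \<omega> \<partial>M)"
      by (intro integral_mono int Bochner_Integration.integrable_add int2) (auto simp: b emeasure_eq_measure split: split_indicator)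
    also have "\<dots> = prob A + (\<integral>\<omega>. indicator (space M - A) \<omega> * e l \<omega> \<partial>M)"
      by (subst Bochner_Integration.integral_add) (auto simp: emeasure_eq_measure intro!: int2)
    finally show "ereal (\<integral>\<omega>. e l \<omega> \<partial>M) \<le> ereal (prob A + (\<integral>\<omega>. indicator (space M - A) \<omega> * e l \<omega> \<partial>M))"
      by simp
  qed
  also have "\<dots> = ereal (prob A)"
    using lim_imp_Limsup[OF _ *] by simp
  finally show ?thesis .
qed

lemma (in prob_space) liminf_integral_ge:
  fixes e :: "nat \<Rightarrow> 'a \<Rightarrow> real"
  assumes [measurable]: "\<And>l. e l \<in> borel_measurable M" and A[measurable]: "A \<in> events"
    and b: "\<And>l \<omega>. 0 \<le> e l \<omega>" "\<And>l \<omega>. e l \<omega> \<le> 1"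
    and lim: "AE \<omega> in M. \<omega> \<in> A \<longrightarrow> (\<lambda>l. e l \<omega>) \<longlonglongrightarrow> 1"
  shows "ereal (prob A) \<le> liminf (\<lambda>l. ereal (\<integral>\<omega>. e l \<omega> \<partial>M))"
proof -
  have "(\<lambda>l. \<integral>\<omega>. indicator A \<omega> * e l \<omega> \<partial>M) \<longlonglongrightarrow> (\<integral>\<omega>. indicator A \<omega> \<partial>M)"
  proof (rule integral_dominated_convergence[where w="\<lambda>_. 1"])
    show "AE \<omega> in M. (\<lambda>l. indicator A \<omega> * e l \<omega>) \<longlonglongrightarrow> indicator A \<omega>"
      using lim by eventually_elim (auto split: split_indicator)
  qed (auto simp: b split: split_indicator)
  then have *: "(\<lambda>l. ereal (\<integral>\<omega>. indicator A \<omega> * e l \<omega> \<partial>M)) \<longlonglongrightarrow> ereal (prob A)"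
    by (simp add: Int_absorb2 sets.sets_into_space[OF A])
  have "ereal (prob A) = liminf (\<lambda>l. ereal (\<integral>\<omega>. indicator A \<omega> * e l \<omega> \<partial>M))"
    using lim_imp_Liminf[OF _ *] by simp
  also have "\<dots> \<le> liminf (\<lambda>l. ereal (\<integral>\<omega>. e l \<omega> \<partial>M))"
  proof (intro Liminf_mono always_eventually allI)
    fix l
    have "(\<integral>\<omega>. indicator A \<omega> * e l \<omega> \<partial>M) \<le> (\<integral>\<omega>. e l \<omega> \<partial>M)"
      by (intro integral_mono integrable_const_bound[where B=1]) (auto simp: b split: split_indicator)
    then show "ereal (\<integral>\<omega>. indicator A \<omega> * e l \<omega> \<partial>M) \<le> ereal (\<integral>\<omega>. e l \<omega> \<partial>M)" by simp
  qed
  finally show ?thesis .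
qed

section \<open>Long codes at a fixed signal-to-noise ratio\<close>

lemma tendsto_two_powr_neg:
  assumes "filterlim f at_top F" "k > 0"
  shows "((\<lambda>x. 2 powr (- (k * f x))) \<longlongrightarrow> (0::real)) F"
proof -
  have "filterlim (\<lambda>x. k * f x) at_top F"
    by (rule filterlim_tendsto_pos_mult_at_top[OF tendsto_const assms(2,1)])
  then have "filterlim (\<lambda>x. - (k * f x)) at_bot F"
    by (simp add: filterlim_uminus_at_top)
  moreover have "((\<lambda>x. 2 powr x) \<longlongrightarrow> (0::real)) at_bot"
    by real_asymp
  ultimately show ?thesis by (rule filterlim_compose[rotated])
qed

locale ddf_long =
  fixes N :: nat and \<sigma>w2 \<sigma>v2 :: real and R :: "real \<Rightarrow> real" and \<mu> :: "nat \<Rightarrow> nat" and \<rho> :: real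
  assumes N: "N \<ge> 2" and noise_pos: "\<sigma>w2 > 0" "\<sigma>v2 > 0" and rho_pos: "\<rho> > 0" and R_pos: "R \<rho> > 0"
    and margin: "admissible_margin \<mu>"
begin

abbreviation "fam \<equiv> ddf_family N \<sigma>w2 \<sigma>v2 R \<mu> \<rho>"

sublocale sys: ddf_system "fam l" for l
  by standard (use N noise_pos rho_pos R_pos in \<open>auto simp: ddf_family_def\<close>)

lemma fam_simps [simp]:
  "nodes (fam l) = N" "relay_noise_var (fam l) = \<sigma>w2" "dest_noise_var (fam l) = \<sigma>v2"
  "snr (fam l) = \<rho>" "rate (fam l) = R \<rho>" "len (fam l) = l" "margin (fam l) = \<mu> l"
  "noise_ratio (fam l) = \<sigma>v2 / \<sigma>w2"
  by (auto simp: ddf_family_def noise_ratio_def)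

text \<open>The space carries coordinates for all intervals, and their variances do not involve the
  code-length. All \<open>l\<close> thus share one space, and limits can be taken for fixed
  gains.\<close>

lemma ddf_space_fam: "ddf_space (fam l) = ddf_space (fam 0)"
proof -
  have "coord_variance (fam l) k = coord_variance (fam 0) k" for k
    by (cases k) (auto simp: symbol_energy_def)
  then show ?thesis by (simp add: ddf_space_def)
qed

abbreviation "Q \<equiv> ddf_space (fam 0)"

lemma margin_at_top: "filterlim (\<lambda>l. real (\<mu> l)) at_top sequentially"
proof (rule filterlim_at_top_mono)
  show "filterlim (\<lambda>l. real (\<mu> l) / sqrt (real l)) at_top sequentially"
    using margin by (simp add: admissible_margin_def)
  show "\<forall>\<^sub>F l in sequentially. real (\<mu> l) / sqrt (real l) \<le> real (\<mu> l)"
    using eventually_gt_at_top[of 0]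
  proof eventually_elim
    case (elim l)
    then have "real (\<mu> l) * 1 \<le> real (\<mu> l) * sqrt (real l)" by (intro mult_left_mono) auto
    then show ?case using elim by (simp add: field_simps)
  qed
qed

text \<open>Here the margin has to dominate \<open>sqrt l\<close>: the leading exponent is
  proportional to \<open>\<mu> l / sqrt l\<close>, with a factor that depends on the gains only and
  is positive when they do not vanish.\<close>

lemma relays_error_bound_tendsto:
  assumes good: "sys.nonzero_gains 0 \<omega>"
  shows "(\<lambda>l. sys.relays_error_bound l \<omega>) \<longlonglongrightarrow> 0"
proof -
  have "(\<lambda>l. sys.relay_error_bound l \<omega> j) \<longlonglongrightarrow> 2 * 0 + 0" if j: "j < N" for j
  proof -
    define a where "a = sys.source_relay_rate 0 \<omega> j"
    have a: "sys.source_relay_rate l \<omega> j = a" for l by (simp add: a_def sys.source_relay_rate_def)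
    have ap: "a > 0" unfolding a_def using good j by (intro sys.source_relay_rate_pos) auto
    have "(\<lambda>l. 2 * 2 powr (- (a / 4 * (real (\<mu> l) / sqrt (real l)))) + 2 powr (- (a / 2 * real (\<mu> l)))) \<longlonglongrightarrow> 2 * 0 + 0"
      using margin ap margin_at_top
      by (intro tendsto_intros tendsto_two_powr_neg) (auto simp: admissible_margin_def)
    then show ?thesis
      unfolding sys.relay_error_bound_def a by (simp add: mult.commute)
  qed
  then have "(\<lambda>l. \<Sum>j<N. sys.relay_error_bound l \<omega> j) \<longlonglongrightarrow> (\<Sum>j<N. 0)"
    by (intro tendsto_sum) auto
  then show ?thesis by (simp add: sys.relays_error_bound_def)
qed

lemma exponential_terms_tendsto:
  assumes "\<delta> > 0"
  shows "(\<lambda>l. 2 powr (- (real l * \<delta>) / (4 * sqrt (real l)))) \<longlonglongrightarrow> 0"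
    and "(\<lambda>l. 2 powr (- (real l * \<delta>) / 2)) \<longlonglongrightarrow> 0"
proof -
  have "(\<lambda>l. 2 powr (- (\<delta> / 4 * sqrt (real l)))) \<longlonglongrightarrow> 0"
    using assms by (intro tendsto_two_powr_neg filterlim_compose[OF sqrt_at_top filterlim_real_sequentially]) auto
  moreover have "\<forall>\<^sub>F l in sequentially. 2 powr (- (\<delta> / 4 * sqrt (real l))) = 2 powr (- (real l * \<delta>) / (4 * sqrt (real l)))"
    using eventually_gt_at_top[of 0]
  proof eventually_elim
    case (elim l)
    have "\<delta> / 4 * sqrt (real l) = \<delta> / 4 * (real l / sqrt (real l))" by (simp add: real_div_sqrt)
    also have "\<dots> = real l * \<delta> / (4 * sqrt (real l))" by simp
    finally have e: "\<delta> / 4 * sqrt (real l) = real l * \<delta> / (4 * sqrt (real l))" .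
    show ?case unfolding e minus_divide_left ..
  qed
  ultimately show "(\<lambda>l. 2 powr (- (real l * \<delta>) / (4 * sqrt (real l)))) \<longlonglongrightarrow> 0"
    by (rule Lim_transform_eventually)
  have "(\<lambda>l. 2 powr (- (\<delta> / 2 * real l))) \<longlonglongrightarrow> 0"
    using assms by (intro tendsto_two_powr_neg filterlim_real_sequentially) auto
  then show "(\<lambda>l. 2 powr (- (real l * \<delta>) / 2)) \<longlonglongrightarrow> 0" by (simp add: mult.commute)
qed

abbreviation "dest_info l \<omega> \<equiv> \<Sum>t<l. sys.dest_rate l \<omega> t"

abbreviation "surplus \<omega> \<equiv> \<exists>\<delta>>0. \<forall>\<^sub>F l in sequentially. dest_info l \<omega> \<ge> real l * (R \<rho> + \<delta>)"

abbreviation "deficit \<omega> \<equiv> \<exists>\<delta>>0. \<forall>\<^sub>F l in sequentially. dest_info l \<omega> \<le> real l * (R \<rho> - \<delta>)"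

lemma avg_error_tendsto_0:
  assumes good: "sys.nonzero_gains 0 \<omega>" and d: "\<delta> > 0"
    and info: "\<forall>\<^sub>F l in sequentially. dest_info l \<omega> \<ge> real l * (R \<rho> + \<delta>)"
  shows "(\<lambda>l. sys.avg_error l \<omega>) \<longlonglongrightarrow> 0"
proof (rule real_tendsto_sandwich[OF always_eventually _ tendsto_const])
  show "(\<lambda>l. sys.relays_error_bound l \<omega> + 2 * 2 powr (- (real l * \<delta>) / (4 * sqrt (real l))) + 2 powr (- (real l * \<delta>) / 2)) \<longlonglongrightarrow> 0"
    using tendsto_add[OF tendsto_add[OF relays_error_bound_tendsto[OF good]
      tendsto_mult[OF tendsto_const exponential_terms_tendsto(1)[OF d]]] exponential_terms_tendsto(2)[OF d], of 2] by simp
  show "\<forall>\<^sub>F l in sequentially. sys.avg_error l \<omega> \<le> sys.relays_error_bound l \<omega> + 2 * 2 powr (- (real l * \<delta>) / (4 * sqrt (real l))) + 2 powr (- (real l * \<delta>) / 2)"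
    using info eventually_gt_at_top[of 0]
  proof eventually_elim
    case (elim l)
    have "sys.nonzero_gains l \<omega>" using good by (simp add: sys.nonzero_gains_def)
    then show ?case
      using sys.avg_error_le[of l \<omega> "real l * \<delta>"] elim by (simp add: algebra_simps)
  qed
qed (simp add: sys.avg_error_bounds)

lemma avg_error_tendsto_1:
  assumes good: "sys.nonzero_gains 0 \<omega>" and d: "\<delta> > 0"
    and info: "\<forall>\<^sub>F l in sequentially. dest_info l \<omega> \<le> real l * (R \<rho> - \<delta>)"
  shows "(\<lambda>l. sys.avg_error l \<omega>) \<longlonglongrightarrow> 1"
proof -
  have "(\<lambda>l. 1 - sys.avg_error l \<omega>) \<longlonglongrightarrow> 0"
  proof (rule real_tendsto_sandwich[OF always_eventually _ tendsto_const])
    show "(\<lambda>l. sys.relays_error_bound l \<omega> + 2 * 2 powr (- (real l * \<delta>) / (4 * sqrt (real l))) + 2 * 2 powr (- (real l * \<delta>) / 2)) \<longlonglongrightarrow> 0"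
      using tendsto_add[OF tendsto_add[OF relays_error_bound_tendsto[OF good]
        tendsto_mult[OF tendsto_const exponential_terms_tendsto(1)[OF d]]] tendsto_mult[OF tendsto_const exponential_terms_tendsto(2)[OF d]], of 2 2] by simp
    show "\<forall>\<^sub>F l in sequentially. 1 - sys.avg_error l \<omega> \<le> sys.relays_error_bound l \<omega> + 2 * 2 powr (- (real l * \<delta>) / (4 * sqrt (real l))) + 2 * 2 powr (- (real l * \<delta>) / 2)"
      using info eventually_gt_at_top[of 0]
    proof eventually_elim
      case (elim l)
      have "sys.nonzero_gains l \<omega>" using good by (simp add: sys.nonzero_gains_def)
      then show ?case
        using sys.avg_error_ge[of l \<omega> "real l * \<delta>"] elim by (simp add: algebra_simps)
    qed
  qed (simp add: sys.avg_error_bounds)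
  from tendsto_diff[OF tendsto_const this, of 1] show ?thesis by simp
qed

lemma error_prob_fam: "error_prob (fam l) = (\<integral>\<omega>. sys.avg_error l \<omega> \<partial>Q)"
  using sys.error_prob_eq_integral[of l] ddf_space_fam[of l] by simp

lemma avg_error_measurable: "sys.avg_error l \<in> borel_measurable Q"
  using sys.avg_error_measurable[of l] ddf_space_fam[of l] by simp

lemma error_prob_bounds: "0 \<le> error_prob (fam l)" "error_prob (fam l) \<le> 1"
proof -
  have "error_prob (fam l) \<le> (\<integral>\<omega>. 1 \<partial>Q)"
    unfolding error_prob_fam using sys.avg_error_bounds
    by (intro integral_mono sys.integrable_const_bound[where B=1] avg_error_measurable) auto
  then show "error_prob (fam l) \<le> 1" using sys.prob_space[of 0] by simp
  show "0 \<le> error_prob (fam l)"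
    unfolding error_prob_fam using sys.avg_error_bounds by (intro Bochner_Integration.integral_nonneg) auto
qed

text \<open>\<open>real_of_ereal\<close> sends infinite values to 0; the bounds 0 and 1 on error
  probabilities rule these out.\<close>

lemma long_code_error_ereal:
  "ereal (long_code_error_sup fam) = limsup (\<lambda>l. ereal (error_prob (fam l)))"
  "ereal (long_code_error_inf fam) = liminf (\<lambda>l. ereal (error_prob (fam l)))"
proof -
  have le: "liminf (\<lambda>l. ereal (error_prob (fam l))) \<le> limsup (\<lambda>l. ereal (error_prob (fam l)))"
    by (rule Liminf_le_Limsup) simp
  have ge: "0 \<le> liminf (\<lambda>l. ereal (error_prob (fam l)))"
    by (intro Liminf_bounded always_eventually) (simp add: error_prob_bounds)
  have le1: "limsup (\<lambda>l. ereal (error_prob (fam l))) \<le> 1"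
    by (intro Limsup_bounded always_eventually) (simp add: error_prob_bounds)
  have "\<bar>limsup (\<lambda>l. ereal (error_prob (fam l)))\<bar> \<noteq> \<infinity>" "\<bar>liminf (\<lambda>l. ereal (error_prob (fam l)))\<bar> \<noteq> \<infinity>"
    using le ge le1 by (cases "limsup (\<lambda>l. ereal (error_prob (fam l)))"; cases "liminf (\<lambda>l. ereal (error_prob (fam l)))"; simp)+
  then show "ereal (long_code_error_sup fam) = limsup (\<lambda>l. ereal (error_prob (fam l)))"
    "ereal (long_code_error_inf fam) = liminf (\<lambda>l. ereal (error_prob (fam l)))"
    unfolding long_code_error_sup_def long_code_error_inf_def by (auto simp: ereal_real)
qed

lemma long_code_error_inf_le_sup: "long_code_error_inf fam \<le> long_code_error_sup fam"
proof -
  have "ereal (long_code_error_inf fam) \<le> ereal (long_code_error_sup fam)"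
    unfolding long_code_error_ereal by (rule Liminf_le_Limsup) simp
  then show ?thesis by simp
qed

lemma long_code_error_sup_le_1: "long_code_error_sup fam \<le> 1"
proof -
  have "ereal (long_code_error_sup fam) \<le> 1"
    unfolding long_code_error_ereal by (intro Limsup_bounded always_eventually) (simp add: error_prob_bounds)
  then show ?thesis by simp
qed

lemma long_code_error_sup_le:
  assumes A: "A \<in> sets Q"
    and info: "\<And>\<omega>. sys.nonzero_gains 0 \<omega> \<Longrightarrow> \<omega> \<notin> A \<Longrightarrow>
      surplus \<omega>"
  shows "long_code_error_sup fam \<le> measure Q A"
proof -
  have "ereal (long_code_error_sup fam) \<le> ereal (measure Q A)"
    unfolding long_code_error_ereal error_prob_fam
  proof (rule sys.limsup_integral_le)
    show "AE \<omega> in Q. \<omega> \<notin> A \<longrightarrow> (\<lambda>l. sys.avg_error l \<omega>) \<longlonglongrightarrow> 0"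
      using sys.AE_nonzero_gains[of 0] by eventually_elim (use info avg_error_tendsto_0 in blast)
  qed (use A in \<open>auto simp: sys.avg_error_bounds avg_error_measurable\<close>)
  then show ?thesis by simp
qed

lemma long_code_error_inf_ge:
  assumes A: "A \<in> sets Q"
    and info: "\<And>\<omega>. sys.nonzero_gains 0 \<omega> \<Longrightarrow> \<omega> \<in> A \<Longrightarrow>
      deficit \<omega>"
  shows "measure Q A \<le> long_code_error_inf fam"
proof -
  have "ereal (measure Q A) \<le> ereal (long_code_error_inf fam)"
    unfolding long_code_error_ereal error_prob_fam
  proof (rule sys.liminf_integral_ge)
    show "AE \<omega> in Q. \<omega> \<in> A \<longrightarrow> (\<lambda>l. sys.avg_error l \<omega>) \<longlonglongrightarrow> 1"
      using sys.AE_nonzero_gains[of 0] by eventually_elim (use info avg_error_tendsto_1 in blast)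
  qed (use A in \<open>auto simp: sys.avg_error_bounds avg_error_measurable\<close>)
  then show ?thesis by simp
qed

lemma info_ge_source:
  assumes a0: "\<And>l t. sys.dest_rate l \<omega> t \<ge> a0" and "a0 > R \<rho>"
  shows "surplus \<omega>"
proof (intro exI conjI always_eventually allI)
  show "a0 - R \<rho> > 0" using assms by simp
  fix l
  have "real l * a0 = (\<Sum>t<l. a0)" by simp
  also have "\<dots> \<le> dest_info l \<omega>" by (intro sum_mono a0)
  finally show "real l * (R \<rho> + (a0 - R \<rho>)) \<le> dest_info l \<omega>" by simp
qed

text \<open>Crediting the relay with the source's contribution alone, \<open>x\<close> intervals at
  rate at least \<open>b\<close> cross the threshold; the margin follows.\<close>

lemma relay_transmits:
  assumes j: "0 < j" "j < N" and b: "sys.source_relay_rate 0 \<omega> j \<ge> b" and t: "real t \<ge> real (\<mu> l) + x" and x: "x * b > real l * R \<rho>" "b > 0"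
  shows "j \<in> transmitting (fam l) \<omega> t"
proof -
  have "x > 0" using x R_pos by (smt (verit) mult_nonneg_nonneg mult_nonpos_nonneg of_nat_0_le_iff)
  then have tm: "t \<ge> \<mu> l" "real (t - \<mu> l) \<ge> x" using t by linarith+
  have "real l * R \<rho> < x * b" by fact
  also have "\<dots> \<le> real (t - \<mu> l) * b" using tm x by (intro mult_right_mono) auto
  also have "\<dots> = (\<Sum>\<tau><t - \<mu> l. b)" by simp
  also have "\<dots> \<le> (\<Sum>\<tau><t - \<mu> l. sys.relay_rate l \<omega> j \<tau>)"
  proof (rule sum_mono)
    fix \<tau>
    have "sys.source_relay_rate l \<omega> j = sys.source_relay_rate 0 \<omega> j" by (simp add: sys.source_relay_rate_def)
    then show "b \<le> sys.relay_rate l \<omega> j \<tau>"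
      using sys.source_relay_rate_le[OF j(1), of l \<omega> \<tau>] b by linarith
  qed
  finally show ?thesis using j by (simp add: sys.in_transmitting_iff)
qed

text \<open>The number \<open>f\<close> bounds the limiting fraction of the codeword after which
  relay \<open>j\<close> surely transmits, the margin being negligible against \<open>l\<close>. The
  destination then receives at least \<open>a0\<close> per interval before that point and
  \<open>a1\<close> after it.\<close>

lemma info_ge_relay:
  assumes j: "0 < j" "j < N" and b: "sys.source_relay_rate 0 \<omega> j \<ge> b" "b > 0"
    and a0: "a0 \<ge> 0" "\<And>l t. sys.dest_rate l \<omega> t \<ge> a0"
    and a1: "\<And>l t. j \<in> transmitting (fam l) \<omega> t \<Longrightarrow> sys.dest_rate l \<omega> t \<ge> a1"
    and f: "R \<rho> / b \<le> f" "f < 1" and gt: "f * a0 + (1 - f) * a1 > R \<rho>"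
  shows "surplus \<omega>"
proof -
  define \<delta> where "\<delta> = (f * a0 + (1 - f) * a1 - R \<rho>) / 2"
  \<comment> \<open>The added 1 makes the accumulated information exceed the threshold
    strictly.\<close>
  define T where "T l = \<mu> l + nat \<lceil>f * real l\<rceil> + 1" for l
  have f0: "f > 0" using f R_pos b by (smt (verit) divide_pos_pos)
  have Tl: "(\<lambda>l. real (T l) / real l) \<longlonglongrightarrow> f"
  proof -
    have lim1: "(\<lambda>l. 1 / real l) \<longlonglongrightarrow> 0" by (rule lim_1_over_n)
    have lim2: "(\<lambda>l. real (\<mu> l) / real l) \<longlonglongrightarrow> 0" using margin by (simp add: admissible_margin_def)
    have lo: "(\<lambda>l. real (\<mu> l) / real l + f + 1 / real l) \<longlonglongrightarrow> 0 + f + 0"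
      by (intro tendsto_intros lim1 lim2)
    have hi: "(\<lambda>l. real (\<mu> l) / real l + f + 2 * (1 / real l)) \<longlonglongrightarrow> 0 + f + 2 * 0"
      by (intro tendsto_intros lim1 lim2)
    show ?thesis
    proof (rule real_tendsto_sandwich)
      show "\<forall>\<^sub>F l in sequentially. real (\<mu> l) / real l + f + 1 / real l \<le> real (T l) / real l"
        using eventually_gt_at_top[of 0]
      proof eventually_elim
        case (elim l)
        have "real (\<mu> l) + f * real l + 1 \<le> real (T l)" unfolding T_def by linarith
        then have "(real (\<mu> l) + f * real l + 1) / real l \<le> real (T l) / real l" by (intro divide_right_mono) auto
        then show ?case using elim by (simp add: add_divide_distrib)
      qed
      show "\<forall>\<^sub>F l in sequentially. real (T l) / real l \<le> real (\<mu> l) / real l + f + 2 * (1 / real l)"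
        using eventually_gt_at_top[of 0]
      proof eventually_elim
        case (elim l)
        have "0 \<le> f * real l" using f0 by simp
        then have "real (T l) \<le> real (\<mu> l) + f * real l + 2" unfolding T_def by linarith
        then have "real (T l) / real l \<le> (real (\<mu> l) + f * real l + 2) / real l" by (intro divide_right_mono) auto
        then show ?case using elim by (simp add: add_divide_distrib)
      qed
    qed (use lo hi in auto)
  qed
  have "(\<lambda>l. real (T l) / real l * a0 + (1 - real (T l) / real l) * a1) \<longlonglongrightarrow> f * a0 + (1 - f) * a1"
    by (intro tendsto_intros Tl)
  moreover have "R \<rho> + \<delta> < f * a0 + (1 - f) * a1" using gt by (simp add: \<delta>_def field_simps)
  ultimately have ev1: "\<forall>\<^sub>F l in sequentially. R \<rho> + \<delta> < real (T l) / real l * a0 + (1 - real (T l) / real l) * a1"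
    by (rule order_tendstoD(1))
  have ev2: "\<forall>\<^sub>F l in sequentially. real (T l) / real l < 1"
    using Tl f(2) by (rule order_tendstoD(2))
  have "\<forall>\<^sub>F l in sequentially. dest_info l \<omega> \<ge> real l * (R \<rho> + \<delta>)"
    using ev1 ev2 eventually_gt_at_top[of 0]
  proof eventually_elim
    case (elim l)
    then have Tl: "T l \<le> l" by (simp add: field_simps)
    have "real l * (R \<rho> + \<delta>) \<le> real l * (real (T l) / real l * a0 + (1 - real (T l) / real l) * a1)"
      using elim by (intro mult_left_mono) auto
    also have "\<dots> = real (T l) * a0 + (real l - real (T l)) * a1"
      using elim by (simp add: field_simps)
    also have "\<dots> = (\<Sum>t<T l. a0) + (\<Sum>t\<in>{T l..<l}. a1)"
      using Tl by (simp add: of_nat_diff)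
    also have "\<dots> \<le> (\<Sum>t<T l. sys.dest_rate l \<omega> t) + (\<Sum>t\<in>{T l..<l}. sys.dest_rate l \<omega> t)"
    proof (intro add_mono sum_mono a0 a1)
      fix t assume t: "t \<in> {T l..<l}"
      show "j \<in> transmitting (fam l) \<omega> t"
      proof (rule relay_transmits[OF j b(1)])
        show "real (\<mu> l) + (f * real l + 1) \<le> real t" using t unfolding T_def by simp linarith
        have "R \<rho> \<le> f * b" using f(1) b(2) by (simp add: field_simps)
        then have "real l * R \<rho> \<le> real l * (f * b)" by (intro mult_left_mono) auto
        then show "real l * R \<rho> < (f * real l + 1) * b" using b by (simp add: algebra_simps)
      qed (use b in auto)
    qed
    also have "\<dots> = dest_info l \<omega>"
      using Tl by (subst sum.union_disjoint[symmetric]) (auto intro!: sum.cong)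
    finally show ?case .
  qed
  moreover have "\<delta> > 0" using gt by (simp add: \<delta>_def)
  ultimately show ?thesis by blast
qed

text \<open>With all gains at the relays at most 1, no relay gathers more than \<open>B\<close> per
  interval, so none starts before the fraction \<open>R / B\<close> of the codeword. Afterwards even
  all \<open>N\<close> nodes together provide at most \<open>A1\<close> per interval.\<close>

lemma info_le:
  assumes h: "\<And>i j. i < N \<Longrightarrow> j < N \<Longrightarrow> (cmod (\<omega> (Relay_Gain i j)))\<^sup>2 \<le> 1"
    and g0: "(cmod (\<omega> (Dest_Gain 0)))\<^sup>2 \<le> x0" and g: "\<And>i. i < N \<Longrightarrow> (cmod (\<omega> (Dest_Gain i)))\<^sup>2 \<le> x1"
    and x: "0 \<le> x0" "x0 \<le> x1"
    and B: "B = log 2 (1 + \<sigma>v2 / \<sigma>w2 * \<rho> * real N)" and \<phi>: "\<phi> = min 1 (R \<rho> / B)"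
    and A: "A0 = log 2 (1 + \<rho> * x0)" "A1 = log 2 (1 + \<rho> * (real N * x1))"
    and lt: "\<phi> * A0 + (1 - \<phi>) * A1 < R \<rho>"
  shows "deficit \<omega>"
proof -
  have cp: "\<sigma>v2 / \<sigma>w2 * \<rho> > 0" using noise_pos rho_pos by simp
  have "\<sigma>v2 / \<sigma>w2 * \<rho> * real N > 0" using noise_pos rho_pos N by (intro mult_pos_pos divide_pos_pos) auto
  then have Bp: "B > 0" unfolding B by (subst zero_less_log_cancel_iff) auto
  have A01: "A0 \<le> A1"
  proof -
    have "1 * x0 \<le> real N * x1" using x N by (intro mult_mono) auto
    then have "\<rho> * x0 \<le> \<rho> * (real N * x1)" using rho_pos by (intro mult_left_mono) auto
    moreover have "0 \<le> \<rho> * x0" using rho_pos x by simp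
    ultimately show ?thesis unfolding A by (subst log_le_cancel_iff) auto
  qed
  have rr: "sys.relay_rate l \<omega> j \<tau> \<le> B" if "j < N" for l j \<tau>
  proof -
    have "(\<Sum>i\<in>transmitting (fam l) \<omega> \<tau> - {j}. (cmod (\<omega> (Relay_Gain i j)))\<^sup>2)
        \<le> (\<Sum>i<N. (cmod (\<omega> (Relay_Gain i j)))\<^sup>2)"
      using sys.transmitting_subset[of l \<omega> \<tau>] by (intro sum_mono2) auto
    also have "\<dots> \<le> (\<Sum>i<N. 1)" using h that by (intro sum_mono) auto
    finally have "\<sigma>v2 / \<sigma>w2 * \<rho> * (\<Sum>i\<in>transmitting (fam l) \<omega> \<tau> - {j}. (cmod (\<omega> (Relay_Gain i j)))\<^sup>2) \<le> \<sigma>v2 / \<sigma>w2 * \<rho> * real N"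
      using cp by (intro mult_left_mono) auto
    moreover have "0 \<le> \<sigma>v2 / \<sigma>w2 * \<rho> * (\<Sum>i\<in>transmitting (fam l) \<omega> \<tau> - {j}. (cmod (\<omega> (Relay_Gain i j)))\<^sup>2)"
      by (rule mult_nonneg_nonneg[OF less_imp_le[OF cp] sum_nonneg]) auto
    ultimately show ?thesis
      unfolding sys.relay_rate_def B fam_simps by (subst log_le_cancel_iff) auto
  qed
  have early: "transmitting (fam l) \<omega> t = {0}" if "real t \<le> real l * R \<rho> / B" for l t
  proof -
    have "j = 0" if j: "j \<in> transmitting (fam l) \<omega> t" for j
    proof (rule ccontr)
      assume "j \<noteq> 0"
      then have "j < N" and "real l * R \<rho> < (\<Sum>\<tau><t - \<mu> l. sys.relay_rate l \<omega> j \<tau>)"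
        using j by (auto simp: sys.in_transmitting_iff)
      note this(2)
      also have "\<dots> \<le> (\<Sum>\<tau><t - \<mu> l. B)" by (intro sum_mono rr \<open>j < N\<close>)
      also have "\<dots> \<le> real t * B" using Bp by (simp add: mult_right_mono)
      also have "\<dots> \<le> real l * R \<rho>" using \<open>real t \<le> real l * R \<rho> / B\<close> Bp by (simp add: field_simps)
      finally show False by simp
    qed
    then show ?thesis using sys.zero_in_transmitting[of l \<omega> t] by blast
  qed
  have dr0: "sys.dest_rate l \<omega> t \<le> A0" if "real t \<le> real l * R \<rho> / B" for l t
  proof -
    have "\<rho> * (cmod (\<omega> (Dest_Gain 0)))\<^sup>2 \<le> \<rho> * x0" using g0 rho_pos by (intro mult_left_mono) auto
    moreover have "0 \<le> \<rho> * (cmod (\<omega> (Dest_Gain 0)))\<^sup>2" using rho_pos by simp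
    ultimately show ?thesis
      unfolding sys.dest_rate_def early[OF that] A fam_simps by simp
  qed
  have dr1: "sys.dest_rate l \<omega> t \<le> A1" for l t
  proof -
    have "(\<Sum>i\<in>transmitting (fam l) \<omega> t. (cmod (\<omega> (Dest_Gain i)))\<^sup>2) \<le> (\<Sum>i<N. (cmod (\<omega> (Dest_Gain i)))\<^sup>2)"
      using sys.transmitting_subset[of l \<omega> t] by (intro sum_mono2) auto
    also have "\<dots> \<le> (\<Sum>i<N. x1)" using g by (intro sum_mono) auto
    finally have "\<rho> * (\<Sum>i\<in>transmitting (fam l) \<omega> t. (cmod (\<omega> (Dest_Gain i)))\<^sup>2) \<le> \<rho> * (real N * x1)"
      using rho_pos by (intro mult_left_mono) auto
    moreover have "0 \<le> \<rho> * (\<Sum>i\<in>transmitting (fam l) \<omega> t. (cmod (\<omega> (Dest_Gain i)))\<^sup>2)"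
      using rho_pos by (intro mult_nonneg_nonneg sum_nonneg) auto
    ultimately show ?thesis
      unfolding sys.dest_rate_def A fam_simps by (subst log_le_cancel_iff) auto
  qed
  have "dest_info l \<omega> \<le> real l * (\<phi> * A0 + (1 - \<phi>) * A1)" for l
  proof -
    define E where "E = {t. t < l \<and> real t \<le> real l * R \<rho> / B}"
    have E: "E \<subseteq> {..<l}" "finite E" by (auto simp: E_def)
    have pos: "0 \<le> real l * R \<rho> / B" using Bp R_pos by simp
    have cardE: "real l * \<phi> \<le> real (card E)"
    proof (cases "real l * R \<rho> / B \<ge> real l")
      case True
      then have "E = {..<l}" by (auto simp: E_def)
      moreover have "real l * \<phi> \<le> real l * 1" unfolding \<phi> by (intro mult_left_mono) auto
      ultimately show ?thesis by simp
    next
      case False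
      \<comment> \<open>Intervals are counted from 0, so those with \<open>t \<le> x\<close> number
        \<open>\<lfloor>x\<rfloor> + 1\<close>, which is at least \<open>x\<close>.\<close>
      have "{..<nat \<lfloor>real l * R \<rho> / B\<rfloor> + 1} \<subseteq> E"
      proof
        fix t assume "t \<in> {..<nat \<lfloor>real l * R \<rho> / B\<rfloor> + 1}"
        then have "real t \<le> real l * R \<rho> / B" using pos by simp linarith
        then show "t \<in> E" using False by (simp add: E_def)
      qed
      then have "card {..<nat \<lfloor>real l * R \<rho> / B\<rfloor> + 1} \<le> card E" by (intro card_mono E)
      then have "real l * R \<rho> / B \<le> real (card E)" using pos by simp linarith
      moreover have "real l * \<phi> \<le> real l * (R \<rho> / B)" unfolding \<phi> by (intro mult_left_mono) auto
      ultimately show ?thesis by simp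
    qed
    have "dest_info l \<omega> \<le> (\<Sum>t<l. A1 - (A1 - A0) * (if t \<in> E then 1 else 0))"
      by (intro sum_mono) (auto simp: E_def intro: dr0 dr1)
    also have "\<dots> = real l * A1 - (A1 - A0) * real (card E)"
    proof -
      have "(\<Sum>t<l. if t \<in> E then 1 else 0 :: real) = real (card E)"
        using E by (simp add: sum.If_cases Int_absorb1)
      then show ?thesis by (simp only: sum_subtractf sum_distrib_left[symmetric]) simp
    qed
    also have "\<dots> \<le> real l * A1 - (A1 - A0) * (real l * \<phi>)"
      using A01 cardE by (intro diff_left_mono mult_left_mono) auto
    also have "\<dots> = real l * (\<phi> * A0 + (1 - \<phi>) * A1)" by (simp add: algebra_simps)
    finally show ?thesis .
  qed
  then show ?thesis
    using lt by (intro exI[of _ "R \<rho> - (\<phi> * A0 + (1 - \<phi>) * A1)"]) (auto intro: always_eventually)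
qed

end

section \<open>Probabilities of gain events\<close>

context ddf_long
begin

lemma AE_coord_nonzero_Q: "AE \<omega> in Q. \<omega> k \<noteq> 0"
  by (rule sys.AE_coord_nonzero)

lemma distr_gain: "gain_coord k \<Longrightarrow> distr Q borel (\<lambda>\<omega>. \<omega> k) = cgauss 1"
  by (subst sys.distr_coord) (cases k; simp)

lemma small_gains_prob_ge:
  assumes J: "finite J" "\<And>k. k \<in> J \<Longrightarrow> gain_coord k" and x: "\<And>k. k \<in> J \<Longrightarrow> 0 \<le> x k \<and> x k \<le> 1"
  shows "(\<Prod>k\<in>J. 2 * exp (- 1) / pi * x k) \<le> measure Q {\<omega>\<in>space Q. \<forall>k\<in>J. (cmod (\<omega> k))\<^sup>2 \<le> x k}"
proof (cases "J = {}")
  case True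
  then show ?thesis using sys.prob_space[of 0] by simp
next
  case False
  have p: "measure Q {\<omega>\<in>space Q. (cmod (\<omega> k))\<^sup>2 \<le> x k} \<ge> 2 * exp (- 1) / pi * x k" if k: "k \<in> J" for k
  proof -
    interpret C: prob_space "cgauss 1" by (rule prob_space_cgauss) simp
    have "ennreal (2 * exp (- 1) / pi * x k) \<le> emeasure (cgauss 1) {z. (cmod z)\<^sup>2 \<le> x k}"
      using x[OF k] by (intro cgauss_ball_ge) auto
    also have "\<dots> = emeasure (distr Q borel (\<lambda>\<omega>. \<omega> k)) {z. (cmod z)\<^sup>2 \<le> x k}"
      using distr_gain[OF J(2)[OF k]] by simp
    also have "\<dots> = emeasure Q {\<omega>\<in>space Q. (cmod (\<omega> k))\<^sup>2 \<le> x k}"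
      by (subst emeasure_distr) (auto intro!: arg_cong2[where f=emeasure])
    finally show ?thesis
      unfolding sys.emeasure_eq_measure by (subst (asm) ennreal_le_iff) auto
  qed
  have "sys.indep_vars 0 (\<lambda>_. borel) (\<lambda>k \<omega>. \<omega> k) J"
    by (rule sys.indep_vars_subset[OF sys.indep_coords]) simp
  then have "measure Q (\<Inter>k\<in>J. (\<lambda>\<omega>. \<omega> k) -` {z. (cmod z)\<^sup>2 \<le> x k} \<inter> space Q)
    = (\<Prod>k\<in>J. measure Q ((\<lambda>\<omega>. \<omega> k) -` {z. (cmod z)\<^sup>2 \<le> x k} \<inter> space Q))"
    using False J by (intro sys.indep_varsD_finite) auto
  moreover have "(\<Inter>k\<in>J. (\<lambda>\<omega>. \<omega> k) -` {z. (cmod z)\<^sup>2 \<le> x k} \<inter> space Q) = {\<omega>\<in>space Q. \<forall>k\<in>J. (cmod (\<omega> k))\<^sup>2 \<le> x k}"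
    using False by auto
  moreover have "((\<lambda>\<omega>. \<omega> k) -` {z. (cmod z)\<^sup>2 \<le> x k} \<inter> space Q) = {\<omega>\<in>space Q. (cmod (\<omega> k))\<^sup>2 \<le> x k}" for k
    by auto
  ultimately have "measure Q {\<omega>\<in>space Q. \<forall>k\<in>J. (cmod (\<omega> k))\<^sup>2 \<le> x k} = (\<Prod>k\<in>J. measure Q {\<omega>\<in>space Q. (cmod (\<omega> k))\<^sup>2 \<le> x k})"
    by simp
  also have "\<dots> \<ge> (\<Prod>k\<in>J. 2 * exp (- 1) / pi * x k)"
    using p x by (intro prod_mono) auto
  finally show ?thesis .
qed

text \<open>The exponent \<open>N + N * N\<close> counts the coordinates of the box:
  \<open>N\<close> gains to the destination and a full square of relay gains. Only the destination
  gains have a shrinking bound, namely \<open>x0\<close> for the source and \<open>x1\<close> for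
  each of the \<open>N - 1\<close> relays.\<close>

lemma long_code_error_inf_ge_powr:
  assumes x: "0 \<le> x0" "x0 \<le> x1" "x1 \<le> 1"
    and B: "B = log 2 (1 + \<sigma>v2 / \<sigma>w2 * \<rho> * real N)" and \<phi>: "\<phi> = min 1 (R \<rho> / B)"
    and lt: "\<phi> * log 2 (1 + \<rho> * x0) + (1 - \<phi>) * log 2 (1 + \<rho> * (real N * x1)) < R \<rho>"
  shows "(2 * exp (- 1) / pi) ^ (N + N * N) * (x0 * x1 ^ (N - 1)) \<le> long_code_error_inf fam"
proof -
  define k where "k = 2 * exp (- 1 :: real) / pi"
  define J where "J = Dest_Gain ` {..<N} \<union> case_prod Relay_Gain ` ({..<N} \<times> {..<N})"
  define x where "x c = (case c of Dest_Gain i \<Rightarrow> if i = 0 then x0 else x1 | _ \<Rightarrow> 1)" for c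
  have J: "finite J" "\<And>c. c \<in> J \<Longrightarrow> gain_coord c" by (auto simp: J_def)
  define A where "A = {\<omega>\<in>space Q. \<forall>c\<in>J. (cmod (\<omega> c))\<^sup>2 \<le> x c}"
  have Am: "A \<in> sets Q" unfolding A_def using J(1) by measurable
  have "(\<Prod>c\<in>J. k * x c) = (\<Prod>i<N. k * x (Dest_Gain i)) * (\<Prod>c\<in>{..<N} \<times> {..<N}. k * x (case_prod Relay_Gain c))"
    unfolding J_def by (subst prod.union_disjoint) (auto simp: prod.reindex inj_on_def)
  also have "(\<Prod>c\<in>{..<N} \<times> {..<N}. k * x (case_prod Relay_Gain c)) = k ^ (N * N)"
    by (simp add: x_def split_beta)
  also have "(\<Prod>i<N. k * x (Dest_Gain i)) = k ^ N * (x0 * x1 ^ (N - 1))"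
  proof -
    obtain n where n: "N = Suc n" using N by (cases N) auto
    show ?thesis unfolding n by (subst prod.lessThan_Suc_shift) (simp add: x_def power_mult_distrib mult_ac)
  qed
  finally have "(\<Prod>c\<in>J. k * x c) = k ^ (N + N * N) * (x0 * x1 ^ (N - 1))" by (simp add: power_add mult_ac)
  moreover have "(\<Prod>c\<in>J. k * x c) \<le> measure Q A"
    unfolding k_def A_def using x(1-3) by (intro small_gains_prob_ge J) (auto simp: x_def split: coord.split)
  moreover have "measure Q A \<le> long_code_error_inf fam"
  proof (rule long_code_error_inf_ge[OF Am])
    fix \<omega> assume "\<omega> \<in> A"
    then have *: "(cmod (\<omega> c))\<^sup>2 \<le> x c" if "c \<in> J" for c using that by (auto simp: A_def)
    show "deficit \<omega>"
    proof (rule info_le[OF _ _ _ x(1,2) B \<phi> refl refl lt])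
      show "(cmod (\<omega> (Relay_Gain i j)))\<^sup>2 \<le> 1" if "i < N" "j < N" for i j
        using *[of "Relay_Gain i j"] that by (force simp: J_def x_def)
      show "(cmod (\<omega> (Dest_Gain 0)))\<^sup>2 \<le> x0"
        using *[of "Dest_Gain 0"] N by (force simp: J_def x_def)
      show "(cmod (\<omega> (Dest_Gain i)))\<^sup>2 \<le> x1" if "i < N" for i
        using *[of "Dest_Gain i"] that x(2) by (force simp: J_def x_def split: if_splits)
    qed
  qed
  ultimately show ?thesis by (simp add: k_def)
qed

text \<open>Gains between relays are left out: the achievability bound credits a relay with the
  source's signal only.\<close>

definition key_gains :: "coord set" where
  "key_gains = Dest_Gain ` {..<N} \<union> Relay_Gain 0 ` {1..<N}"

lemma finite_key_gains [simp]: "finite key_gains"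
  by (simp add: key_gains_def)

text \<open>For \<open>\<rho> > 1\<close>, in exponents: the exponents of the capped key gains add
  up to at least \<open>D\<close>.\<close>

definition outage :: "real \<Rightarrow> (coord \<Rightarrow> complex) set" where
  "outage D = {\<omega>\<in>space Q. (\<Prod>k\<in>key_gains. min 1 ((cmod (\<omega> k))\<^sup>2)) \<le> \<rho> powr (- D)}"

lemma sets_outage [measurable]: "outage D \<in> sets Q"
  unfolding outage_def by measurable

lemma prob_outage_le:
  assumes e: "0 < e" "e < 1"
  shows "measure Q (outage D)
    \<le> enn2real (\<integral>\<^sup>+z. ennreal (min 1 ((cmod z)\<^sup>2) powr (- (1 - e))) \<partial>cgauss 1) ^ card key_gains * \<rho> powr (- D * (1 - e))"
proof -
  define m where "m z = ennreal (min 1 ((cmod z)\<^sup>2) powr (- (1 - e)))" for z :: complex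
  define C where "C = (\<integral>\<^sup>+z. m z \<partial>cgauss 1)"
  have [measurable]: "m \<in> borel_measurable borel" unfolding m_def by measurable
  have C: "C < \<infinity>" unfolding C_def m_def by (rule nn_integral_cgauss_min_powr_finite[OF e])
  have "emeasure Q (outage D) \<le> emeasure Q {\<omega>\<in>space Q. 1 \<le> ennreal (\<rho> powr (- D * (1 - e))) * (\<Prod>k\<in>key_gains. m (\<omega> k))}"
  proof (rule emeasure_mono_AE)
    \<comment> \<open>At a vanishing gain the convention \<open>0 powr x = 0\<close> would make the
      negative power 0 instead of infinite and break the inequality.\<close>
    have "AE \<omega> in Q. \<forall>k\<in>key_gains. \<omega> k \<noteq> 0"
      by (intro AE_finite_allI finite_key_gains AE_coord_nonzero_Q)
    then show "AE \<omega> in Q. \<omega> \<in> outage D \<longrightarrow> \<omega> \<in> {\<omega>\<in>space Q. 1 \<le> ennreal (\<rho> powr (- D * (1 - e))) * (\<Prod>k\<in>key_gains. m (\<omega> k))}"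
    proof eventually_elim
      case (elim \<omega>)
      show ?case
      proof
        assume o: "\<omega> \<in> outage D"
        let ?p = "\<Prod>k\<in>key_gains. min 1 ((cmod (\<omega> k))\<^sup>2)"
        have p0: "?p > 0" using elim by (intro prod_pos) auto
        have "?p \<le> \<rho> powr (- D)" using o by (simp add: outage_def)
        then have "(\<rho> powr (- D)) powr (- (1 - e)) \<le> ?p powr (- (1 - e))"
          using p0 e by (intro powr_mono2') auto
        then have "\<rho> powr (- D * (1 - e)) * (\<rho> powr (- D)) powr (- (1 - e)) \<le> \<rho> powr (- D * (1 - e)) * ?p powr (- (1 - e))"
          by (intro mult_left_mono) auto
        also have "\<rho> powr (- D * (1 - e)) * (\<rho> powr (- D)) powr (- (1 - e)) = 1"
          using rho_pos by (simp add: powr_powr powr_add[symmetric] algebra_simps)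
        also have "?p powr (- (1 - e)) = (\<Prod>k\<in>key_gains. min 1 ((cmod (\<omega> k))\<^sup>2) powr (- (1 - e)))"
          by (rule prod_powr_distrib)
        finally have "1 \<le> ennreal (\<rho> powr (- D * (1 - e))) * ennreal (\<Prod>k\<in>key_gains. min 1 ((cmod (\<omega> k))\<^sup>2) powr (- (1 - e)))"
          by (simp add: ennreal_mult[symmetric] prod_nonneg)
        then show "\<omega> \<in> {\<omega>\<in>space Q. 1 \<le> ennreal (\<rho> powr (- D * (1 - e))) * (\<Prod>k\<in>key_gains. m (\<omega> k))}"
          by (simp add: m_def prod_ennreal)
      qed
    qed
  qed measurable
  also have "\<dots> \<le> ennreal (\<rho> powr (- D * (1 - e))) * (\<integral>\<^sup>+\<omega>. (\<Prod>k\<in>key_gains. m (\<omega> k)) * indicator (space Q) \<omega> \<partial>Q)"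
    by (rule nn_integral_Markov_inequality) measurable
  also have "(\<integral>\<^sup>+\<omega>. (\<Prod>k\<in>key_gains. m (\<omega> k)) * indicator (space Q) \<omega> \<partial>Q) = (\<integral>\<^sup>+\<omega>. (\<Prod>k\<in>key_gains. m (\<omega> k)) \<partial>Q)"
    by (intro nn_integral_cong) simp
  also have "\<dots> = (\<Prod>k\<in>key_gains. \<integral>\<^sup>+\<omega>. m (\<omega> k) \<partial>Q)"
  proof (rule sys.indep_vars_nn_integral)
    have "sys.indep_vars 0 (\<lambda>_. borel) (\<lambda>k \<omega>. \<omega> k) key_gains"
      by (rule sys.indep_vars_subset[OF sys.indep_coords]) simp
    then show "sys.indep_vars 0 (\<lambda>_. borel) (\<lambda>k \<omega>. m (\<omega> k)) key_gains"
      by (rule sys.indep_vars_compose2) simp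
  qed auto
  also have "\<dots> = (\<Prod>k\<in>key_gains. C)"
  proof (rule prod.cong[OF refl])
    fix k assume "k \<in> key_gains"
    then have "gain_coord k" by (auto simp: key_gains_def)
    then show "(\<integral>\<^sup>+\<omega>. m (\<omega> k) \<partial>Q) = C"
      unfolding C_def by (subst distr_gain[symmetric]) (auto simp: nn_integral_distr)
  qed
  also have "\<dots> = ennreal (enn2real C ^ card key_gains)"
    using C by (simp add: ennreal_power[symmetric] ennreal_enn2real)
  also have "ennreal (\<rho> powr (- D * (1 - e))) * \<dots> = ennreal (enn2real C ^ card key_gains * \<rho> powr (- D * (1 - e)))"
    by (simp add: ennreal_mult[symmetric] mult.commute)
  finally show ?thesis
    unfolding sys.emeasure_eq_measure C_def m_def by (subst (asm) ennreal_le_iff) auto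
qed

end

text \<open>With \<open>k = r * x / (1 - r)\<close>, relay \<open>j\<close> starts at the fraction
  \<open>f = r / (1 - u j)\<close> and the destination collects
  \<open>f * (1 - x) + (1 - f) * (1 - v j)\<close>. The number \<open>k\<close> is chosen so that
  this equals \<open>r\<close> for \<open>u j = 0\<close> and \<open>v j = 1 - k\<close>. For a
  given sum \<open>u j + v j\<close>, moving loss from the relay-destination link to the
  source-relay link does not hurt: on the line \<open>u j + v j = 1 - k\<close> the surplus over
  \<open>r\<close> is \<open>u j * (1 - k / (1 - u j))\<close>, which is nonnegative.\<close>

lemma outage_alternative:
  fixes u v :: "'i \<Rightarrow> real"
  assumes r: "0 < r" "r < 1" and v0: "v0 \<ge> 0" and J: "finite J"
    and uv: "\<And>j. j \<in> J \<Longrightarrow> u j \<ge> 0" "\<And>j. j \<in> J \<Longrightarrow> v j \<ge> 0"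
    and lt: "v0 + (\<Sum>j\<in>J. u j + v j) < D"
    and D: "\<And>x. 1 - r \<le> x \<Longrightarrow> x \<le> 1 \<Longrightarrow> D \<le> x + real (card J) * max 0 (1 - r * x / (1 - r))"
  shows "1 - v0 > r \<or> (\<exists>j\<in>J. u j < 1 \<and> r / (1 - u j) < 1 \<and>
    r / (1 - u j) * (1 - min v0 1) + (1 - r / (1 - u j)) * (1 - v j) > r)"
proof (cases "1 - v0 > r")
  case False
  define x where "x = min v0 1"
  define k where "k = r * x / (1 - r)"
  have x: "1 - r \<le> x" "x \<le> 1" "x \<le> v0" using False r by (auto simp: x_def)
  \<comment> \<open>Pigeonhole: if every relay had a sum of at least \<open>max 0 (1 - k)\<close>,
    the total would reach \<open>D\<close>.\<close>
  obtain j where j: "j \<in> J" "u j + v j < max 0 (1 - k)"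
  proof (rule ccontr)
    assume no: "\<not> thesis"
    have "(\<Sum>j\<in>J. max 0 (1 - k)) \<le> (\<Sum>j\<in>J. u j + v j)"
      using no that by (intro sum_mono) (meson not_le)
    then show False using D[OF x(1,2)] lt x by (simp add: k_def)
  qed
  have uvj: "u j \<ge> 0" "v j \<ge> 0" "u j + v j < 1 - k" using j uv[OF j(1)] by (auto simp: max_def split: if_splits)
  have "r * (1 - r) \<le> r * x" using x r by (intro mult_left_mono) auto
  \<comment> \<open>Since \<open>w > k\<close>, this gives \<open>w > r\<close>: the relay finishes
    listening before the codeword ends.\<close>
  then have kr: "k \<ge> r" using r by (simp add: k_def field_simps)
  define w where "w = 1 - u j"
  have w: "w > k" "w > r" "w > 0" "w \<le> 1" using uvj kr r by (auto simp: w_def)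
  define f where "f = r / w"
  have f: "0 < f" "f < 1" using w r by (auto simp: f_def)
  define q where "q = k / w"
  have "f * x = r * x / w" by (simp add: f_def)
  also have "r * x = k * (1 - r)" using r by (simp add: k_def)
  finally have fx: "f * x = q * (1 - r)" by (simp add: q_def)
  have fk: "f * k = r * q" and fw: "f * w = r" and wq: "w * q = k" using w by (auto simp: f_def q_def)
  have "f * (1 - x) + (1 - f) * (k + (1 - w)) = k + (1 - w) - f * x - f * k + f * w"
    by (simp add: algebra_simps)
  also have "\<dots> = r + (1 - w) * (1 - k / w)"
    unfolding fx fk fw q_def[symmetric] using wq by (simp add: algebra_simps)
  finally have "f * (1 - x) + (1 - f) * (k + (1 - w)) = r + (1 - w) * (1 - k / w)" .
  moreover have "0 \<le> (1 - w) * (1 - k / w)" using w by (intro mult_nonneg_nonneg) auto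
  moreover have "(1 - f) * (k + (1 - w)) < (1 - f) * (1 - v j)"
    using f uvj by (intro mult_strict_left_mono) (auto simp: w_def)
  ultimately have "f * (1 - x) + (1 - f) * (1 - v j) > r" by linarith
  then show ?thesis using j(1) w f unfolding f_def w_def x_def by (intro disjI2 bexI[of _ j]) auto
qed simp

context ddf_long
begin

lemma log_gain:
  assumes "\<rho> > 1" "z \<noteq> 0" "c > 0"
  shows "log 2 (1 + c * \<rho> * (cmod z)\<^sup>2) \<ge> log 2 \<rho> * (1 - (- log \<rho> (min 1 ((cmod z)\<^sup>2)))) + log 2 c"
proof -
  define m where "m = min 1 ((cmod z)\<^sup>2)"
  have m: "m > 0" "m \<le> (cmod z)\<^sup>2" using assms by (auto simp: m_def)
  have "log 2 \<rho> * log \<rho> m = log 2 m"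
    using assms m by (simp add: log_def)
  then have "log 2 \<rho> * (1 - (- log \<rho> m)) + log 2 c = log 2 (c * \<rho> * m)"
    using assms m by (simp add: log_mult algebra_simps)
  also have "\<dots> \<le> log 2 (1 + c * \<rho> * (cmod z)\<^sup>2)"
  proof -
    have "c * \<rho> * m \<le> c * \<rho> * (cmod z)\<^sup>2" using assms m by (intro mult_left_mono) auto
    moreover have "0 < c * \<rho> * m" using assms m by simp
    ultimately show ?thesis by (subst log_le_cancel_iff) auto
  qed
  finally show ?thesis by (simp add: m_def)
qed

text \<open>The noise ratio shifts each source-relay exponent by a term of order
  \<open>1 / log 2 \<rho>\<close>. The number \<open>k\<close> bounds this loss and is added to each
  of the \<open>N - 1\<close> exponents, which accounts for the correction of \<open>D\<close> in
  the outage event.\<close>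

lemma info_ge_of_not_outage:
  assumes rho: "\<rho> > 1" and r: "0 < r" "r < 1" "R \<rho> \<le> r * log 2 \<rho>"
    and D: "\<And>x. 1 - r \<le> x \<Longrightarrow> x \<le> 1 \<Longrightarrow> D \<le> x + real (N - 1) * max 0 (1 - r * x / (1 - r))"
    and k: "k \<ge> 0" "k \<ge> - log 2 (\<sigma>v2 / \<sigma>w2) / log 2 \<rho>"
    and good: "sys.nonzero_gains 0 \<omega>" and no: "\<omega> \<notin> outage (D - real (N - 1) * k)"
  shows "surplus \<omega>"
proof -
  define L where "L = log 2 \<rho>"
  have L: "L > 0" using rho by (simp add: L_def)
  define V where "V c = - log \<rho> (min 1 ((cmod (\<omega> c))\<^sup>2))" for c
  have V0: "V c \<ge> 0" for c
    using rho by (cases "\<omega> c = 0") (auto simp: V_def log_def ln_le_zero_iff intro!: divide_nonpos_pos)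
  have nz: "\<omega> c \<noteq> 0" if "c \<in> key_gains" for c
    using good that N by (auto simp: key_gains_def sys.nonzero_gains_def)
  have "(\<Prod>c\<in>key_gains. min 1 ((cmod (\<omega> c))\<^sup>2)) > \<rho> powr (- (D - real (N - 1) * k))"
    using no by (auto simp: outage_def not_le)
  then have "log \<rho> (\<Prod>c\<in>key_gains. min 1 ((cmod (\<omega> c))\<^sup>2)) > - (D - real (N - 1) * k)"
    using rho nz by (subst less_log_iff) (auto intro!: prod_pos)
  also have "log \<rho> (\<Prod>c\<in>key_gains. min 1 ((cmod (\<omega> c))\<^sup>2)) = (\<Sum>c\<in>key_gains. log \<rho> (min 1 ((cmod (\<omega> c))\<^sup>2)))"
  proof -
    have "ln (\<Prod>c\<in>key_gains. min 1 ((cmod (\<omega> c))\<^sup>2)) = (\<Sum>c\<in>key_gains. ln (min 1 ((cmod (\<omega> c))\<^sup>2)))"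
    proof (rule ln_prod[OF finite_key_gains])
      fix c assume "c \<in> key_gains"
      then have "0 < min 1 ((cmod (\<omega> c))\<^sup>2)" using nz[of c] by (auto simp: min_def)
      then show "min 1 ((cmod (\<omega> c))\<^sup>2) \<noteq> 0" by linarith
    qed
    then show ?thesis by (simp add: log_def sum_divide_distrib)
  qed
  finally have "(\<Sum>c\<in>key_gains. V c) < D - real (N - 1) * k"
    by (simp add: V_def sum_negf)
  also have "(\<Sum>c\<in>key_gains. V c) = (\<Sum>i<N. V (Dest_Gain i)) + (\<Sum>j\<in>{1..<N}. V (Relay_Gain 0 j))"
    unfolding key_gains_def by (subst sum.union_disjoint) (auto simp: sum.reindex inj_on_def)
  also have "(\<Sum>i<N. V (Dest_Gain i)) = V (Dest_Gain 0) + (\<Sum>j\<in>{1..<N}. V (Dest_Gain j))"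
    using N by (subst lessThan_atLeast0, subst sum.atLeast_Suc_lessThan) auto
  finally have lt: "V (Dest_Gain 0) + (\<Sum>j\<in>{1..<N}. (V (Relay_Gain 0 j) + k) + V (Dest_Gain j)) < D"
    using N by (simp add: sum.distrib of_nat_diff algebra_simps)
  have rateD: "sys.dest_rate l \<omega> t \<ge> L * (1 - V (Dest_Gain i))" if "i \<in> transmitting (fam l) \<omega> t" for l t i
  proof -
    have "i < N" using that sys.transmitting_subset[of l \<omega> t] by auto
    then have "L * (1 - V (Dest_Gain i)) \<le> log 2 (1 + \<rho> * (cmod (\<omega> (Dest_Gain i)))\<^sup>2)"
      using log_gain[OF rho nz[of "Dest_Gain i"], of 1] by (simp add: L_def V_def key_gains_def)
    also have "\<dots> \<le> sys.dest_rate l \<omega> t"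
    proof -
      have "\<rho> * (cmod (\<omega> (Dest_Gain i)))\<^sup>2 \<le> \<rho> * (\<Sum>i\<in>transmitting (fam l) \<omega> t. (cmod (\<omega> (Dest_Gain i)))\<^sup>2)"
        using that rho by (intro mult_left_mono member_le_sum) auto
      moreover have "0 \<le> \<rho> * (cmod (\<omega> (Dest_Gain i)))\<^sup>2" using rho by simp
      ultimately show ?thesis unfolding sys.dest_rate_def fam_simps by (subst log_le_cancel_iff) auto
    qed
    finally show ?thesis .
  qed
  have rate0: "sys.dest_rate l \<omega> t \<ge> 0" for l t
  proof -
    have "0 \<le> \<rho> * (\<Sum>i\<in>transmitting (fam l) \<omega> t. (cmod (\<omega> (Dest_Gain i)))\<^sup>2)"
      using rho by (intro mult_nonneg_nonneg sum_nonneg) auto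
    then show ?thesis unfolding sys.dest_rate_def fam_simps by (subst zero_le_log_cancel_iff) auto
  qed
  have "1 - V (Dest_Gain 0) > r \<or> (\<exists>j\<in>{1..<N}. V (Relay_Gain 0 j) + k < 1 \<and> r / (1 - (V (Relay_Gain 0 j) + k)) < 1 \<and>
    r / (1 - (V (Relay_Gain 0 j) + k)) * (1 - min (V (Dest_Gain 0)) 1) + (1 - r / (1 - (V (Relay_Gain 0 j) + k))) * (1 - V (Dest_Gain j)) > r)"
    by (rule outage_alternative[OF r(1,2) V0 _ _ _ lt]) (use V0 k D in \<open>auto simp: add_nonneg_nonneg\<close>)
  then show ?thesis
  proof (elim disjE bexE conjE)
    assume "1 - V (Dest_Gain 0) > r"
    then have "L * r < L * (1 - V (Dest_Gain 0))" using L by (intro mult_strict_left_mono) auto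
    then have "R \<rho> < L * (1 - V (Dest_Gain 0))" using r(3) by (simp add: L_def mult.commute)
    then show ?thesis by (intro info_ge_source[where ?a0.0="L * (1 - V (Dest_Gain 0))"] rateD) auto
  next
    fix j assume j: "j \<in> {1..<N}" and u: "V (Relay_Gain 0 j) + k < 1"
      and f: "r / (1 - (V (Relay_Gain 0 j) + k)) < 1"
      and gt: "r / (1 - (V (Relay_Gain 0 j) + k)) * (1 - min (V (Dest_Gain 0)) 1) + (1 - r / (1 - (V (Relay_Gain 0 j) + k))) * (1 - V (Dest_Gain j)) > r"
    define u where "u = V (Relay_Gain 0 j) + k"
    define f where "f = r / (1 - u)"
    show ?thesis
    proof (rule info_ge_relay[where b="L * (1 - u)" and f=f and ?a0.0="L * (1 - min (V (Dest_Gain 0)) 1)" and ?a1.0="L * (1 - V (Dest_Gain j))"])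
      show "0 < j" "j < N" using j by auto
      show "L * (1 - u) > 0" using L \<open>V (Relay_Gain 0 j) + k < 1\<close> by (simp add: u_def)
      show "L * (1 - u) \<le> sys.source_relay_rate 0 \<omega> j"
      proof -
        have "L * (1 - V (Relay_Gain 0 j)) + log 2 (\<sigma>v2 / \<sigma>w2) \<le> sys.source_relay_rate 0 \<omega> j"
          unfolding sys.source_relay_rate_def fam_simps L_def V_def
          using j noise_pos by (intro log_gain rho nz) (auto simp: key_gains_def)
        moreover have "- log 2 (\<sigma>v2 / \<sigma>w2) \<le> k * L" using k(2) L by (simp add: L_def field_simps)
        ultimately show ?thesis by (simp add: u_def algebra_simps)
      qed
      \<comment> \<open>An exponent above 1 would give a negative lower bound; capping it at 1 is
        justified because rates are nonnegative.\<close>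
      show "0 \<le> L * (1 - min (V (Dest_Gain 0)) 1)" using L by simp
      show "L * (1 - min (V (Dest_Gain 0)) 1) \<le> sys.dest_rate l \<omega> t" for l t
        using rateD[of 0 l t] rate0[of l t] by (auto simp: min_def)
      show "L * (1 - V (Dest_Gain j)) \<le> sys.dest_rate l \<omega> t" if "j \<in> transmitting (fam l) \<omega> t" for l t
        by (rule rateD[OF that])
      show "R \<rho> / (L * (1 - u)) \<le> f"
      proof -
        have "R \<rho> / (L * (1 - u)) \<le> (r * L) / (L * (1 - u))"
          using r(3) L \<open>V (Relay_Gain 0 j) + k < 1\<close> by (intro divide_right_mono) (auto simp: L_def u_def)
        then show ?thesis using L by (simp add: f_def)
      qed
      show "f < 1" using f unfolding f_def u_def .
      have "L * r < L * (f * (1 - min (V (Dest_Gain 0)) 1) + (1 - f) * (1 - V (Dest_Gain j)))"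
        using gt L unfolding f_def u_def by (intro mult_strict_left_mono) auto
      then show "R \<rho> < f * (L * (1 - min (V (Dest_Gain 0)) 1)) + (1 - f) * (L * (1 - V (Dest_Gain j)))"
        using r(3) by (simp add: L_def algebra_simps)
    qed
  qed
qed

lemma long_code_error_sup_le_powr:
  assumes rho: "\<rho> > 1" and r: "0 < r" "r < 1" "R \<rho> \<le> r * log 2 \<rho>"
    and D: "\<And>x. 1 - r \<le> x \<Longrightarrow> x \<le> 1 \<Longrightarrow> D \<le> x + real (N - 1) * max 0 (1 - r * x / (1 - r))"
    and k: "k \<ge> 0" "k \<ge> - log 2 (\<sigma>v2 / \<sigma>w2) / log 2 \<rho>" and e: "0 < e" "e < 1"
  shows "long_code_error_sup fam
    \<le> enn2real (\<integral>\<^sup>+z. ennreal (min 1 ((cmod z)\<^sup>2) powr (- (1 - e))) \<partial>cgauss 1) ^ card key_gains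
      * \<rho> powr (- (D - real (N - 1) * k) * (1 - e))"
  by (rule order_trans[OF long_code_error_sup_le[OF sets_outage] prob_outage_le[OF e]])
     (rule info_ge_of_not_outage[OF rho r D k])

lemma key_gains_card: "card key_gains = 2 * N - 1"
proof -
  have "card key_gains = card (Dest_Gain ` {..<N}) + card (Relay_Gain 0 ` {1..<N})"
    unfolding key_gains_def by (intro card_Un_disjoint) auto
  also have "\<dots> = N + (N - 1)" by (simp add: card_image inj_on_def)
  finally show ?thesis using N by simp
qed

end

section \<open>The tradeoff curve\<close>

definition dmt :: "nat \<Rightarrow> real \<Rightarrow> real" where
  "dmt N r = (if r \<le> 1 / real N then real N * (1 - r)
    else if r \<le> 1 / 2 then 1 + (real N - 1) * (1 - 2 * r) / (1 - r)
    else (1 - r) / r)"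

text \<open>The right-hand side is convex and piecewise linear in \<open>x\<close>, with slope
  \<open>1 - n * q\<close> left of the kink \<open>1 / q\<close> and slope 1 beyond it. It is
  minimal at \<open>1 - r\<close> if \<open>n * q \<le> 1\<close>, i.e.
  \<open>r \<le> 1 / N\<close>; otherwise at the smaller of 1 and the kink, which is at most 1 for
  \<open>r \<ge> 1 / 2\<close>.\<close>

lemma dmt_le:
  assumes N: "N \<ge> 2" and r: "0 < r" "r < 1" and x: "1 - r \<le> x" "x \<le> 1"
  shows "dmt N r \<le> x + real (N - 1) * max 0 (1 - r * x / (1 - r))"
proof -
  define n where "n = real N - 1"
  have n: "n \<ge> 1" "real (N - 1) = n" "real N = n + 1" using N by (auto simp: n_def of_nat_diff)
  define q where "q = r / (1 - r)"
  have q: "q > 0" "q * (1 - r) = r" "q - r = q * r" using r by (auto simp: q_def field_simps)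
  define s where "s = 1 - q * x"
  have s: "1 - r * x / (1 - r) = s" by (simp add: s_def q_def)
  have s0: "n * s \<le> n * max 0 s" "0 \<le> n * max 0 s" using n by (auto intro!: mult_left_mono)
  consider "r \<le> 1 / (n + 1)" | "r > 1 / (n + 1)" "r \<le> 1 / 2" | "r > 1 / (n + 1)" "r > 1 / 2" by linarith
  then show ?thesis
  proof cases
    case 1
    then have "n * r \<le> 1 - r" using n by (simp add: field_simps)
    then have nq: "n * q \<le> 1" using r by (simp add: q_def field_simps)
    have "(1 - n * q) * (1 - r) \<le> (1 - n * q) * x" using nq x by (intro mult_left_mono) auto
    moreover have "n * q * (1 - r) = n * r" using q(2) by (simp add: mult.assoc)
    ultimately have "(n + 1) * (1 - r) \<le> x + n * s" unfolding s_def by (simp add: algebra_simps)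
    then show ?thesis unfolding s n using 1 s0 by (simp add: dmt_def n)
  next
    case 2
    then have "n * r \<ge> 1 - r" using n by (simp add: field_simps)
    then have nq: "n * q \<ge> 1" using r by (simp add: q_def field_simps)
    have "(n * q - 1) * x \<le> (n * q - 1) * 1" using nq x by (intro mult_left_mono) auto
    then have "1 + n * (1 - q) \<le> x + n * s" by (simp add: s_def algebra_simps)
    moreover have "n * (1 - 2 * r) / (1 - r) = n * (1 - q)" using r by (simp add: q_def field_simps)
    ultimately show ?thesis unfolding s n using 2 s0 by (simp add: dmt_def n)
  next
    case 3
    then have "n * r \<ge> 1 - r" using n by (simp add: field_simps)
    then have nq: "n * q \<ge> 1" using r by (simp add: q_def field_simps)
    have q1: "(1 - r) / r = 1 / q" by (simp add: q_def)
    have "1 / q \<le> x + n * max 0 s"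
    proof (cases "s \<ge> 0")
      case True
      have "1 * (s / q) \<le> n * q * (s / q)" using nq True q(1) by (intro mult_right_mono) auto
      then have "s / q \<le> n * s" using q(1) by simp
      moreover have "1 / q = x + s / q" using q(1) by (simp add: s_def field_simps)
      ultimately show ?thesis using s0 by linarith
    next
      case False
      then have "1 / q \<le> x" using q(1) by (simp add: s_def field_simps)
      then show ?thesis using s0 by linarith
    qed
    then show ?thesis unfolding s n using 3 by (simp add: dmt_def n q1)
  qed
qed

text \<open>The typical outage event: the destination gain of the source is of order \<open>\<rho> powr (- \<alpha>)\<close>,
  those of the relays of order \<open>\<rho> powr (- \<beta>)\<close>, and all gains at the relays are of order 1.\<close>

lemma dmt_witness:
  assumes N: "N \<ge> 2" and r: "0 \<le> r" "r \<le> 1"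
  obtains \<alpha> \<beta> where "0 \<le> \<beta>" "\<beta> \<le> \<alpha>" "\<alpha> \<le> 1" "dmt N r = \<alpha> + real (N - 1) * \<beta>"
    "r * (1 - \<alpha>) + (1 - r) * (1 - \<beta>) = r"
proof -
  have n: "real (N - 1) = real N - 1" using N by (simp add: of_nat_diff)
  \<comment> \<open>In each case \<open>\<alpha>\<close> is the minimising \<open>x\<close> of
    \<open>dmt_le\<close> and \<open>\<beta>\<close> the value
    \<open>1 - r * \<alpha> / (1 - r)\<close> (for \<open>r < 1\<close>).\<close>
  consider "r \<le> 1 / real N" | "r > 1 / real N" "r \<le> 1 / 2" | "r > 1 / real N" "r > 1 / 2" by linarith
  then show ?thesis
  proof cases
    case 1
    show ?thesis
    proof (rule that[of "1 - r" "1 - r"])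
      show "dmt N r = (1 - r) + real (N - 1) * (1 - r)"
        unfolding n using 1 by (simp add: dmt_def algebra_simps)
    qed (use r in \<open>auto simp: algebra_simps\<close>)
  next
    case 2
    define b where "b = (1 - 2 * r) / (1 - r)"
    have b: "0 \<le> b" "b \<le> 1" "(1 - r) * (1 - b) = r" using 2 r by (auto simp: b_def field_simps)
    show ?thesis
    proof (rule that[of b 1])
      show "dmt N r = 1 + real (N - 1) * b"
        unfolding n using 2 by (simp add: dmt_def b_def)
    qed (use b in auto)
  next
    case 3
    define a where "a = (1 - r) / r"
    have a: "0 \<le> a" "a \<le> 1" "r * (1 - a) + (1 - r) = r" using 3 r by (auto simp: a_def field_simps)
    show ?thesis
    proof (rule that[of 0 a])
      show "dmt N r = a + real (N - 1) * 0"
        using 3 by (simp add: dmt_def a_def)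
    qed (use a in auto)
  qed
qed

lemma dmt_nonneg: "N \<ge> 2 \<Longrightarrow> 0 \<le> r \<Longrightarrow> r \<le> 1 \<Longrightarrow> dmt N r \<ge> 0"
  by (erule (2) dmt_witness) simp

text \<open>The normalised rate may approach \<open>r\<close> from above, so the achievability bound
  is applied at points slightly larger than \<open>r\<close>. At the breakpoints the adjacent
  formulas agree.\<close>

lemma dmt_at_right:
  assumes N: "N \<ge> 2" and r: "0 \<le> r" "r < 1"
  shows "(dmt N \<longlongrightarrow> dmt N r) (at_right r)"
proof -
  have N0: "real N > 0" using N by simp
  consider "r < 1 / real N" | "1 / real N \<le> r" "r < 1 / 2" | "1 / 2 \<le> r" by linarith
  then show ?thesis
  proof cases
    case 1
    have "\<forall>\<^sub>F x in at_right r. x < 1 / real N" using eventually_at_right_real[OF 1] by eventually_elim simp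
    then have "\<forall>\<^sub>F x in at_right r. real N * (1 - x) = dmt N x"
      by eventually_elim (simp add: dmt_def)
    moreover have "((\<lambda>x. real N * (1 - x)) \<longlongrightarrow> real N * (1 - r)) (at_right r)"
      by (intro tendsto_intros)
    ultimately show ?thesis using 1 by (auto simp: dmt_def intro: Lim_transform_eventually)
  next
    case 2
    have "\<forall>\<^sub>F x in at_right r. x < 1 / 2" using eventually_at_right_real[OF 2(2)] by eventually_elim simp
    moreover have "\<forall>\<^sub>F x in at_right r. r < x" by (rule eventually_at_right_less)
    ultimately have ev: "\<forall>\<^sub>F x in at_right r. 1 + (real N - 1) * (1 - 2 * x) / (1 - x) = dmt N x"
      by eventually_elim (use 2 in \<open>auto simp: dmt_def\<close>)
    have lim: "((\<lambda>x. 1 + (real N - 1) * (1 - 2 * x) / (1 - x)) \<longlongrightarrow> 1 + (real N - 1) * (1 - 2 * r) / (1 - r)) (at_right r)"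
      using r by (intro tendsto_intros) auto
    have eq: "1 + (real N - 1) * (1 - 2 * r) / (1 - r) = dmt N r"
    proof (cases "r = 1 / real N")
      case True
      then show ?thesis using N0 r N by (simp add: dmt_def field_simps)
    qed (use 2 in \<open>auto simp: dmt_def\<close>)
    show ?thesis using Lim_transform_eventually[OF lim ev] unfolding eq .
  next
    case 3
    have N2: "1 / real N \<le> 1 / 2" using N by (simp add: field_simps)
    have "\<forall>\<^sub>F x in at_right r. r < x" by (rule eventually_at_right_less)
    then have ev: "\<forall>\<^sub>F x in at_right r. (1 - x) / x = dmt N x"
      by eventually_elim (use 3 N2 in \<open>auto simp: dmt_def\<close>)
    have lim: "((\<lambda>x. (1 - x) / x) \<longlongrightarrow> (1 - r) / r) (at_right r)"
      using 3 by (intro tendsto_intros) auto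
    have eq: "(1 - r) / r = dmt N r"
    proof (cases "r = 1 / 2")
      case True
      \<comment> \<open>For \<open>N = 2\<close> the two breakpoints coincide and the first branch
        gives the value at \<open>1 / 2\<close>.\<close>
      have "real N * (1 - 1 / 2) = 1" if "1 / 2 \<le> 1 / real N"
        using that N by (simp add: field_simps)
      then show ?thesis unfolding True by (auto simp: dmt_def)
    qed (use 3 N2 in \<open>auto simp: dmt_def\<close>)
    show ?thesis using Lim_transform_eventually[OF lim ev] unfolding eq .
  qed
qed

section \<open>Asymptotics in the signal-to-noise ratio\<close>

lemma has_diversity_gainI:
  assumes "\<And>e. e > 0 \<Longrightarrow> \<forall>\<^sub>F \<rho> in at_top. \<rho> powr (- (d + e)) \<le> P \<rho>"
    and "\<And>e. e > 0 \<Longrightarrow> \<forall>\<^sub>F \<rho> in at_top. P \<rho> \<le> \<rho> powr (- (d - e))"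
  shows "has_diversity_gain P d"
  unfolding has_diversity_gain_def
proof
  show pos: "\<forall>\<^sub>F \<rho> in at_top. P \<rho> > 0"
    using assms(1)[OF zero_less_one] eventually_gt_at_top[of 0]
    by eventually_elim (auto intro: less_le_trans[rotated])
  show "((\<lambda>\<rho>. - (log 2 (P \<rho>) / log 2 \<rho>)) \<longlongrightarrow> d) at_top"
  proof (rule tendstoI)
    fix e :: real assume e: "e > 0"
    have e2: "e / 2 > 0" using e by simp
    show "\<forall>\<^sub>F \<rho> in at_top. dist (- (log 2 (P \<rho>) / log 2 \<rho>)) d < e"
      using assms(1)[OF e2] assms(2)[OF e2] pos eventually_gt_at_top[of 1]
    proof eventually_elim
      case (elim \<rho>)
      have L: "log 2 \<rho> > 0" using elim by simp
      have "log 2 (\<rho> powr (- (d + e / 2))) \<le> log 2 (P \<rho>)" "log 2 (P \<rho>) \<le> log 2 (\<rho> powr (- (d - e / 2)))"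
        using elim by (subst log_le_cancel_iff; simp)+
      then have "- (d + e / 2) \<le> log 2 (P \<rho>) / log 2 \<rho>" "log 2 (P \<rho>) / log 2 \<rho> \<le> - (d - e / 2)"
        using elim L by (auto simp: log_powr pos_le_divide_eq pos_divide_le_eq)
      then show ?case using e by (simp add: dist_real_def abs_less_iff)
    qed
  qed
qed

lemma eventually_const_mult_powr_le:
  fixes C :: real
  assumes "a < b"
  shows "\<forall>\<^sub>F \<rho> in at_top. C * \<rho> powr a \<le> \<rho> powr b"
proof -
  define c where "c = b - a"
  have "c > 0" using assms by (simp add: c_def)
  then have "filterlim (\<lambda>\<rho>. \<rho> powr c) at_top (at_top :: real filter)"
    by real_asymp
  then have "\<forall>\<^sub>F \<rho> in at_top. C \<le> \<rho> powr (b - a)"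
    unfolding c_def[symmetric] by (simp add: filterlim_at_top)
  then show ?thesis using eventually_gt_at_top[of 0]
  proof eventually_elim
    case (elim \<rho>)
    then have "C * \<rho> powr a \<le> \<rho> powr (b - a) * \<rho> powr a" by (intro mult_right_mono) auto
    then show ?case using elim by (simp add: powr_add[symmetric])
  qed
qed

lemma eventually_const_mult_powr_ge:
  fixes C :: real
  assumes "a < b" "C > 0"
  shows "\<forall>\<^sub>F \<rho> in at_top. \<rho> powr a \<le> C * \<rho> powr b"
  using eventually_const_mult_powr_le[OF assms(1), of "1 / C"]
  by eventually_elim (use assms in \<open>simp add: field_simps\<close>)

lemma log_ratio_tendsto:
  fixes c a :: real
  assumes c: "c > 0"
  shows "((\<lambda>\<rho>. log 2 (1 + \<rho> * (c * \<rho> powr (- a))) / log 2 \<rho>) \<longlongrightarrow> max 0 (1 - a)) at_top"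
proof -
  \<comment> \<open>Which term inside the logarithm dominates depends on the sign of
    \<open>1 - a\<close>.\<close>
  consider "a < 1" | "a = 1" | "a > 1" by linarith
  then show ?thesis
  proof cases
    case 1
    have "((\<lambda>\<rho>. log 2 (1 + \<rho> * (c * \<rho> powr (- a))) / log 2 \<rho>) \<longlongrightarrow> 1 - a) at_top"
      using 1 c by real_asymp
    then show ?thesis using 1 by (simp add: max_def)
  next
    case 2
    have "((\<lambda>\<rho>. log 2 (1 + \<rho> * (c * \<rho> powr (- 1))) / log 2 \<rho>) \<longlongrightarrow> 0) at_top"
      using c by real_asymp
    then show ?thesis using 2 by simp
  next
    case 3
    have "((\<lambda>\<rho>. log 2 (1 + \<rho> * (c * \<rho> powr (- a))) / log 2 \<rho>) \<longlongrightarrow> 0) at_top"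
      using 3 c by real_asymp
    then show ?thesis using 3 by (simp add: max_def)
  qed
qed

lemma log_snr_tendsto_0:
  fixes c a :: real
  assumes "c > 0" "a > 1"
  shows "((\<lambda>\<rho>. log 2 (1 + \<rho> * (c * \<rho> powr (- a)))) \<longlongrightarrow> 0) at_top"
  using assms by real_asymp

text \<open>The exponent identity for \<open>\<alpha>\<close> and \<open>\<beta>\<close> leaves a gap below the rate once both are increased.\<close>

lemma eventually_outage_rate:
  assumes N: "N \<ge> 1" and r: "0 \<le> r" "r \<le> 1" and R: "has_multiplexing_gain R r"
    and R0: "R0 > 0" "\<forall>\<^sub>F \<rho> in at_top. R \<rho> \<ge> R0" and c: "c > 0" and e: "e > 0"
    and ab: "\<beta> \<le> \<alpha>" "\<alpha> \<le> 1" "r * (1 - \<alpha>) + (1 - r) * (1 - \<beta>) = r"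
  shows "\<forall>\<^sub>F \<rho> in at_top. let \<phi> = min 1 (R \<rho> / log 2 (1 + c * \<rho> * real N)) in
    \<phi> * log 2 (1 + \<rho> * \<rho> powr (- (\<alpha> + e))) + (1 - \<phi>) * log 2 (1 + \<rho> * (real N * \<rho> powr (- (\<beta> + e)))) < R \<rho>"
proof (cases "r = 0")
  case True
  \<comment> \<open>For \<open>r = 0\<close> both sides vanish on the scale of
    \<open>log 2 \<rho>\<close>, which decides nothing. Instead the destination rates themselves
    tend to 0 while the rate stays above \<open>R0\<close>.\<close>
  then have b: "\<beta> = 1" "\<alpha> = 1" using ab by auto
  have "((\<lambda>\<rho>. log 2 (1 + \<rho> * (1 * \<rho> powr (- (\<alpha> + e))))) \<longlongrightarrow> 0) at_top"
    "((\<lambda>\<rho>. log 2 (1 + \<rho> * (real N * \<rho> powr (- (\<beta> + e))))) \<longlongrightarrow> 0) at_top"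
    using e b N by (intro log_snr_tendsto_0; simp)+
  then have "\<forall>\<^sub>F \<rho> in at_top. log 2 (1 + \<rho> * (1 * \<rho> powr (- (\<alpha> + e)))) < R0"
    "\<forall>\<^sub>F \<rho> in at_top. log 2 (1 + \<rho> * (real N * \<rho> powr (- (\<beta> + e)))) < R0"
    using R0(1) by (auto intro: order_tendstoD)
  then show ?thesis using R0(2) eventually_gt_at_top[of 1]
  proof eventually_elim
    case (elim \<rho>)
    define \<phi> where "\<phi> = min 1 (R \<rho> / log 2 (1 + c * \<rho> * real N))"
    have "0 < c * \<rho> * real N" using c elim N by (intro mult_pos_pos) auto
    then have "log 2 (1 + c * \<rho> * real N) > 0" by (subst zero_less_log_cancel_iff) auto
    then have phi: "0 \<le> \<phi>" "\<phi> \<le> 1" using elim R0(1) by (auto simp: \<phi>_def)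
    have "\<phi> * log 2 (1 + \<rho> * \<rho> powr (- (\<alpha> + e))) + (1 - \<phi>) * log 2 (1 + \<rho> * (real N * \<rho> powr (- (\<beta> + e)))) < R0"
      using phi elim by (intro convex_bound_lt) auto
    then show ?case using elim unfolding \<phi>_def[symmetric] Let_def by linarith
  qed
next
  case False
  then have r0: "r > 0" using r by simp
  define \<phi> where "\<phi> \<rho> = min 1 (R \<rho> / log 2 (1 + c * \<rho> * real N))" for \<rho>
  have R: "((\<lambda>\<rho>. R \<rho> / log 2 \<rho>) \<longlongrightarrow> r) at_top" using R by (simp add: has_multiplexing_gain_def)
  have B: "((\<lambda>\<rho>. log 2 (1 + \<rho> * ((c * real N) * \<rho> powr (- 0))) / log 2 \<rho>) \<longlongrightarrow> max 0 (1 - 0)) at_top"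
    using c N by (intro log_ratio_tendsto) simp
  have "((\<lambda>\<rho>. min 1 ((R \<rho> / log 2 \<rho>) / (log 2 (1 + \<rho> * ((c * real N) * \<rho> powr (- 0))) / log 2 \<rho>))) \<longlongrightarrow> min 1 (r / max 0 (1 - 0))) at_top"
    by (intro tendsto_min tendsto_const tendsto_divide R B) simp
  moreover have "\<forall>\<^sub>F \<rho> in at_top. min 1 ((R \<rho> / log 2 \<rho>) / (log 2 (1 + \<rho> * ((c * real N) * \<rho> powr (- 0))) / log 2 \<rho>)) = \<phi> \<rho>"
    using eventually_gt_at_top[of 1]
  proof eventually_elim
    case (elim \<rho>)
    then have "log 2 \<rho> \<noteq> 0" by (simp add: log_def)
    then show ?case by (simp add: \<phi>_def mult_ac)
  qed
  ultimately have "(\<phi> \<longlongrightarrow> min 1 (r / max 0 (1 - 0))) at_top"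
    by (rule Lim_transform_eventually)
  moreover have "min 1 (r / max 0 (1 - 0)) = r" using r by simp
  ultimately have phi: "(\<phi> \<longlongrightarrow> r) at_top" by simp
  have A: "((\<lambda>\<rho>. log 2 (1 + \<rho> * (1 * \<rho> powr (- (\<alpha> + e)))) / log 2 \<rho>) \<longlongrightarrow> max 0 (1 - (\<alpha> + e))) at_top"
    "((\<lambda>\<rho>. log 2 (1 + \<rho> * (real N * \<rho> powr (- (\<beta> + e)))) / log 2 \<rho>) \<longlongrightarrow> max 0 (1 - (\<beta> + e))) at_top"
    using N by (intro log_ratio_tendsto; simp)+
  have "((\<lambda>\<rho>. \<phi> \<rho> * (log 2 (1 + \<rho> * (1 * \<rho> powr (- (\<alpha> + e)))) / log 2 \<rho>)
      + (1 - \<phi> \<rho>) * (log 2 (1 + \<rho> * (real N * \<rho> powr (- (\<beta> + e)))) / log 2 \<rho>) - R \<rho> / log 2 \<rho>)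
    \<longlongrightarrow> r * max 0 (1 - (\<alpha> + e)) + (1 - r) * max 0 (1 - (\<beta> + e)) - r) at_top"
    by (intro tendsto_intros phi A R)
  \<comment> \<open>If \<open>\<alpha> < 1\<close>, the increase by \<open>e\<close> makes the first
    term strictly smaller. If \<open>\<alpha> = 1\<close>, the exponent identity and
    \<open>r > 0\<close> force \<open>r < 1\<close> and \<open>\<beta> < 1\<close>, and the second
    term becomes strictly smaller.\<close>
  moreover have "r * max 0 (1 - (\<alpha> + e)) + (1 - r) * max 0 (1 - (\<beta> + e)) - r < 0"
  proof (cases "\<alpha> < 1")
    case True
    have "r * max 0 (1 - (\<alpha> + e)) < r * (1 - \<alpha>)" using True e r0 by (intro mult_strict_left_mono) auto
    moreover have "(1 - r) * max 0 (1 - (\<beta> + e)) \<le> (1 - r) * (1 - \<beta>)" using ab e r by (intro mult_left_mono) auto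
    ultimately show ?thesis using ab by linarith
  next
    case False
    then have a: "\<alpha> = 1" using ab by simp
    then have *: "(1 - r) * (1 - \<beta>) = r" using ab by simp
    then have "1 - r \<noteq> 0" "\<beta> \<noteq> 1" using r0 by auto
    then have "(1 - r) * max 0 (1 - (\<beta> + e)) < (1 - r) * (1 - \<beta>)" using ab a e r by (intro mult_strict_left_mono) auto
    then show ?thesis using * a e by simp
  qed
  ultimately have "\<forall>\<^sub>F \<rho> in at_top. \<phi> \<rho> * (log 2 (1 + \<rho> * (1 * \<rho> powr (- (\<alpha> + e)))) / log 2 \<rho>)
      + (1 - \<phi> \<rho>) * (log 2 (1 + \<rho> * (real N * \<rho> powr (- (\<beta> + e)))) / log 2 \<rho>) - R \<rho> / log 2 \<rho> < 0"
    by (rule order_tendstoD(2))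
  then show ?thesis using eventually_gt_at_top[of 1]
  proof eventually_elim
    case (elim \<rho>)
    have L: "log 2 \<rho> > 0" using elim by simp
    have "(\<phi> \<rho> * log 2 (1 + \<rho> * \<rho> powr (- (\<alpha> + e))) + (1 - \<phi> \<rho>) * log 2 (1 + \<rho> * (real N * \<rho> powr (- (\<beta> + e)))) - R \<rho>) / log 2 \<rho> < 0"
      using elim by (simp add: add_divide_distrib diff_divide_distrib)
    then show ?case using L unfolding Let_def \<phi>_def by (simp add: divide_less_0_iff)
  qed
qed

lemma eventually_ddf_long:
  assumes "N \<ge> 2" "\<sigma>w2 > 0" "\<sigma>v2 > 0" "\<exists>R0>0. \<forall>\<^sub>F \<rho> in at_top. R \<rho> \<ge> R0" "admissible_margin \<mu>"
  shows "\<forall>\<^sub>F \<rho> in at_top. ddf_long N \<sigma>w2 \<sigma>v2 R \<mu> \<rho>"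
proof -
  obtain R0 where R0: "R0 > 0" "\<forall>\<^sub>F \<rho> in at_top. R \<rho> \<ge> R0" using assms by auto
  from R0(2) eventually_gt_at_top[of 0] show ?thesis
    by eventually_elim (use assms R0(1) in \<open>auto simp: ddf_long_def\<close>)
qed

lemma long_code_error_inf_lower:
  assumes N: "N \<ge> 2" and pos: "\<sigma>w2 > 0" "\<sigma>v2 > 0" and r: "0 \<le> r" "r \<le> 1"
    and R: "has_multiplexing_gain R r" and R0: "\<exists>R0>0. \<forall>\<^sub>F \<rho> in at_top. R \<rho> \<ge> R0" and \<mu>: "admissible_margin \<mu>"
    and e: "e > 0"
  shows "\<forall>\<^sub>F \<rho> in at_top. \<rho> powr (- (dmt N r + e)) \<le> long_code_error_inf (ddf_family N \<sigma>w2 \<sigma>v2 R \<mu> \<rho>)"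
proof -
  obtain \<alpha> \<beta> where ab: "0 \<le> \<beta>" "\<beta> \<le> \<alpha>" "\<alpha> \<le> 1" "dmt N r = \<alpha> + real (N - 1) * \<beta>"
    "r * (1 - \<alpha>) + (1 - r) * (1 - \<beta>) = r"
    using dmt_witness[OF N r] .
  obtain R1 where R1: "R1 > 0" "\<forall>\<^sub>F \<rho> in at_top. R \<rho> \<ge> R1" using R0 by auto
  \<comment> \<open>The \<open>N\<close> destination exponents raised by \<open>\<eta>\<close> cost
    \<open>e / 2\<close> in total; the remaining \<open>e / 2\<close> absorbs the constant
    \<open>K\<close>.\<close>
  define \<eta> where "\<eta> = e / (2 * real N)"
  define K where "K = (2 * exp (- 1) / pi) ^ (N + N * N)"
  have eta: "\<eta> > 0" using e N by (simp add: \<eta>_def)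
  have c: "\<sigma>v2 / \<sigma>w2 > 0" using pos by simp
  have K: "K > 0" by (simp add: K_def)
  have N1: "N \<ge> 1" using N by simp
  have ex: "(\<alpha> + \<eta>) + real (N - 1) * (\<beta> + \<eta>) = dmt N r + e / 2"
    using N by (simp add: ab(4) \<eta>_def of_nat_diff field_simps)
  have "- (dmt N r + e) < - (dmt N r + e / 2)" using e by simp
  from eventually_const_mult_powr_ge[OF this K]
    eventually_outage_rate[OF N1 r R R1 c eta ab(2,3,5)]
    eventually_ddf_long[OF N pos R0 \<mu>] eventually_gt_at_top[of 1]
  show ?thesis
  proof eventually_elim
    case (elim \<rho>)
    interpret ddf_long N \<sigma>w2 \<sigma>v2 R \<mu> \<rho> by fact
    have "K * (\<rho> powr (- (\<alpha> + \<eta>)) * (\<rho> powr (- (\<beta> + \<eta>))) ^ (N - 1)) \<le> long_code_error_inf fam"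
      unfolding K_def
    proof (rule long_code_error_inf_ge_powr)
      show "\<rho> powr (- (\<alpha> + \<eta>)) \<le> \<rho> powr (- (\<beta> + \<eta>))" using elim ab by (intro powr_mono) auto
      show "\<rho> powr (- (\<beta> + \<eta>)) \<le> 1" using elim ab eta powr_mono[of "- (\<beta> + \<eta>)" 0 \<rho>] by simp
    qed (use elim in \<open>auto simp: Let_def\<close>)
    also have "\<rho> powr (- (\<alpha> + \<eta>)) * (\<rho> powr (- (\<beta> + \<eta>))) ^ (N - 1) = \<rho> powr (- (dmt N r + e / 2))"
    proof -
      have "(\<rho> powr (- (\<beta> + \<eta>))) ^ (N - 1) = (\<rho> powr (- (\<beta> + \<eta>))) powr real (N - 1)"
        using elim by (intro powr_realpow[symmetric]) simp
      also have "\<dots> = \<rho> powr (- (real (N - 1) * (\<beta> + \<eta>)))"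
        unfolding powr_powr by (simp only: mult_minus_left mult.commute)
      finally show ?thesis unfolding ex[symmetric] minus_add_distrib powr_add by simp
    qed
    finally show ?case using elim by linarith
  qed
qed

lemma long_code_error_sup_upper:
  assumes N: "N \<ge> 2" and pos: "\<sigma>w2 > 0" "\<sigma>v2 > 0" and r: "0 \<le> r" "r \<le> 1"
    and R: "has_multiplexing_gain R r" and R0: "\<exists>R0>0. \<forall>\<^sub>F \<rho> in at_top. R \<rho> \<ge> R0" and \<mu>: "admissible_margin \<mu>"
    and e: "e > 0"
  shows "\<forall>\<^sub>F \<rho> in at_top. long_code_error_sup (ddf_family N \<sigma>w2 \<sigma>v2 R \<mu> \<rho>) \<le> \<rho> powr (- (dmt N r - e))"
proof (cases "r = 1")
  case True
  \<comment> \<open>At \<open>r = 1\<close> there is no room for a point between \<open>r\<close>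
    and 1; the tradeoff is 0 there, and error probabilities are at most 1.\<close>
  have "1 / real N \<le> 1 / 2" using N by (simp add: field_simps)
  then have d: "dmt N r = 0" using True by (simp add: dmt_def)
  show ?thesis
    using eventually_ddf_long[OF N pos R0 \<mu>] eventually_gt_at_top[of 1]
  proof eventually_elim
    case (elim \<rho>)
    interpret ddf_long N \<sigma>w2 \<sigma>v2 R \<mu> \<rho> by fact
    have "1 \<le> \<rho> powr e" using elim e by (intro ge_one_powr_ge_zero) auto
    then show ?case using long_code_error_sup_le_1 by (simp add: d)
  qed
next
  case False
  then have r1: "r < 1" using r by simp
  define d where "d = dmt N r"
  have d0: "d \<ge> 0" unfolding d_def by (rule dmt_nonneg[OF N r])
  have "\<forall>\<^sub>F x in at_right r. dmt N x > d - e / 4"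
    using dmt_at_right[OF N r(1) r1] e by (intro order_tendstoD(1)) (auto simp: d_def)
  moreover have "\<forall>\<^sub>F x in at_right r. x < 1" using eventually_at_right_real[OF r1] by eventually_elim simp
  moreover have "\<forall>\<^sub>F x in at_right r. r < x" by (rule eventually_at_right_less)
  ultimately have "\<forall>\<^sub>F x in at_right r. dmt N x > d - e / 4 \<and> x < 1 \<and> r < x" by eventually_elim auto
  \<comment> \<open>A rate slightly above the limit: eventually
    \<open>R \<rho> \<le> x * log 2 \<rho>\<close>, at a loss of less than \<open>e / 4\<close> in
    the exponent.\<close>
  then obtain x where x: "dmt N x > d - e / 4" "x < 1" "r < x"
    using eventually_happens'[OF trivial_limit_at_right_real] by blast
  have x0: "0 < x" using x r by simp
  \<comment> \<open>The fractional moment costs \<open>d * h \<le> e / 4\<close>; dividing by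
    \<open>d + 1\<close> rather than \<open>d\<close> also covers \<open>d = 0\<close>. A further
    \<open>e / 4\<close> goes to the noise ratio through \<open>\<kappa>\<close>, and the last
    quarter beats the constant \<open>C\<close>.\<close>
  define d1 where "d1 = d + 1"
  have d1: "d1 > 0" "d \<le> d1" using d0 by (auto simp: d1_def)
  define h where "h = min (1 / 2) (e / (4 * d1))"
  have h: "0 < h" "h < 1" using e d1 by (auto simp: h_def)
  have "d * h \<le> d1 * (e / (4 * d1))" using d1 h by (intro mult_mono) (auto simp: h_def)
  also have "\<dots> = e / 4" using d1 by simp
  finally have dh: "d * h \<le> e / 4" .
  define C where "C = enn2real (\<integral>\<^sup>+z. ennreal (min 1 ((cmod z)\<^sup>2) powr (- (1 - h))) \<partial>cgauss 1) ^ (2 * N - 1)"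
  define \<kappa> where "\<kappa> = e / (4 * real N)"
  have kap: "\<kappa> > 0" using e N by (simp add: \<kappa>_def)
  have "((\<lambda>\<rho>. - log 2 (\<sigma>v2 / \<sigma>w2) / log 2 \<rho>) \<longlongrightarrow> 0) at_top" by real_asymp
  then have ev1: "\<forall>\<^sub>F \<rho> in at_top. - log 2 (\<sigma>v2 / \<sigma>w2) / log 2 \<rho> < \<kappa>"
    using kap by (rule order_tendstoD(2))
  have ev2: "\<forall>\<^sub>F \<rho> in at_top. R \<rho> / log 2 \<rho> < x"
    using R x(3) unfolding has_multiplexing_gain_def by (rule order_tendstoD(2))
  have ex: "- (dmt N x - real (N - 1) * \<kappa>) * (1 - h) \<le> - (d - 3 / 4 * e)"
  proof -
    have "real (N - 1) * \<kappa> \<le> real N * \<kappa>" using kap by (intro mult_right_mono) auto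
    also have "\<dots> = e / 4" using N by (simp add: \<kappa>_def)
    finally have "d - e / 2 \<le> dmt N x - real (N - 1) * \<kappa>" using x(1) by linarith
    then have "(d - e / 2) * (1 - h) \<le> (dmt N x - real (N - 1) * \<kappa>) * (1 - h)"
      using h by (intro mult_right_mono) auto
    moreover have "(d - e / 2) * (1 - h) = d - e / 2 - d * h + e * h / 2" by (simp add: field_simps)
    moreover have "0 \<le> e * h / 2" using e h by simp
    ultimately show ?thesis using dh by linarith
  qed
  have "- (d - 3 / 4 * e) < - (d - e)" using e by simp
  from eventually_const_mult_powr_le[OF this, of C] ev1 ev2
    eventually_ddf_long[OF N pos R0 \<mu>] eventually_gt_at_top[of 1]
  show ?thesis
  proof eventually_elim
    case (elim \<rho>)
    interpret ddf_long N \<sigma>w2 \<sigma>v2 R \<mu> \<rho> by fact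
    have Rx: "R \<rho> \<le> x * log 2 \<rho>" using elim by (simp add: pos_divide_less_eq)
    have "long_code_error_sup fam
      \<le> enn2real (\<integral>\<^sup>+z. ennreal (min 1 ((cmod z)\<^sup>2) powr (- (1 - h))) \<partial>cgauss 1) ^ card key_gains
      * \<rho> powr (- (dmt N x - real (N - 1) * \<kappa>) * (1 - h))"
      by (rule long_code_error_sup_le_powr[OF _ x0 x(2) Rx dmt_le[OF assms(1) x0 x(2)] _ _ h])
        (use elim kap in auto)
    also have "\<dots> \<le> C * \<rho> powr (- (d - 3 / 4 * e))"
      unfolding C_def key_gains_card using ex elim by (intro mult_left_mono powr_mono) auto
    also have "\<dots> \<le> \<rho> powr (- (d - e))" by fact
    finally show ?case by (simp add: d_def)
  qed
qed

theorem theorem5: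
  fixes N :: nat and \<sigma>w2 \<sigma>v2 r :: real and R :: "real \<Rightarrow> real" and \<mu> :: "nat \<Rightarrow> nat"
  assumes "N \<ge> 2" and "\<sigma>w2 > 0" and "\<sigma>v2 > 0"
    and "0 \<le> r" and "r \<le> 1"
    and "has_multiplexing_gain R r"
    and "\<exists>R0>0. \<forall>\<^sub>F \<rho> in at_top. R \<rho> \<ge> R0"
    and "admissible_margin \<mu>"
  shows "let d = (if r \<le> 1 / real N then real N * (1 - r)
                  else if r \<le> 1 / 2 then 1 + (real N - 1) * (1 - 2 * r) / (1 - r)
                  else (1 - r) / r)
         in has_diversity_gain (\<lambda>\<rho>. long_code_error_sup (ddf_family N \<sigma>w2 \<sigma>v2 R \<mu> \<rho>)) d
          \<and> has_diversity_gain (\<lambda>\<rho>. long_code_error_inf (ddf_family N \<sigma>w2 \<sigma>v2 R \<mu> \<rho>)) d"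
proof -
  let ?sup = "\<lambda>\<rho>. long_code_error_sup (ddf_family N \<sigma>w2 \<sigma>v2 R \<mu> \<rho>)"
  let ?inf = "\<lambda>\<rho>. long_code_error_inf (ddf_family N \<sigma>w2 \<sigma>v2 R \<mu> \<rho>)"
  \<comment> \<open>The lower bound is available for the limes inferior and the upper bound for the
    limes superior; their order transfers each bound to the other quantity.\<close>
  have le: "\<forall>\<^sub>F \<rho> in at_top. ?inf \<rho> \<le> ?sup \<rho>"
    using eventually_ddf_long[OF assms(1-3,7,8)]
    by eventually_elim (rule ddf_long.long_code_error_inf_le_sup)
  note lower = long_code_error_inf_lower[OF assms] and upper = long_code_error_sup_upper[OF assms]
  have "has_diversity_gain ?sup (dmt N r)"
  proof (rule has_diversity_gainI)
    show "\<forall>\<^sub>F \<rho> in at_top. \<rho> powr (- (dmt N r + e)) \<le> ?sup \<rho>" if "e > 0" for e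
      using lower[OF that] le by eventually_elim linarith
  qed (rule upper)
  moreover have "has_diversity_gain ?inf (dmt N r)"
  proof (rule has_diversity_gainI)
    show "\<forall>\<^sub>F \<rho> in at_top. ?inf \<rho> \<le> \<rho> powr (- (dmt N r - e))" if "e > 0" for e
      using upper[OF that] le by eventually_elim linarith
  qed (rule lower)
  ultimately show ?thesis unfolding Let_def dmt_def by blast
qed

end
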